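(* (a) If $(c_nT_n)_{n\ge1}$ is a tight sequence of rescaled finite trees, then some subsequence converges to some long dendron. (b) If $(T_n,d_n,\mu_n)_{n\ge1}$ is a tight sequence of measured real trees, then some subsequence converges to some long dendron. (c) If $(D_n)_{n\ge1}$ is a tight sequence of long dendrons, then some subsequence converges to some long dendron.
   Context: For $1\le r<\infty$, $M_r$ is the space of real $r\times r$ matrices and $\mathcal P(M_r)$ the space of Borel probability measures on it with the weak topology. For a probability space $(X,\mu)$ with a measurable function $d:X^2\to\mathbb R$, $\tau_r(X,d,\mu)\in\mathcal P(M_r)$ is the distribution of $(d(\xi_i,\xi_j)\mathbf 1\{i\neq j\})_{i,j=1}^r$, where $\xi_1,\dots,\xi_r$ are i.i.d. with distribution $\mu$. For a finite tree $T$ and $c>0$, the rescaled tree $cT$ is the vertex set of $T$ with metric $c$ times graph distance and the uniform probability measure on the vertices. A real tree is a complete non-empty metric space $(T,d)$ such that for any distinct $x,y\in T$ there is a unique isometric map $\gamma:[0,d(x,y)]\to T$ with $\gamma(0)=x$, $\gamma(d(x,y))=y$, and moreover for every $s\in(0,d(x,y))$, $x$ and $y$ are in different components of $T\setminus\{\gamma(s)\}$. A measured real tree $(T,d,\mu)$ is a separable real tree with a Borel probability measure $\mu$. A branch of $T$ is a connected component of $T\setminus\{p\}$ for some $p\in T$. A long dendron $D=(T,d,\nu)$ is a real tree $(T,d)$ with a Borel probability measure $\nu$ on $A_D:=T\times[0,\infty)$ such that $\nu(B\times[0,\infty))>0$ for every branch $B$ of $T$; $d_D((x,a),(y,b)):=d(x,y)+a+b$,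 and $\tau_r(D):=\tau_r(A_D,d_D,\nu)$. A sequence of objects $X_n$ (rescaled finite trees, measured real trees, or long dendrons) converges to a long dendron $D$ if $\tau_r(X_n)\to\tau_r(D)$ in $\mathcal P(M_r)$ for every $r\ge1$. A set of rescaled trees (resp. measured real trees, long dendrons) is tight if the set of real random variables given by the distance between two independent random points is tight: for rescaled trees $c_nd_n(\xi_1,\xi_2)$ with $\xi_1,\xi_2$ independent uniform vertices of $T_n$ and $d_n$ the graph distance; for measured real trees $d_n(\xi_1,\xi_2)$ with $\xi_i\sim\mu_n$ independent; for long dendrons $d_{D_n}(\xi_1,\xi_2)$ with $\xi_i\sim\nu_n$ independent. *)

theory Defs
  imports "HOL-Probability.Probability"
begin

section \<open>Borel probability measures and weak convergence on abstract topological spaces\<close>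

definition borel_of :: "'a topology \<Rightarrow> 'a measure" where
  "borel_of X = sigma (topspace X) {U. openin X U}"

definition borel_prob_measures :: "'a topology \<Rightarrow> 'a measure set" where
  "borel_prob_measures X = {M. prob_space M \<and> sets M = sets (borel_of X)}"

definition weakly_converges :: "'a topology \<Rightarrow> (nat \<Rightarrow> 'a measure) \<Rightarrow> 'a measure \<Rightarrow> bool" where
  "weakly_converges X M L \<longleftrightarrow>
     (\<forall>n. M n \<in> borel_prob_measures X) \<and> L \<in> borel_prob_measures X \<and>
     (\<forall>f. continuous_map X euclideanreal f \<and> bounded (f ` topspace X) \<longrightarrow>
          (\<lambda>n. \<integral>x. f x \<partial>M n) \<longlonglongrightarrow> (\<integral>x. f x \<partial>L))"

section \<open>Distance matrices of random points\<close>

text \<open>A real r-by-r matrix is an extensional function on \<open>{1..r} \<times> {1..r}\<close>, since the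
  size r has to be quantified over inside the notion of convergence.\<close>

definition matrix_topology :: "nat \<Rightarrow> (nat \<times> nat \<Rightarrow> real) topology" where
  "matrix_topology r = product_topology (\<lambda>_. euclideanreal) ({1..r} \<times> {1..r})"

definition distance_matrix :: "nat \<Rightarrow> ('a \<Rightarrow> 'a \<Rightarrow> real) \<Rightarrow> (nat \<Rightarrow> 'a) \<Rightarrow> nat \<times> nat \<Rightarrow> real" where
  "distance_matrix r d \<xi> =
     (\<lambda>(i, j) \<in> {1..r} \<times> {1..r}. if i \<noteq> j then d (\<xi> i) (\<xi> j) else 0)"

definition tau :: "nat \<Rightarrow> ('a \<Rightarrow> 'a \<Rightarrow> real) \<Rightarrow> 'a measure \<Rightarrow> (nat \<times> nat \<Rightarrow> real) measure" where
  "tau r d \<mu> =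
     distr (Pi\<^sub>M {1..r} (\<lambda>_. \<mu>)) (borel_of (matrix_topology r)) (distance_matrix r d)"

definition distance_law :: "('a \<Rightarrow> 'a \<Rightarrow> real) \<Rightarrow> 'a measure \<Rightarrow> real measure" where
  "distance_law d \<mu> = distr (\<mu> \<Otimes>\<^sub>M \<mu>) borel (\<lambda>(x, y). d x y)"

section \<open>Finite trees\<close>

definition finite_simple_graph :: "'v set \<Rightarrow> 'v set set \<Rightarrow> bool" where
  "finite_simple_graph V E \<longleftrightarrow>
     finite V \<and> E \<subseteq> {{u, v} | u v. u \<in> V \<and> v \<in> V \<and> u \<noteq> v}"

definition walk :: "'v set \<Rightarrow> 'v set set \<Rightarrow> 'v \<Rightarrow> 'v list \<Rightarrow> 'v \<Rightarrow> bool" where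
  "walk V E u xs v \<longleftrightarrow>
     xs \<noteq> [] \<and> set xs \<subseteq> V \<and> hd xs = u \<and> last xs = v \<and> successively (\<lambda>a b. {a, b} \<in> E) xs"

definition graph_cycle :: "'v set \<Rightarrow> 'v set set \<Rightarrow> 'v list \<Rightarrow> bool" where
  "graph_cycle V E xs \<longleftrightarrow>
     3 \<le> length xs \<and> distinct xs \<and> walk V E (hd xs) xs (last xs) \<and> {last xs, hd xs} \<in> E"

definition finite_tree :: "'v set \<Rightarrow> 'v set set \<Rightarrow> bool" where
  "finite_tree V E \<longleftrightarrow>
     finite_simple_graph V E \<and> V \<noteq> {} \<and>
     (\<forall>u\<in>V. \<forall>v\<in>V. \<exists>xs. walk V E u xs v) \<and>
     (\<nexists>xs. graph_cycle V E xs)"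

definition graph_dist :: "'v set \<Rightarrow> 'v set set \<Rightarrow> 'v \<Rightarrow> 'v \<Rightarrow> nat" where
  "graph_dist V E u v = (LEAST n. \<exists>xs. walk V E u xs v \<and> length xs = Suc n)"

definition rescaled_dist :: "real \<Rightarrow> 'v set \<Rightarrow> 'v set set \<Rightarrow> 'v \<Rightarrow> 'v \<Rightarrow> real" where
  "rescaled_dist c V E u v = c * real (graph_dist V E u v)"

section \<open>Real trees and long dendrons\<close>

text \<open>Extensionality makes a geodesic a function with domain exactly \<open>{0..mdist T x y}\<close>, so that
  uniqueness of geodesics is \<open>\<exists>!\<close>.\<close>

definition geodesic :: "'a metric \<Rightarrow> 'a \<Rightarrow> 'a \<Rightarrow> (real \<Rightarrow> 'a) \<Rightarrow> bool" where
  "geodesic T x y \<gamma> \<longleftrightarrow>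
     \<gamma> \<in> {0..mdist T x y} \<rightarrow>\<^sub>E mspace T \<and>
     (\<forall>s\<in>{0..mdist T x y}. \<forall>t\<in>{0..mdist T x y}. mdist T (\<gamma> s) (\<gamma> t) = \<bar>s - t\<bar>) \<and>
     \<gamma> 0 = x \<and> \<gamma> (mdist T x y) = y"

definition minus_point :: "'a metric \<Rightarrow> 'a \<Rightarrow> 'a topology" where
  "minus_point T p = subtopology (mtopology_of T) (mspace T - {p})"

definition real_tree :: "'a metric \<Rightarrow> bool" where
  "real_tree T \<longleftrightarrow>
     mspace T \<noteq> {} \<and> mcomplete_of T \<and>
     (\<forall>x\<in>mspace T. \<forall>y\<in>mspace T. x \<noteq> y \<longrightarrow>
        (\<exists>!\<gamma>. geodesic T x y \<gamma>) \<and>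
        (\<forall>\<gamma>. geodesic T x y \<gamma> \<longrightarrow>
           (\<forall>s\<in>{0<..<mdist T x y}. \<not> connected_component_of (minus_point T (\<gamma> s)) x y)))"

definition measured_real_tree :: "'a metric \<Rightarrow> 'a measure \<Rightarrow> bool" where
  "measured_real_tree T \<mu> \<longleftrightarrow>
     real_tree T \<and> separable_space (mtopology_of T) \<and>
     \<mu> \<in> borel_prob_measures (mtopology_of T)"

definition branches :: "'a metric \<Rightarrow> 'a set set" where
  "branches T = (\<Union>p\<in>mspace T. connected_components_of (minus_point T p))"

definition long_dendron :: "'a metric \<Rightarrow> ('a \<times> real) measure \<Rightarrow> bool" where
  "long_dendron T \<nu> \<longleftrightarrow>
     real_tree T \<and>
     \<nu> \<in> borel_prob_measures (prod_topology (mtopology_of T) (top_of_set {0..})) \<and>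
     (\<forall>B\<in>branches T. measure \<nu> (B \<times> {0..}) > 0)"

text \<open>On the diagonal this is \<open>a + b\<close>, not 0, so it is not a metric.\<close>

definition dendron_dist :: "'a metric \<Rightarrow> 'a \<times> real \<Rightarrow> 'a \<times> real \<Rightarrow> real" where
  "dendron_dist T = (\<lambda>(x, a) (y, b). mdist T x y + a + b)"

definition converges_to_dendron ::
    "(nat \<Rightarrow> 'a \<Rightarrow> 'a \<Rightarrow> real) \<Rightarrow> (nat \<Rightarrow> 'a measure) \<Rightarrow>
     'b metric \<Rightarrow> ('b \<times> real) measure \<Rightarrow> bool" where
  "converges_to_dendron d \<mu> T \<nu> \<longleftrightarrow>
     (\<forall>r\<ge>1. weakly_converges (matrix_topology r)
               (\<lambda>n. tau r (d n) (\<mu> n)) (tau r (dendron_dist T) \<nu>))"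

text \<open>A long dendron is separable, because all its branches have positive measure, and hence has
  at most continuum many points. Looking for the limit among those with points in
  \<open>nat \<Rightarrow> real\<close> is therefore no restriction, up to isometry.\<close>

definition subseq_converges_to_some_dendron ::
    "(nat \<Rightarrow> 'a \<Rightarrow> 'a \<Rightarrow> real) \<Rightarrow> (nat \<Rightarrow> 'a measure) \<Rightarrow> bool" where
  "subseq_converges_to_some_dendron d \<mu> \<longleftrightarrow>
     (\<exists>k :: nat \<Rightarrow> nat. strict_mono k \<and>
        (\<exists>(T :: (nat \<Rightarrow> real) metric) \<nu>.
           long_dendron T \<nu> \<and> converges_to_dendron (d \<circ> k) (\<mu> \<circ> k) T \<nu>))"

end

theory Submission
  imports Defs "HOL-Complex_Analysis.Great_Picard" "HOL-Library.Transitive_Closure_Table"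
begin

text \<open>Root each tree at a point with tight distances to a random point, and let \<open>h\<close> be the height and
  \<open>K\<close> the Gromov product at the root, so that \<open>d = h + h' - 2 K\<close> and \<open>K\<close> is ultrametric,
  \<open>min (K x y) (K y z) \<le> K x z\<close>. After restricting to finitely many tree points, a depth-first order
  makes \<open>K x z\<close> the minimum of \<open>K x y\<close> and \<open>K y z\<close> for \<open>y\<close> between \<open>x\<close> and \<open>z\<close>. Spreading the
  mass over \<open>(0, 1)\<close> in this order turns \<open>K\<close> into a kernel \<open>g s t\<close> that is monotone in both arguments,
  so Helly's selection principle yields a limit kernel, while the joint laws of the uniform position
  and the height are tight in the plane. The limit kernel determines a real tree, on which a position
  \<open>s\<close> marks the supremum of the branch points \<open>g s t\<close>, and the excess of the height over that
  supremum becomes the second coordinate of the long dendron.\<close>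

section \<open>Geodesics\<close>

text \<open>All three kinds of objects enter through \<open>tree_space\<close>: a pseudometric with
  the four-point condition plus a nonnegative extra length at each point, so one theorem serves (a),
  (b) and (c). The restriction to finitely many points is what makes a depth-first order available,
  since that order is built by inserting points one at a time; its cost vanishes because a sample
  point moves only a little outside an event of small probability. Spreading the mass uniformly
  gives all trees of the sequence the same law of positions, so that only kernels and heights vary,
  and a monotone limit kernel is controlled off a countable set of positions by countably many
  rational values. The limit kernel lives on pairs \<open>s < t\<close>: independent uniform
  positions almost surely differ and avoid any given countable set, and \<open>tau\<close> evaluates
  distances at distinct indices only. The supremum of the branch points along a position can stay
  strictly below the limit height. Stars with unit edges show this: their limit tree is a single
  point and all distance comes from the second coordinate, so the limit has to be a long dendron and
  not a measured real tree.\<close>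

lemma geodesic_D:
  assumes "geodesic T x y \<gamma>" "s \<in> {0..mdist T x y}"
  shows "\<gamma> s \<in> mspace T" "mdist T x (\<gamma> s) = s" "mdist T (\<gamma> s) y = mdist T x y - s"
proof -
  have "0 \<in> {0..mdist T x y}" "mdist T x y \<in> {0..mdist T x y}" by auto
  moreover have "\<gamma> 0 = x" "\<gamma> (mdist T x y) = y"
    "\<And>s t. s \<in> {0..mdist T x y} \<Longrightarrow> t \<in> {0..mdist T x y} \<Longrightarrow> mdist T (\<gamma> s) (\<gamma> t) = \<bar>s - t\<bar>"
    using assms(1) unfolding geodesic_def by blast+
  ultimately have "mdist T (\<gamma> 0) (\<gamma> s) = \<bar>0 - s\<bar>"
    "mdist T (\<gamma> s) (\<gamma> (mdist T x y)) = \<bar>s - mdist T x y\<bar>"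
    using assms(2) by blast+
  then show "mdist T x (\<gamma> s) = s" "mdist T (\<gamma> s) y = mdist T x y - s"
    using assms(2) \<open>\<gamma> 0 = x\<close> \<open>\<gamma> (mdist T x y) = y\<close> by auto
  show "\<gamma> s \<in> mspace T"
    using assms unfolding geodesic_def by blast
qed

lemma geodesic_connectedin:
  assumes \<gamma>: "geodesic T x y \<gamma>" and "0 \<le> a" "b \<le> mdist T x y"
  shows "connectedin (mtopology_of T) (\<gamma> ` {a..b})"
proof (rule connectedin_continuous_map_image)
  show "connectedin (top_of_set {a..b}) {a..b}"
    by (simp add: connectedin_subtopology)
  interpret M: Metric_space "mspace T" "mdist T" by simp
  show "continuous_map (top_of_set {a..b}) (mtopology_of T) \<gamma>"
    unfolding mtopology_of_def M.continuous_map_to_metric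
  proof (intro ballI allI impI)
    fix s e :: real assume s: "s \<in> topspace (top_of_set {a..b})" and "0 < e"
    have "openin (top_of_set {a..b}) ({a..b} \<inter> ball s e)" by (simp add: openin_open_Int)
    moreover have "\<gamma> t \<in> M.mball (\<gamma> s) e" if t: "t \<in> {a..b} \<inter> ball s e" for t
    proof -
      have *: "s \<in> {0..mdist T x y}" "t \<in> {0..mdist T x y}" using s t assms(2,3) by auto
      then have "mdist T (\<gamma> s) (\<gamma> t) = \<bar>s - t\<bar>" using \<gamma> unfolding geodesic_def by blast
      then show ?thesis using * geodesic_D(1)[OF \<gamma>] t by (auto simp: dist_real_def)
    qed
    ultimately show "\<exists>U. openin (top_of_set {a..b}) U \<and> s \<in> U \<and> (\<forall>t\<in>U. \<gamma> t \<in> M.mball (\<gamma> s) e)"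
      using s \<open>0 < e\<close> by (intro exI[of _ "{a..b} \<inter> ball s e"]) auto
  qed
qed

text \<open>The isometric image of an interval is connected. This is mostly used in contraposition:
  a point that disconnects the ends of a geodesic lies on it.\<close>

lemma geodesic_connected_component:
  assumes \<gamma>: "geodesic T x y \<gamma>" and xy: "x \<in> mspace T" "y \<in> mspace T"
    and p: "\<And>s. s \<in> {0..mdist T x y} \<Longrightarrow> \<gamma> s \<noteq> p"
  shows "connected_component_of (minus_point T p) x y"
proof -
  have "x = \<gamma> 0" "y = \<gamma> (mdist T x y)" using \<gamma> by (auto simp: geodesic_def)
  then have "x \<in> \<gamma> ` {0..mdist T x y}" "y \<in> \<gamma> ` {0..mdist T x y}"
    by (metis (no_types) atLeastAtMost_iff imageI mdist_nonneg order_refl)+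
  then show ?thesis
    unfolding connected_component_of_def minus_point_def connectedin_subtopology
    using geodesic_connectedin[OF \<gamma>, of 0 "mdist T x y"] geodesic_D(1)[OF \<gamma>] p by blast
qed

text \<open>Points that separate the ends of one geodesic lie on every other geodesic with the same ends.\<close>

lemma geodesic_eq_if_separating:
  assumes \<gamma>: "geodesic T x y \<gamma>" and \<delta>: "geodesic T x y \<delta>" and xy: "x \<in> mspace T" "y \<in> mspace T"
    and sep: "\<And>s. s \<in> {0<..<mdist T x y} \<Longrightarrow> \<not> connected_component_of (minus_point T (\<gamma> s)) x y"
  shows "\<gamma> = \<delta>"
proof
  fix s
  consider "s \<notin> {0..mdist T x y}" | "s = 0" | "s = mdist T x y" | "s \<in> {0<..<mdist T x y}"
    by fastforce
  then show "\<gamma> s = \<delta> s"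
  proof cases
    case 1
    then show ?thesis using \<gamma> \<delta> by (auto simp: geodesic_def PiE_def extensional_def)
  next
    case 4
    then obtain t where t: "t \<in> {0..mdist T x y}" "\<delta> t = \<gamma> s"
      using geodesic_connected_component[OF \<delta> xy, of "\<gamma> s"] sep by blast
    have "s = mdist T x (\<gamma> s)" "t = mdist T x (\<delta> t)"
      using geodesic_D(2)[OF \<gamma>, of s] geodesic_D(2)[OF \<delta>, of t] 4 t by auto
    then show ?thesis using t by simp
  qed (use \<gamma> \<delta> in \<open>auto simp: geodesic_def\<close>)
qed

section \<open>The real tree of an ultrametric kernel\<close>

text \<open>A Gromov product relative to a root, in abstract form. By symmetry,
  \<open>G_ultra\<close> with \<open>k = i\<close> bounds \<open>G i j\<close> by
  \<open>G i i\<close>, which becomes the height of the tip of the branch labelled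
  \<open>i\<close>.\<close>

locale tree_kernel =
  fixes G :: "nat \<Rightarrow> nat \<Rightarrow> real"
  assumes G_nonneg: "0 \<le> G i j"
    and G_sym: "G i j = G j i"
    and G_ultra: "min (G i j) (G j k) \<le> G i k"
begin

text \<open>\<open>G i j\<close> is the height at which the branches to the labels \<open>i\<close> and \<open>j\<close> part. A point \<open>p\<close> of the tree
  is coded by the heights \<open>p i\<close> at which the branches to \<open>p\<close> and to \<open>i\<close> part; its own height is the
  supremum of these, \<open>meet p p\<close>. The constant \<open>0\<close> is the root.\<close>

definition points :: "(nat \<Rightarrow> real) set" where
  "points = {p. (\<forall>i. 0 \<le> p i) \<and> bdd_above (range p) \<and>
     (\<forall>i j. min (p i) (p j) \<le> G i j) \<and> (\<forall>i j. min (p i) (G i j) \<le> p j)}"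

definition meet :: "(nat \<Rightarrow> real) \<Rightarrow> (nat \<Rightarrow> real) \<Rightarrow> real" where
  "meet p q = (SUP i. min (p i) (q i))"

definition tdist :: "(nat \<Rightarrow> real) \<Rightarrow> (nat \<Rightarrow> real) \<Rightarrow> real" where
  "tdist p q = meet p p + meet q q - 2 * meet p q"

text \<open>The ancestor of \<open>p\<close> at height \<open>c\<close>, which is \<open>p\<close>
  itself once \<open>c\<close> reaches the height of \<open>p\<close>.\<close>

definition cut :: "(nat \<Rightarrow> real) \<Rightarrow> real \<Rightarrow> nat \<Rightarrow> real" where
  "cut p c = (\<lambda>i. min (p i) c)"

section \<open>Meets, the metric and truncation\<close>

lemma bdd_meet: "p \<in> points \<Longrightarrow> bdd_above (range (\<lambda>i. min (p i) (q i)))"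
  unfolding points_def bdd_above_def by (fastforce intro: min.coboundedI1)

text \<open>A strict lower bound of a supremum is witnessed by a single label. Inequalities between
  meets are derived from such witnesses through \<open>dense_le\<close>.\<close>

lemma less_meet_iff:
  assumes "p \<in> points"
  shows "c < meet p q \<longleftrightarrow> (\<exists>i. c < p i \<and> c < q i)"
  unfolding meet_def using less_cSUP_iff[OF _ bdd_meet[OF assms], of c q] by auto

lemma meet_ge: "p \<in> points \<Longrightarrow> min (p i) (q i) \<le> meet p q"
  unfolding meet_def by (rule cSUP_upper[OF _ bdd_meet]) auto

lemma meet_leI: "(\<And>i. min (p i) (q i) \<le> c) \<Longrightarrow> meet p q \<le> c"
  unfolding meet_def by (rule cSUP_least) auto

lemma meet_commute: "meet p q = meet q p"
  unfolding meet_def by (simp add: min.commute)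

lemma points_nonneg: "p \<in> points \<Longrightarrow> 0 \<le> p i"
  and points_le_G: "p \<in> points \<Longrightarrow> min (p i) (p j) \<le> G i j"
  and points_prop: "p \<in> points \<Longrightarrow> min (p i) (G i j) \<le> p j"
  by (auto simp: points_def)

lemma meet_nonneg: "p \<in> points \<Longrightarrow> q \<in> points \<Longrightarrow> 0 \<le> meet p q"
  using meet_ge[of p 0 q] points_nonneg[of p 0] points_nonneg[of q 0] by (auto simp: min_def split: if_splits)

lemma height_ge: "p \<in> points \<Longrightarrow> p i \<le> meet p p"
  using meet_ge[of p i p] by simp

lemma meet_le_height: "p \<in> points \<Longrightarrow> meet p q \<le> meet p p"
  by (rule meet_leI) (use height_ge in \<open>auto intro: min.coboundedI1\<close>)

lemma meet_le_height': "q \<in> points \<Longrightarrow> meet p q \<le> meet q q"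
  using meet_le_height[of q p] by (simp add: meet_commute)

text \<open>Labels \<open>i\<close> and \<open>j\<close> witness that \<open>q\<close> follows
  \<open>p\<close> and \<open>r\<close> beyond height \<open>c\<close>. Both lie above
  \<open>c\<close> along \<open>q\<close>, so they part from each other above \<open>c\<close>; then
  \<open>p\<close>, which follows \<open>i\<close> beyond \<open>c\<close>, follows \<open>j\<close>
  too, and \<open>j\<close> witnesses the meet of \<open>p\<close> and \<open>r\<close>.\<close>

lemma meet_ultra:
  assumes p: "p \<in> points" and q: "q \<in> points" and r: "r \<in> points"
  shows "min (meet p q) (meet q r) \<le> meet p r"
proof (rule dense_le)
  fix c assume "c < min (meet p q) (meet q r)"
  then obtain i j where "c < p i" "c < q i" "c < q j" "c < r j"
    using p q by (auto simp: less_meet_iff)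
  moreover have "min (q i) (q j) \<le> G i j" "min (p i) (G i j) \<le> p j"
    using p q points_le_G points_prop by auto
  ultimately have "c < p j" by linarith
  then show "c \<le> meet p r"
    using less_meet_iff[OF p, of c r] \<open>c < r j\<close> by force
qed

text \<open>Below their meet two points part from every label at the same heights. A label followed
  by both \<open>p\<close> and \<open>q\<close> beyond \<open>c\<close> passes the information from
  one to the other.\<close>

lemma min_meet_le:
  assumes p: "p \<in> points" and q: "q \<in> points"
  shows "min (p i) (meet p q) \<le> q i"
proof (rule dense_le)
  fix c assume "c < min (p i) (meet p q)"
  then obtain j where "c < p i" "c < p j" "c < q j"
    using p by (auto simp: less_meet_iff)
  moreover have "min (p j) (p i) \<le> G j i" "min (q j) (G j i) \<le> q i"
    using p q points_le_G points_prop by auto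
  ultimately show "c \<le> q i" by linarith
qed

text \<open>Coordinates are 1-Lipschitz: by \<open>min_meet_le\<close>, \<open>p i\<close> can
  exceed \<open>q i\<close> only by the part of \<open>p\<close> above the meet. Definiteness of the
  metric and the passage from Cauchy sequences to coordinatewise limits rest on this.\<close>

lemma abs_diff_le_tdist:
  assumes "p \<in> points" "q \<in> points"
  shows "\<bar>p i - q i\<bar> \<le> tdist p q"
  using min_meet_le[OF assms, of i] min_meet_le[OF assms(2,1), of i]
    height_ge[OF assms(1), of i] height_ge[OF assms(2), of i]
    meet_le_height[OF assms(1), of q] meet_le_height'[OF assms(2), of p]
  unfolding tdist_def by (auto simp: meet_commute[of q p])

text \<open>The converse estimate: a uniform change of the coordinates by \<open>e\<close> puts each
  of the two heights at most \<open>e\<close> above the meet, whence the factor 2.\<close>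

lemma tdist_le:
  assumes "p \<in> points" "q \<in> points" and e: "\<And>i. \<bar>p i - q i\<bar> \<le> e"
  shows "tdist p q \<le> 2 * e"
proof -
  have *: "meet p p \<le> meet p q + e" if p: "p \<in> points" and e: "\<And>i. \<bar>p i - q i\<bar> \<le> e" for p q
  proof (rule meet_leI)
    fix i show "min (p i) (p i) \<le> meet p q + e"
      using meet_ge[OF p, of i q] e[of i] by auto
  qed
  show ?thesis
    using *[OF assms(1) e] *[OF assms(2), of p] e
    by (auto simp: tdist_def meet_commute[of q p] abs_minus_commute)
qed

text \<open>The claim amounts to \<open>meet p q + meet q r <= meet q q + meet p r\<close>. The
  smaller summand on the left is at most \<open>meet p r\<close>, the larger at most the height of
  \<open>q\<close>.\<close>

lemma tdist_triangle:
  assumes "p \<in> points" "q \<in> points" "r \<in> points"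
  shows "tdist p r \<le> tdist p q + tdist q r"
  using meet_ultra[OF assms] meet_le_height'[OF assms(2), of p] meet_le_height[OF assms(2), of r]
  unfolding tdist_def by linarith

lemma tdist_nonneg: "p \<in> points \<Longrightarrow> q \<in> points \<Longrightarrow> 0 \<le> tdist p q"
  using abs_diff_le_tdist[of p q 0] by linarith

lemma tdist_eq_0_iff: "p \<in> points \<Longrightarrow> q \<in> points \<Longrightarrow> tdist p q = 0 \<longleftrightarrow> p = q"
  using abs_diff_le_tdist[of p q] by (auto simp: tdist_def)

text \<open>\<open>Metric_space\<close> requires nonnegativity and symmetry for all arguments, also
  outside the carrier; the default 0 provides both.\<close>

lemma Metric_space_tdist: "Metric_space points (\<lambda>p q. if p \<in> points \<and> q \<in> points then tdist p q else 0)"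
  by unfold_locales
    (auto simp: tdist_nonneg tdist_eq_0_iff tdist_triangle, simp_all add: tdist_def meet_commute)

definition tree :: "(nat \<Rightarrow> real) metric" where
  "tree = metric (points, \<lambda>p q. if p \<in> points \<and> q \<in> points then tdist p q else 0)"

lemma mspace_tree [simp]: "mspace tree = points"
  unfolding tree_def by (simp add: Metric_space_tdist Metric_space.mspace_metric)

lemma mdist_tree: "p \<in> points \<Longrightarrow> q \<in> points \<Longrightarrow> mdist tree p q = tdist p q"
  unfolding tree_def by (simp add: Metric_space_tdist Metric_space.mdist_metric)

lemma root_point: "(\<lambda>_. 0) \<in> points"
  by (auto simp: points_def G_nonneg)

lemma cut_point: "p \<in> points \<Longrightarrow> 0 \<le> c \<Longrightarrow> cut p c \<in> points"
  unfolding points_def cut_def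
  by (auto simp: bdd_above_def min_le_iff_disj) (metis min_le_iff_disj order.trans linear)+

lemma meet_cut:
  assumes "p \<in> points" "0 \<le> c"
  shows "meet (cut p c) q = min c (meet p q)"
proof (rule antisym)
  show "meet (cut p c) q \<le> min c (meet p q)"
    by (rule meet_leI) (use meet_ge[OF assms(1), of _ q] in \<open>auto simp: cut_def min_le_iff_disj\<close>)
  show "min c (meet p q) \<le> meet (cut p c) q"
  proof (rule dense_le)
    fix x assume "x < min c (meet p q)"
    then have "x < meet (cut p c) q"
      using less_meet_iff[OF cut_point[OF assms], of x q] less_meet_iff[OF assms(1), of x q]
      by (auto simp: cut_def)
    then show "x \<le> meet (cut p c) q" by simp
  qed
qed

lemma meet_cut': "p \<in> points \<Longrightarrow> 0 \<le> c \<Longrightarrow> meet q (cut p c) = min c (meet q p)"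
  using meet_cut[of p c q] by (simp add: meet_commute)

text \<open>Up to the branch point \<open>p\<close> and \<open>q\<close> have the same ancestors:
  the distance of the two cuts evaluates to 0.\<close>

lemma cut_cong:
  assumes "p \<in> points" "q \<in> points" "0 \<le> c" "c \<le> meet p q"
  shows "cut p c = cut q c"
  using assms meet_le_height[of p q] meet_le_height'[of q p]
  by (subst tdist_eq_0_iff[symmetric]) (auto simp: cut_point tdist_def meet_cut meet_cut' meet_commute)

lemma cut_height: "p \<in> points \<Longrightarrow> meet p p \<le> c \<Longrightarrow> cut p c = p"
  unfolding cut_def using order.trans[OF height_ge[of p]] by (auto simp: min_def intro!: ext)

text \<open>Descend from \<open>p\<close> to the branch point, then ascend to \<open>q\<close>, with
  the distance from \<open>p\<close> as parameter. The branch point is reached at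
  \<open>s = meet p p - meet p q\<close>; after that the height is \<open>meet p q\<close> plus the
  remaining length, which is the expression in the second case.\<close>

definition geo :: "(nat \<Rightarrow> real) \<Rightarrow> (nat \<Rightarrow> real) \<Rightarrow> real \<Rightarrow> nat \<Rightarrow> real" where
  "geo p q s = (if s \<le> meet p p - meet p q then cut p (meet p p - s)
     else cut q (s - meet p p + 2 * meet p q))"

lemma geo_point:
  assumes "p \<in> points" "q \<in> points"  "0 \<le> s"
  shows "geo p q s \<in> points"
  using assms meet_nonneg[OF assms(1,2)] by (auto simp: geo_def intro!: cut_point)

lemma tdist_geo:
  assumes p: "p \<in> points" and q: "q \<in> points" and "0 \<le> s" "s \<le> t" "t \<le> tdist p q"
  shows "tdist (geo p q s) (geo p q t) = t - s"
  using assms meet_nonneg[OF p q] meet_le_height[OF p, of q] meet_le_height'[OF q, of p]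
  unfolding geo_def tdist_def
  by (auto simp: meet_cut meet_cut' cut_point meet_commute[of q p])

lemma geo_ends:
  assumes p: "p \<in> points" and q: "q \<in> points"
  shows "geo p q 0 = p" "geo p q (tdist p q) = q"
proof -
  show "geo p q 0 = p"
    using meet_le_height[OF p, of q] by (auto simp: geo_def cut_height p)
  have "cut p (meet p q) = cut q (meet p q)"
    using cut_cong[OF p q meet_nonneg[OF p q]] by simp
  then show "geo p q (tdist p q) = q"
    using meet_le_height'[OF q, of p] by (auto simp: geo_def tdist_def cut_height q)
qed

lemma geodesic_geo:
  assumes p: "p \<in> points" and q: "q \<in> points"
  shows "geodesic tree p q (restrict (geo p q) {0..tdist p q})"
proof -
  have "tdist (geo p q s) (geo p q t) = \<bar>s - t\<bar>" if "s \<in> {0..tdist p q}" "t \<in> {0..tdist p q}" for s t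
    using tdist_geo[OF p q, of s t] tdist_geo[OF p q, of t s] that
    by (cases "s \<le> t") (auto simp: tdist_def meet_commute)
  then show ?thesis
    using geo_ends[OF p q] tdist_nonneg[OF p q]
    by (auto simp: geodesic_def mdist_tree p q geo_point)
qed

lemma meet_geo_ge:
  assumes p: "p \<in> points" and q: "q \<in> points" and "0 \<le> s" "s \<le> tdist p q"
  shows "meet p q \<le> meet (geo p q s) (geo p q s)"
  using assms meet_nonneg[OF p q] meet_le_height[OF p, of q] meet_le_height'[OF q, of p]
  by (auto simp: geo_def meet_cut meet_cut' tdist_def)

text \<open>Points of the geodesic are ancestors of \<open>p\<close> or of \<open>q\<close>, and an
  ancestor cannot meet \<open>r\<close> higher up.\<close>

lemma meet_geo_le:
  assumes p: "p \<in> points" and q: "q \<in> points" and "0 \<le> s"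
  shows "meet (geo p q s) r \<le> max (meet p r) (meet q r)"
  using assms meet_nonneg[OF p q]
  by (auto simp: geo_def meet_cut)

lemma tdist_commute: "tdist p q = tdist q p"
  by (simp add: tdist_def meet_commute)

lemma openin_tree:
  "openin (mtopology_of tree) U \<longleftrightarrow>
     U \<subseteq> points \<and> (\<forall>p\<in>U. \<exists>r>0. \<forall>q\<in>points. tdist p q < r \<longrightarrow> q \<in> U)"
proof -
  interpret M: Metric_space points "\<lambda>p q. if p \<in> points \<and> q \<in> points then tdist p q else 0"
    by (rule Metric_space_tdist)
  have "M.mball p r \<subseteq> U \<longleftrightarrow> (\<forall>q\<in>points. tdist p q < r \<longrightarrow> q \<in> U)" if "p \<in> points" for p r
    using that by (auto simp: M.mball_def subset_iff)
  then have "(\<exists>r>0. M.mball p r \<subseteq> U) \<longleftrightarrow> (\<exists>r>0. \<forall>q\<in>points. tdist p q < r \<longrightarrow> q \<in> U)"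
    if "p \<in> points" for p
    using that by simp
  then show ?thesis
    unfolding tree_def M.mtopology_of M.openin_mtopology by blast
qed

lemma meet_lipschitz:
  assumes "p \<in> points" "q \<in> points" "y \<in> points"
  shows "meet q y - meet p y \<le> tdist p q"
  using meet_ultra[of p q y] assms meet_le_height[of q y] meet_le_height[of p q] meet_le_height'[of q p]
  unfolding tdist_def by linarith

text \<open>Without the point \<open>cut y c\<close> the tree splits into \<open>E1\<close>, the
  part that follows \<open>y\<close> beyond height \<open>c\<close>, and the rest \<open>E2\<close>.
  Both are open and they are disjoint. Away from height \<open>c\<close> openness is the Lipschitz
  property of the meet with \<open>y\<close>; the delicate points are those that leave
  \<open>y\<close> exactly at the removed point.\<close>

lemma cut_separates:
  assumes y: "y \<in> points" and c: "0 \<le> c" "c < meet y y"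
    and x: "x \<in> points" "meet x y \<le> c" "x \<noteq> cut y c"
  shows "\<not> connected_component_of (minus_point tree (cut y c)) x y"
proof
  define p where "p = cut y c"
  define E1 where "E1 = {q \<in> points. c < meet q y}"
  define E2 where "E2 = {q \<in> points. meet q y \<le> c \<and> q \<noteq> p}"
  have py: "p \<in> points" "meet p y = c" and qp: "meet q p = min c (meet q y)" for q
    using y c by (auto simp: p_def cut_point meet_cut meet_cut')
  have "\<exists>r>0. \<forall>q'\<in>points. tdist q q' < r \<longrightarrow> q' \<in> E1" if "q \<in> E1" for q
    using that meet_lipschitz[OF _ _ y, of _ q]
    by (intro exI[of _ "meet q y - c"]) (fastforce simp: E1_def tdist_commute)
  then have E1: "openin (mtopology_of tree) E1"
    by (auto simp: openin_tree) (auto simp: E1_def)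
  have "\<exists>r>0. \<forall>q'\<in>points. tdist q q' < r \<longrightarrow> q' \<in> E2" if q: "q \<in> E2" for q
  proof (cases "meet q y < c")
    case True
    then show ?thesis
      using q meet_lipschitz[OF _ _ y, of q] py
      by (intro exI[of _ "c - meet q y"]) (fastforce simp: E2_def)
  next
    case False
    then have qy: "q \<in> points" "meet q y = c" "q \<noteq> p" using q by (auto simp: E2_def)
    \<comment> \<open>If \<open>q\<close> were no higher than \<open>c\<close>, it would be its own
      ancestor at height \<open>c\<close>; but \<open>q\<close> and \<open>y\<close> share that
      ancestor, which is \<open>p\<close>.\<close>
    have gt: "c < meet q q"
    proof (rule ccontr)
      assume "\<not> c < meet q q"
      then have "cut q c = q" using qy by (intro cut_height) auto
      then show False using cut_cong[OF qy(1) y, of c] qy c by (simp add: p_def)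
    qed
    \<comment> \<open>A point this close to \<open>q\<close> leaves \<open>q\<close> strictly above
      \<open>c\<close>. So it is not \<open>p\<close>, and if it met \<open>y\<close> above
      \<open>c\<close>, then so would \<open>q\<close>.\<close>
    have "q' \<in> E2" if q': "q' \<in> points" "tdist q q' < meet q q - c" for q'
    proof -
      have "c < meet q q'"
        using that meet_le_height'[OF q'(1), of q] unfolding tdist_def by linarith
      then show ?thesis
        using meet_ultra[OF qy(1) q'(1) y] qy q' qp[of q] by (auto simp: E2_def)
    qed
    then show ?thesis using gt by (intro exI[of _ "meet q q - c"]) auto
  qed
  then have E2: "openin (mtopology_of tree) E2"
    by (auto simp: openin_tree) (auto simp: E2_def)
  assume "connected_component_of (minus_point tree (cut y c)) x y"
  then obtain S where S: "connectedin (mtopology_of tree) S" "S \<subseteq> points - {p}" "x \<in> S" "y \<in> S"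
    by (auto simp: connected_component_of_def minus_point_def connectedin_subtopology p_def)
  have "S \<subseteq> E1 \<union> E2" "E1 \<inter> E2 \<inter> S = {}" "y \<in> E1" "x \<in> E2"
    using S x y c by (auto simp: E1_def E2_def p_def)
  then show False
    using S E1 E2 unfolding connectedin by blast
qed

text \<open>An interior point of the geodesic is an ancestor of one of its ends, at a height not
  below \<open>meet x y\<close> and strictly below that end, so \<open>cut_separates\<close> applies
  with this end in the role of \<open>y\<close>.\<close>

lemma geo_separates:
  assumes x: "x \<in> points" and y: "y \<in> points" and s: "0 < s" "s < tdist x y"
  shows "\<not> connected_component_of (minus_point tree (geo x y s)) x y"
proof -
  have ne: "geo x y s \<noteq> x" "geo x y s \<noteq> y"
    using tdist_geo[OF x y, of 0 s] tdist_geo[OF x y, of s "tdist x y"] s geo_ends[OF x y]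
    by (auto simp: tdist_def)
  have m: "meet x y \<le> meet x x" "meet x y \<le> meet y y" "0 \<le> meet x y"
    using x y meet_le_height meet_le_height' meet_nonneg by auto
  show ?thesis
  proof (cases "s \<le> meet x x - meet x y")
    case True
    then have "\<not> connected_component_of (minus_point tree (geo x y s)) y x"
      using ne s m x y cut_separates[OF x, of "meet x x - s" y]
      by (auto simp: geo_def meet_commute[of y x])
    then show ?thesis by (simp add: connected_component_of_sym)
  next
    case False
    then show ?thesis
      using ne s m x y cut_separates[OF y, of "s - meet x x + 2 * meet x y" x]
      by (auto simp: geo_def tdist_def)
  qed
qed

text \<open>A Cauchy sequence is uniformly Cauchy in its coordinates by
  \<open>abs_diff_le_tdist\<close>. The conditions defining \<open>points\<close> survive uniform
  limits, and \<open>tdist_le\<close> turns uniform convergence back into convergence in the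
  metric.\<close>

lemma mcomplete_tree: "mcomplete_of tree"
proof -
  interpret M: Metric_space points "\<lambda>p q. if p \<in> points \<and> q \<in> points then tdist p q else 0"
    by (rule Metric_space_tdist)
  have "\<exists>p. limitin M.mtopology \<sigma> p sequentially" if "M.MCauchy \<sigma>" for \<sigma>
  proof -
    have \<sigma>: "\<sigma> n \<in> points" for n using that by (auto simp: M.MCauchy_def)
    have Cauchy: "\<exists>N. \<forall>n\<ge>N. \<forall>n'\<ge>N. tdist (\<sigma> n) (\<sigma> n') < e" if "e > 0" for e
      using \<open>M.MCauchy \<sigma>\<close> that \<sigma> by (fastforce simp: M.MCauchy_def)
    have "Cauchy (\<lambda>n. \<sigma> n i)" for i
      unfolding Cauchy_def dist_real_def
      using Cauchy abs_diff_le_tdist[OF \<sigma> \<sigma>, of _ i] by (meson le_less_trans)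
    then have conv: "convergent (\<lambda>n. \<sigma> n i)" for i by (rule Cauchy_convergent)
    define p where "p = (\<lambda>i. lim (\<lambda>n. \<sigma> n i))"
    have p: "(\<lambda>n. \<sigma> n i) \<longlonglongrightarrow> p i" for i
      unfolding p_def using conv by (simp add: convergent_LIMSEQ_iff)
    have close: "\<exists>N. \<forall>n\<ge>N. \<forall>i. \<bar>\<sigma> n i - p i\<bar> \<le> e" if e: "e > 0" for e
    proof -
      obtain N where N: "\<forall>n\<ge>N. \<forall>n'\<ge>N. tdist (\<sigma> n) (\<sigma> n') < e" using Cauchy[OF e] by blast
      have "\<bar>\<sigma> n i - p i\<bar> \<le> e" if "n \<ge> N" for n i
      proof (rule LIMSEQ_le_const2)
        show "(\<lambda>k. \<bar>\<sigma> n i - \<sigma> k i\<bar>) \<longlonglongrightarrow> \<bar>\<sigma> n i - p i\<bar>" by (intro tendsto_intros p)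
        show "\<exists>N. \<forall>k\<ge>N. \<bar>\<sigma> n i - \<sigma> k i\<bar> \<le> e"
          using N that abs_diff_le_tdist[OF \<sigma> \<sigma>, of n i] by (meson le_less_trans less_imp_le)
      qed
      then show ?thesis by blast
    qed
    have "p \<in> points"
      unfolding points_def mem_Collect_eq
    proof (intro conjI allI)
      fix i j
      show "0 \<le> p i"
        by (rule LIMSEQ_le_const[OF p]) (use points_nonneg[OF \<sigma>] in auto)
      show "min (p i) (p j) \<le> G i j"
        by (rule LIMSEQ_le_const2[OF tendsto_min[OF p p]]) (use points_le_G[OF \<sigma>] in auto)
      show "min (p i) (G i j) \<le> p j"
        by (rule LIMSEQ_le[OF tendsto_min[OF p tendsto_const] p]) (use points_prop[OF \<sigma>] in auto)
      obtain N where "\<forall>i. \<bar>\<sigma> N i - p i\<bar> \<le> 1" using close[of 1] by auto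
      then have "p i \<le> meet (\<sigma> N) (\<sigma> N) + 1" for i
        using height_ge[OF \<sigma>, of N i] by (smt (verit))
      then show "bdd_above (range p)" by (auto simp: bdd_above_def)
    qed
    moreover have "\<exists>N. \<forall>n\<ge>N. tdist (\<sigma> n) p < e" if e: "e > 0" for e
    proof -
      obtain N where "\<forall>n\<ge>N. \<forall>i. \<bar>\<sigma> n i - p i\<bar> \<le> e / 3" using close[of "e/3"] e by fastforce
      then have "tdist (\<sigma> n) p \<le> 2 * (e / 3)" if "n \<ge> N" for n
        using that \<sigma> \<open>p \<in> points\<close> by (intro tdist_le) auto
      then show ?thesis using e by (intro exI[of _ N]) fastforce
    qed
    ultimately show ?thesis
      using \<sigma> by (auto simp: M.limit_metric_sequentially)
  qed
  then show ?thesis unfolding tree_def M.mcomplete_of M.mcomplete_def by blast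
qed

lemma real_tree_tree: "real_tree tree"
  unfolding real_tree_def
proof (intro conjI ballI impI allI)
  show "mspace tree \<noteq> {}" using root_point by auto
  show "mcomplete_of tree" by (rule mcomplete_tree)
  fix x y assume "x \<in> mspace tree" "y \<in> mspace tree" "x \<noteq> y"
  then have x: "x \<in> points" and y: "y \<in> points" by auto
  let ?g = "restrict (geo x y) {0..tdist x y}"
  have sep: "\<not> connected_component_of (minus_point tree (?g s)) x y"
    if "s \<in> {0<..<mdist tree x y}" for s
    using that geo_separates[OF x y, of s] by (auto simp: mdist_tree x y)
  have eq: "?g = \<gamma>" if "geodesic tree x y \<gamma>" for \<gamma>
    by (rule geodesic_eq_if_separating[OF geodesic_geo[OF x y] that _ _ sep]) (auto simp: x y)
  then show "\<exists>!\<gamma>. geodesic tree x y \<gamma>" using geodesic_geo[OF x y] by blast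
  fix \<gamma> s assume "geodesic tree x y \<gamma>" "s \<in> {0<..<mdist tree x y}"
  then show "\<not> connected_component_of (minus_point tree (\<gamma> s)) x y" using eq sep by blast
qed

section \<open>Labels, a countable dense set and branches\<close>

lemma connected_component_avoiding:
  assumes "p \<in> points" "q \<in> points" "\<And>s. 0 \<le> s \<Longrightarrow> s \<le> tdist p q \<Longrightarrow> geo p q s \<noteq> z"
  shows "connected_component_of (minus_point tree z) p q"
  using assms geodesic_connected_component[OF geodesic_geo[OF assms(1,2)], of z] by (auto simp: mdist_tree)

text \<open>A row of the kernel codes the tip of the branch with that label.\<close>

lemma label_point: "G i \<in> points"
  unfolding points_def mem_Collect_eq
proof (intro conjI allI)
  show "bdd_above (range (G i))"
    unfolding bdd_above_def
  proof (intro exI ballI)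
    fix x assume "x \<in> range (G i)"
    then obtain j where "x = G i j" by blast
    then show "x \<le> G i i" using G_ultra[of i j i] by (simp add: G_sym[of j i])
  qed
  fix j k show "min (G i j) (G i k) \<le> G j k" using G_ultra[of j i k] by (simp add: G_sym[of j i])
qed (use G_nonneg G_ultra in auto)

text \<open>This justifies the coding: coordinate \<open>i\<close> of a point is its Gromov product
  with the tip labelled \<open>i\<close>.\<close>

lemma meet_label:
  assumes "p \<in> points" shows "meet p (G i) = p i"
proof (rule antisym)
  show "meet p (G i) \<le> p i"
    by (rule meet_leI) (use points_prop[OF assms, of _ i] in \<open>simp add: G_sym[of i]\<close>)
  show "p i \<le> meet p (G i)"
    using meet_ge[OF assms, of i "G i"] points_le_G[OF assms, of i i] by simp
qed

lemma separable_tree: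
  obtains D where "countable D" "D \<subseteq> points" "\<And>p e. p \<in> points \<Longrightarrow> 0 < e \<Longrightarrow> \<exists>q\<in>D. tdist p q < e"
proof
  let ?D = "(\<lambda>(i, c). cut (G i) c) ` (UNIV \<times> (\<rat> \<inter> {0..}))"
  show "countable ?D" by (intro countable_image countable_SIGMA) (auto intro: countable_Int1 countable_rat)
  show "?D \<subseteq> points" by (auto intro: cut_point label_point)
  fix p and e :: real assume p: "p \<in> points" and e: "0 < e"
  \<comment> \<open>The label \<open>i\<close> is followed almost up to \<open>p\<close>, and its
    ancestor slightly above the branch point \<open>p i\<close> still meets \<open>p\<close> at
    \<open>p i\<close>. The distance is then the sum of two stretches, each shorter than
    \<open>e / 4\<close>.\<close>
  obtain i where i: "meet p p - e / 4 < p i"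
    using less_meet_iff[OF p, of "meet p p - e / 4" p] e by auto
  obtain c where c: "p i < c" "c < p i + e / 4" "c \<in> \<rat>"
    using Rats_dense_in_real[of "p i" "p i + e / 4"] e by auto
  have "0 \<le> c" using points_nonneg[OF p, of i] c by simp
  then have "meet (cut (G i) c) (cut (G i) c) \<le> c" "meet p (cut (G i) c) = p i"
    using c by (auto simp: meet_cut meet_cut' label_point meet_label p cut_point)
  then have "tdist p (cut (G i) c) < e" using i c e unfolding tdist_def by linarith
  then show "\<exists>q\<in>?D. tdist p q < e" using c \<open>0 \<le> c\<close> by force
qed

text \<open>A branch at \<open>p\<close> either lies above \<open>p\<close> or contains what is not
  above \<open>p\<close>. In the first case it contains everything beyond the tip of some label, in
  the second everything that leaves \<open>p\<close> early. Only these two kinds of test sets need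
  positive mass later. Openness: a geodesic shorter than the distance to \<open>p\<close> cannot
  reach \<open>p\<close>.\<close>

lemma branch_open_and_contains:
  assumes "B \<in> branches tree"
  shows "openin (mtopology_of tree) B"
    and "(\<exists>i. \<forall>x\<in>points. G i i \<le> x i \<longrightarrow> x \<in> B) \<or>
      (\<exists>p\<in>points. 0 < meet p p \<and> (\<forall>x\<in>points. meet x p < meet p p \<longrightarrow> x \<in> B))"
proof -
  obtain p y where p: "p \<in> points" and y: "y \<in> points" "y \<noteq> p"
    and B: "B = {z. connected_component_of (minus_point tree p) y z}"
    using assms by (auto simp: branches_def connected_components_of_def minus_point_def)
  have sub: "B \<subseteq> points - {p}"
    using connected_component_of_subset_topspace[of "minus_point tree p" y]
    unfolding B by (auto simp: minus_point_def)
  show "openin (mtopology_of tree) B"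
    unfolding openin_tree
  proof (intro conjI ballI)
    show "B \<subseteq> points" using sub by auto
    fix q assume q: "q \<in> B"
    then have qp: "q \<in> points" "q \<noteq> p" using sub by auto
    have "z \<in> B" if z: "z \<in> points" "tdist q z < tdist q p" for z
    proof -
      have "connected_component_of (minus_point tree p) q z"
      proof (rule connected_component_avoiding[OF qp(1) z(1)])
        fix s assume "0 \<le> s" "s \<le> tdist q z"
        then have "tdist q (geo q z s) = s"
          using tdist_geo[OF qp(1) z(1), of 0 s] geo_ends[OF qp(1) z(1)] by simp
        then show "geo q z s \<noteq> p" using z \<open>s \<le> tdist q z\<close> by auto
      qed
      then show ?thesis using q unfolding B by (auto intro: connected_component_of_trans)
    qed
    moreover have "0 < tdist q p" using qp p tdist_nonneg[of q p] tdist_eq_0_iff[of q p] by auto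
    ultimately show "\<exists>r>0. \<forall>z\<in>points. tdist q z < r \<longrightarrow> z \<in> B" by blast
  qed
  have py: "meet y p \<le> meet p p" "meet y p \<le> meet y y" "0 \<le> meet y p" using p y meet_le_height meet_le_height' meet_nonneg by auto
  show "(\<exists>i. \<forall>x\<in>points. G i i \<le> x i \<longrightarrow> x \<in> B) \<or>
      (\<exists>p\<in>points. 0 < meet p p \<and> (\<forall>x\<in>points. meet x p < meet p p \<longrightarrow> x \<in> B))"
  proof (cases "meet y p = meet p p")
    case True
    then have "meet p p < meet y y"
      using py tdist_eq_0_iff[OF y(1) p] y(2) unfolding tdist_def by linarith
    then obtain i where i: "meet p p < y i" using less_meet_iff[OF y(1)] by blast
    have "x \<in> B" if x: "x \<in> points" "G i i \<le> x i" for x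
      unfolding B mem_Collect_eq
    proof (rule connected_component_avoiding[OF y(1) x(1)])
      fix s assume s: "0 \<le> s" "s \<le> tdist y x"
      have "y i \<le> meet y x"
        using meet_ge[OF y(1), of i x] points_le_G[OF y(1), of i i] x by simp
      then show "geo y x s \<noteq> p" using meet_geo_ge[OF y(1) x(1) s] i by auto
    qed
    then show ?thesis by blast
  next
    case False
    then have lt: "meet y p < meet p p" using py by simp
    have "x \<in> B" if x: "x \<in> points" "meet x p < meet p p" for x
      unfolding B mem_Collect_eq
    proof (rule connected_component_avoiding[OF y(1) x(1)])
      fix s assume s: "0 \<le> s" "s \<le> tdist y x"
      show "geo y x s \<noteq> p" using meet_geo_le[OF y(1) x(1) s(1), of p] x lt by auto
    qed
    then show ?thesis using p lt py by force
  qed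
qed

end

section \<open>Schoenberg's curve\<close>

text \<open>Schoenberg's space-filling curve, built from a \<open>2\<close>-periodic continuous function that is \<open>0\<close> on
  \<open>[0, 1/3]\<close> and \<open>1\<close> on \<open>[2/3, 1]\<close> and so reads off ternary digits. Having a measurable section, it
  reduces weak compactness in the plane to weak compactness on the line.\<close>

definition tent :: "real \<Rightarrow> real" where
  "tent t = max 0 (min 1 (1/2 - cos (pi * t)))"

definition schoenberg :: "nat \<Rightarrow> real \<Rightarrow> real" where
  "schoenberg j t = (\<Sum>k. tent (3 ^ (2 * k + j) * t) / 2 ^ Suc k)"

definition binary_digit :: "real \<Rightarrow> nat \<Rightarrow> real" where
  "binary_digit x k = of_int (\<lfloor>2 ^ Suc k * x\<rfloor> mod 2)"

text \<open>For a sequence \<open>c\<close> of zeros and ones, the point of the Cantor set with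
  ternary digits \<open>2 * c i\<close>.\<close>

definition ternary :: "(nat \<Rightarrow> real) \<Rightarrow> real" where
  "ternary c = (\<Sum>i. 2 * c i / 3 ^ Suc i)"

text \<open>Even ternary places carry the binary digits of the first coordinate and odd places those
  of the second, matching the exponents \<open>2 * k + j\<close> in
  \<open>schoenberg\<close>.\<close>

definition schoenberg_section :: "real \<times> real \<Rightarrow> real" where
  "schoenberg_section z = ternary (\<lambda>i. binary_digit (if even i then fst z else snd z) (i div 2))"

lemma tent_bounds: "0 \<le> tent t" "tent t \<le> 1"
  by (auto simp: tent_def)

lemma continuous_tent: "continuous_on A tent"
  unfolding tent_def by (intro continuous_intros)

lemma tent_periodic: "tent (2 * of_int n + t) = tent t"
proof -
  have "cos (pi * (2 * of_int n + t)) = cos (pi * t + of_int n * (2 * pi))" by (simp add: algebra_simps)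
  also have "\<dots> = cos (pi * t) * cos (of_int n * (2 * pi)) - sin (pi * t) * sin (of_int n * (2 * pi))" by (rule cos_add)
  also have "\<dots> = cos (pi * t)"
    using cos_int_2pin[of n] sin_int_2pin[of n] by (simp add: mult.commute)
  finally show ?thesis by (simp add: tent_def)
qed

lemma tent_eq_0: "0 \<le> t \<Longrightarrow> t \<le> 1/3 \<Longrightarrow> tent t = 0"
proof -
  assume "0 \<le> t" "t \<le> 1/3"
  then have "cos (pi / 3) \<le> cos (pi * t)" by (intro cos_monotone_0_pi_le) auto
  then show ?thesis by (simp add: tent_def cos_60)
qed

lemma tent_eq_1: "2/3 \<le> t \<Longrightarrow> t \<le> 1 \<Longrightarrow> tent t = 1"
proof -
  assume t: "2/3 \<le> t" "t \<le> 1"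
  then have "cos (pi * t) \<le> cos (pi * (2/3))" by (intro cos_monotone_0_pi_le) auto
  also have "pi * (2/3) = pi - pi / 3" by simp
  also have "cos (pi - pi / 3) = - (1/2)" by (subst cos_diff) (simp add: cos_60)
  finally show ?thesis by (simp add: tent_def)
qed

lemma continuous_schoenberg: "continuous_on UNIV (schoenberg j)"
proof (rule uniform_limit_theorem)
  show "uniform_limit UNIV (\<lambda>n t. \<Sum>k<n. tent (3 ^ (2 * k + j) * t) / 2 ^ Suc k) (schoenberg j) sequentially"
    unfolding schoenberg_def
  proof (rule Weierstrass_m_test[where M = "\<lambda>k. (1/2) ^ Suc k"])
    show "summable (\<lambda>k. (1/2::real) ^ Suc k)" by (subst summable_Suc_iff) (rule summable_geometric, simp)
  qed (use tent_bounds in \<open>simp add: divide_simps power_divide\<close>)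
  show "\<forall>\<^sub>F n in sequentially. continuous_on UNIV (\<lambda>t. \<Sum>k<n. tent (3 ^ (2 * k + j) * t) / 2 ^ Suc k)"
    by (intro always_eventually allI continuous_intros continuous_on_compose2[OF continuous_tent[of UNIV]]) auto
qed simp

lemma binary_digit_cases: "binary_digit x k = 0 \<or> binary_digit x k = 1"
  unfolding binary_digit_def by (metis mod_2_eq_odd of_bool_eq(1,2) of_int_0 of_int_1)

text \<open>The first \<open>n\<close> terms add up to the floor of \<open>2 ^ n * x\<close> divided
  by \<open>2 ^ n\<close>.\<close>

lemma binary_expansion:
  assumes x: "0 \<le> x" "x < 1"
  shows "(\<lambda>k. binary_digit x k / 2 ^ Suc k) sums x"
proof -
  have partial: "(\<Sum>k<n. binary_digit x k / 2 ^ Suc k) = \<lfloor>2 ^ n * x\<rfloor> / 2 ^ n" for n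
  proof (induction n)
    case 0
    have "\<lfloor>x\<rfloor> = 0" using x by (simp add: floor_eq_iff)
    then show ?case by simp
  next
    case (Suc n)
    have "\<lfloor>2 ^ Suc n * x\<rfloor> div 2 = \<lfloor>2 ^ n * x\<rfloor>"
      using floor_divide_real_eq_div[of 2 "2 ^ Suc n * x"] by simp
    then have "\<lfloor>2 ^ Suc n * x\<rfloor> = 2 * \<lfloor>2 ^ n * x\<rfloor> + \<lfloor>2 ^ Suc n * x\<rfloor> mod 2"
      by (metis mult_div_mod_eq)
    then have "real_of_int \<lfloor>2 ^ Suc n * x\<rfloor> = 2 * \<lfloor>2 ^ n * x\<rfloor> + binary_digit x n"
      unfolding binary_digit_def by (metis of_int_add of_int_mult of_int_numeral)
    then show ?case using Suc by (simp add: field_simps)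
  qed
  have "(\<lambda>n. \<lfloor>2 ^ n * x\<rfloor> / 2 ^ n) \<longlonglongrightarrow> x"
  proof (rule tendsto_sandwich)
    show "\<forall>\<^sub>F n in sequentially. x - (1/2) ^ n \<le> \<lfloor>2 ^ n * x\<rfloor> / 2 ^ n"
    proof (intro always_eventually allI)
      fix n
      have "2 ^ n * x - 1 \<le> \<lfloor>2 ^ n * x\<rfloor>" by linarith
      then have "(2 ^ n * x - 1) / 2 ^ n \<le> \<lfloor>2 ^ n * x\<rfloor> / 2 ^ n" by (intro divide_right_mono) auto
      moreover have "(2 ^ n * x - 1) / 2 ^ n = x - (1/2) ^ n" by (simp add: diff_divide_distrib power_one_over)
      ultimately show "x - (1/2) ^ n \<le> \<lfloor>2 ^ n * x\<rfloor> / 2 ^ n" by simp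
    qed
    show "\<forall>\<^sub>F n in sequentially. \<lfloor>2 ^ n * x\<rfloor> / 2 ^ n \<le> x"
      by (intro always_eventually allI) (simp add: divide_le_eq mult.commute)
    show "(\<lambda>n. x - (1/2) ^ n) \<longlonglongrightarrow> x"
      using tendsto_diff[OF tendsto_const LIMSEQ_power_zero[of "1/2::real"], of x] by simp
  qed simp
  then show ?thesis unfolding sums_def partial .
qed

lemma
  assumes c: "\<And>i. c i = 0 \<or> c i = (1::real)"
  shows ternary_step: "3 * ternary c = 2 * c 0 + ternary (\<lambda>i. c (Suc i))"
    and ternary_bounds: "0 \<le> ternary c" "ternary c \<le> 1"
proof -
  have c01: "0 \<le> c i" "c i \<le> 1" for i using c[of i] by auto
  have geo: "(\<lambda>i. 2 / 3 ^ Suc i :: real) sums 1"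
    using sums_mult[OF geometric_sums[of "1/3::real"], of "2/3"] by (simp add: power_divide)
  have le: "2 * c i / 3 ^ Suc i \<le> 2 / 3 ^ Suc i" for i
    using c01 by (intro divide_right_mono) auto
  have sm: "summable (\<lambda>i. 2 * c i / 3 ^ Suc i)"
    by (rule summable_comparison_test'[OF sums_summable[OF geo], of 0]) (use le c01 in simp)
  show "0 \<le> ternary c" unfolding ternary_def by (rule suminf_nonneg[OF sm]) (use c01 in simp)
  have "ternary c \<le> (\<Sum>i. 2 / 3 ^ Suc i)"
    unfolding ternary_def by (rule suminf_le[OF le sm sums_summable[OF geo]])
  then show "ternary c \<le> 1" using sums_unique[OF geo] by simp
  have "ternary c = 2 * c 0 / 3 + (\<Sum>i. 2 * c (Suc i) / 3 ^ Suc (Suc i))"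
    unfolding ternary_def using suminf_split_initial_segment[OF sm, of 1] by (simp add: add.commute)
  also have "(\<Sum>i. 2 * c (Suc i) / 3 ^ Suc (Suc i)) = ternary (\<lambda>i. c (Suc i)) / 3"
  proof -
    have "summable (\<lambda>i. 2 * c (Suc i) / 3 ^ Suc i)"
      by (rule summable_comparison_test'[OF sums_summable[OF geo], of 0])
        (use c01 in \<open>simp add: divide_right_mono\<close>)
    from suminf_divide[OF this, of 3] show ?thesis unfolding ternary_def by (simp add: mult.commute)
  qed
  finally show "3 * ternary c = 2 * c 0 + ternary (\<lambda>i. c (Suc i))" by simp
qed

text \<open>Multiplication by \<open>3 ^ k\<close> moves the first \<open>k\<close> digits into the
  integer part. These digits are 0 or 2, so that part is even and drops out by periodicity; the next
  digit puts the remainder into \<open>[0, 1/3]\<close> or \<open>[2/3, 1]\<close>, where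
  \<open>tent\<close> is 0 or 1.\<close>

lemma tent_ternary:
  assumes "\<And>i. c i = 0 \<or> c i = (1::real)"
  shows "tent (3 ^ k * ternary c) = c k"
  using assms
proof (induction k arbitrary: c)
  case 0
  have "3 * ternary c = 2 * c 0 + ternary (\<lambda>i. c (Suc i))" "0 \<le> ternary (\<lambda>i. c (Suc i))" "ternary (\<lambda>i. c (Suc i)) \<le> 1"
    using 0 ternary_step[of c] ternary_bounds[of "\<lambda>i. c (Suc i)"] by auto
  then show ?case using 0[of 0] by (auto simp: tent_eq_0 tent_eq_1)
next
  case (Suc k)
  have "3 ^ Suc k * ternary c = 3 ^ k * (2 * c 0 + ternary (\<lambda>i. c (Suc i)))"
    using ternary_step[of c] Suc.prems by (metis (no_types, lifting) mult.assoc mult.commute power_Suc)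
  also have "\<dots> = 2 * of_int (if c 0 = 0 then 0 else 3 ^ k) + 3 ^ k * ternary (\<lambda>i. c (Suc i))"
    using Suc.prems[of 0] by (auto simp: algebra_simps)
  finally have "tent (3 ^ Suc k * ternary c) = tent (3 ^ k * ternary (\<lambda>i. c (Suc i)))"
    by (simp only: tent_periodic)
  also have "\<dots> = c (Suc k)" by (rule Suc.IH) (rule Suc.prems)
  finally show ?case .
qed

text \<open>The value 1 is excluded because all its digits in the sense of
  \<open>binary_digit\<close> vanish. Heights are therefore compressed into \<open>[0, 1)\<close>
  before they are coded.\<close>

lemma schoenberg_section:
  assumes "0 \<le> x" "x < 1" "0 \<le> y" "y < 1"
  shows "schoenberg 0 (schoenberg_section (x, y)) = x" "schoenberg 1 (schoenberg_section (x, y)) = y"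
proof -
  have *: "tent (3 ^ k * schoenberg_section (x, y)) = binary_digit (if even k then x else y) (k div 2)" for k
    unfolding schoenberg_section_def by (subst tent_ternary) (auto simp: binary_digit_cases)
  show "schoenberg 0 (schoenberg_section (x, y)) = x"
    unfolding schoenberg_def * using binary_expansion[OF assms(1,2)] by (simp add: sums_iff)
  show "schoenberg 1 (schoenberg_section (x, y)) = y"
    unfolding schoenberg_def * using binary_expansion[OF assms(3,4)] by (simp add: sums_iff)
qed

lemma schoenberg_section_bounds: "0 \<le> schoenberg_section z" "schoenberg_section z \<le> 1"
  unfolding schoenberg_section_def by (rule ternary_bounds, rule binary_digit_cases)+

lemma measurable_schoenberg_section [measurable]: "schoenberg_section \<in> borel_measurable (borel \<Otimes>\<^sub>M borel)"
proof -
  have "(\<lambda>z. binary_digit (if even i then fst z else snd z) (i div 2)) \<in> borel_measurable (borel \<Otimes>\<^sub>M borel)" for i :: nat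
    unfolding binary_digit_def by (cases "even i") measurable
  then show ?thesis unfolding schoenberg_section_def ternary_def by measurable
qed

lemma measurable_schoenberg [measurable]: "schoenberg j \<in> borel_measurable borel"
  by (rule borel_measurable_continuous_onI) (rule continuous_schoenberg)

section \<open>Ordering finite ultrametric kernels\<close>

lemma finite_obtain_Max:
  fixes f :: "'q \<Rightarrow> real"
  assumes "finite A" "A \<noteq> {}"
  obtains x where "x \<in> A" "f x = Max (f ` A)"
proof -
  have "Max (f ` A) \<in> f ` A" using assms by (intro Max_in) auto
  then show ?thesis using that by auto
qed

lemma finite_obtain_Min:
  fixes f :: "'q \<Rightarrow> real"
  assumes "finite A" "A \<noteq> {}"
  obtains x where "x \<in> A" "f x = Min (f ` A)"
proof -
  have "Min (f ` A) \<in> f ` A" using assms by (intro Min_in) auto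
  then show ?thesis using that by auto
qed

text \<open>A new point goes directly after the last one among those maximizing the kernel with it.\<close>

lemma ultrametric_linear_order:
  fixes K :: "'q \<Rightarrow> 'q \<Rightarrow> real"
  assumes "finite Q"
    and sym: "\<And>x y. x \<in> Q \<Longrightarrow> y \<in> Q \<Longrightarrow> K x y = K y x"
    and ultra: "\<And>x y z. x \<in> Q \<Longrightarrow> y \<in> Q \<Longrightarrow> z \<in> Q \<Longrightarrow> min (K x y) (K y z) \<le> K x z"
  obtains r :: "'q \<Rightarrow> real" where "inj_on r Q"
    "\<And>x y z. x \<in> Q \<Longrightarrow> y \<in> Q \<Longrightarrow> z \<in> Q \<Longrightarrow> r x < r y \<Longrightarrow> r y < r z \<Longrightarrow>
       K x z = min (K x y) (K y z)"
proof -
  have "\<exists>r :: 'q \<Rightarrow> real. inj_on r Q \<and> (\<forall>x\<in>Q. \<forall>y\<in>Q. \<forall>z\<in>Q. r x < r y \<longrightarrow> r y < r z \<longrightarrow>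
       K x z = min (K x y) (K y z))"
    using assms
  proof (induction Q rule: finite_induct)
    case empty
    then show ?case by simp
  next
    case (insert w Q)
    then obtain r :: "'q \<Rightarrow> real" where inj: "inj_on r Q"
      and r: "\<And>x y z. x \<in> Q \<Longrightarrow> y \<in> Q \<Longrightarrow> z \<in> Q \<Longrightarrow> r x < r y \<Longrightarrow> r y < r z \<Longrightarrow> K x z = min (K x y) (K y z)"
      by (metis insertI2)
    note sym = insert.prems(1) and ultra = insert.prems(2)
    show ?case
    proof (cases "Q = {}")
      case True
      then show ?thesis by auto
    next
      case False
      \<comment> \<open>The new point \<open>w\<close> is placed right after \<open>a\<close>, the
        last of the points at which \<open>K w\<close> attains its maximum \<open>m\<close>.\<close>
      define m where "m = Max (K w ` Q)"
      define J where "J = {x \<in> Q. K w x = m}"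
      have J: "finite J" "J \<noteq> {}"
      proof -
        have "m \<in> K w ` Q" unfolding m_def using insert.hyps(1) False by (intro Max_in) auto
        then show "finite J" "J \<noteq> {}" using insert.hyps(1) by (auto simp: J_def)
      qed
      have m: "K w x \<le> m" if "x \<in> Q" for x
        using that insert.hyps(1) by (simp add: m_def)
      obtain a where a: "a \<in> J" "r a = Max (r ` J)"
        using finite_obtain_Max[OF J, of r] by blast
      then have aQ: "a \<in> Q" "K w a = m" "K a w = m" using sym[of a w] by (auto simp: J_def)
      have after: "K w x < m" if "x \<in> Q" "r a < r x" for x
      proof (rule ccontr)
        assume "\<not> K w x < m"
        then have "x \<in> J" using that m[of x] by (auto simp: J_def)
        then show False using a J that by (metis Max_ge finite_imageI imageI not_less)
      qed
      \<comment> \<open>A free rank just after \<open>a\<close>: half way to the next rank, or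
        anything larger if \<open>a\<close> is last.\<close>
      obtain b where b: "r a < b" "\<And>x. x \<in> Q \<Longrightarrow> r a < r x \<Longrightarrow> b < r x"
      proof (cases "{x \<in> Q. r a < r x} = {}")
        case True
        then show ?thesis using that[of "r a + 1"] by auto
      next
        case False
        define c where "c = Min (r ` {x \<in> Q. r a < r x})"
        have "c \<in> r ` {x \<in> Q. r a < r x}" unfolding c_def using insert.hyps(1) False by (intro Min_in) auto
        moreover have "c \<le> r x" if "x \<in> Q" "r a < r x" for x
          unfolding c_def using insert.hyps(1) that by (intro Min_le) auto
        ultimately show ?thesis using that[of "(r a + c) / 2"] by force
      qed
      have b_cases: "r x \<le> r a \<and> r x < b \<or> b < r x \<and> r a < r x" if "x \<in> Q" for x
        using b that by force
      define r' where "r' = r(w := b)"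
      have r'Q: "r' x = r x" if "x \<in> Q" for x using that insert.hyps(2) by (auto simp: r'_def)
      have r'w: "r' w = b" by (simp add: r'_def)
      have inj': "inj_on r' (insert w Q)"
      proof -
        have "inj_on r' Q" using inj r'Q by (metis inj_on_cong)
        then show ?thesis using r'Q r'w b_cases insert.hyps(2) by (fastforce simp: inj_on_def)
      qed
      \<comment> \<open>Seen from points up to \<open>a\<close>, the new point behaves as if it were
        reached through \<open>a\<close>.\<close>
      have left: "K x w = min (K x a) m" if x: "x \<in> Q" "r x \<le> r a" for x
        using ultra[of x a w] ultra[of x w a] ultra[of a x w] sym[of x w] sym[of x a] m[OF x(1)] x aQ
        by (auto simp: min_def split: if_splits)
      \<comment> \<open>Later points do not attain the maximum, and then the ultrametric inequality
        leaves no difference between \<open>w\<close> and \<open>a\<close>.\<close>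
      have right: "K w x = K a x \<and> K a x < m" if x: "x \<in> Q" "r a < r x" for x
        using ultra[of w a x] ultra[of a w x] after[OF x] x aQ
        by (auto simp: min_def split: if_splits)
      have through: "K x z = min (K x a) (K a z)" if "x \<in> Q" "z \<in> Q" "r x \<le> r a" "r a < r z" for x z
      proof (cases "x = a")
        case True
        then show ?thesis using ultra[of a z a] sym[of a z] that aQ by (auto simp: min_def)
      next
        case False
        then have "r x < r a" using inj that aQ by (metis inj_onD order_le_less)
        then show ?thesis using r that aQ by blast
      qed
      have upto: "K x a = min (K x y) (K y a)" if "x \<in> Q" "y \<in> Q" "r x < r y" "r y \<le> r a" for x y
      proof (cases "y = a")
        case True
        then show ?thesis using ultra[of a x a] sym[of a x] that aQ by (auto simp: min_def)
      next
        case False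
        then have "r y < r a" using inj that aQ by (metis inj_onD order_le_less)
        then show ?thesis using r that aQ by blast
      qed
      have "K x z = min (K x y) (K y z)"
        if xyz: "x \<in> insert w Q" "y \<in> insert w Q" "z \<in> insert w Q" and lt: "r' x < r' y" "r' y < r' z" for x y z
      proof -
        consider "x \<in> Q" "y \<in> Q" "z \<in> Q" | "x = w" "y \<in> Q" "z \<in> Q" | "x \<in> Q" "y = w" "z \<in> Q"
          | "x \<in> Q" "y \<in> Q" "z = w" using xyz lt insert.hyps(2) by auto
        then show ?thesis
        proof cases
          case 1
          then show ?thesis using r lt r'Q by simp
        next
          case 2
          then have "r a < r y" "r y < r z" using lt r'Q r'w b_cases[of y] by auto
          then show ?thesis using 2 right[of y] right[of z] r[of a y z] aQ by auto
        next
          case 3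
          then have *: "r x \<le> r a" "r a < r z" using lt r'Q r'w b_cases[of x] b_cases[of z] by auto
          then show ?thesis using 3 left[of x] right[of z] through[of x z] by (auto simp: min_def)
        next
          case 4
          then have *: "r x < r y" "r y \<le> r a" using lt r'Q r'w b_cases[of y] by auto
          then show ?thesis using 4 left[of x] left[of y] upto[of x y] by (auto simp: min_def)
        qed
      qed
      then show ?thesis using inj' by blast
    qed
  qed
  then show ?thesis using that by blast
qed

section \<open>Coding a finite ultrametric kernel by uniform positions\<close>

abbreviation unif :: "real measure" where
  "unif \<equiv> uniform_measure lborel {0<..<1}"

lemma prob_space_unif: "prob_space unif"
  by (rule prob_space_uniform_measure) auto

lemma emeasure_unif: "A \<in> sets borel \<Longrightarrow> emeasure unif A = emeasure lborel ({0<..<1} \<inter> A)"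
  by (subst emeasure_uniform_measure) (auto simp: divide_ennreal_def)

text \<open>\<open>F x\<close> is the mass ranked strictly before \<open>x\<close>, so the intervals
  from \<open>F x\<close> of length \<open>p x\<close> tile \<open>[0, 1)\<close> in the order of
  the ranks. For the covering take the lowest ranked \<open>x\<close> whose interval ends beyond
  \<open>s\<close>; if it began beyond \<open>s\<close>, its predecessor would already
  qualify.\<close>

lemma consecutive_intervals:
  fixes r :: "'q \<Rightarrow> real" and p :: "'q \<Rightarrow> real"
  assumes Q: "finite Q" and inj: "inj_on r Q" and p: "\<And>x. x \<in> Q \<Longrightarrow> 0 \<le> p x" "(\<Sum>x\<in>Q. p x) = 1"
  defines "F \<equiv> \<lambda>x. \<Sum>y | y \<in> Q \<and> r y < r x. p y"
  shows "x \<in> Q \<Longrightarrow> y \<in> Q \<Longrightarrow> r x < r y \<Longrightarrow> F x + p x \<le> F y"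
    and "x \<in> Q \<Longrightarrow> 0 \<le> F x"
    and "x \<in> Q \<Longrightarrow> F x + p x \<le> 1"
    and "0 \<le> s \<Longrightarrow> s < 1 \<Longrightarrow> \<exists>x\<in>Q. F x \<le> s \<and> s < F x + p x"
proof -
  have Fp: "F x + p x = (\<Sum>y | y \<in> Q \<and> r y \<le> r x. p y)" if "x \<in> Q" for x
  proof -
    have "{y \<in> Q. r y \<le> r x} = insert x {y \<in> Q. r y < r x}"
      using that inj by (auto simp: order_le_less dest: inj_onD)
    then show ?thesis using Q unfolding F_def by (simp add: add.commute)
  qed
  show "F x + p x \<le> F y" if "x \<in> Q" "y \<in> Q" "r x < r y" for x y
    unfolding Fp[OF that(1)] unfolding F_def using that Q p by (intro sum_mono2) auto
  show "0 \<le> F x" if "x \<in> Q" for x unfolding F_def using p by (intro sum_nonneg) auto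
  show "F x + p x \<le> 1" if "x \<in> Q" for x
    unfolding Fp[OF that] p(2)[symmetric] using p Q by (intro sum_mono2) auto
  show "\<exists>x\<in>Q. F x \<le> s \<and> s < F x + p x" if s: "0 \<le> s" "s < 1"
  proof -
    define A where "A = {x \<in> Q. s < F x + p x}"
    have "Q \<noteq> {}" using p by auto
    then obtain z where z: "z \<in> Q" "r z = Max (r ` Q)" using finite_obtain_Max[OF Q, of r] by blast
    then have "{y \<in> Q. r y \<le> r z} = Q" using Q by auto
    then have "z \<in> A" using Fp[OF z(1)] p z s by (simp add: A_def)
    then have "finite A" "A \<noteq> {}" using Q by (auto simp: A_def)
    then obtain x where x: "x \<in> A" "r x = Min (r ` A)" using finite_obtain_Min[of A r] by blast
    have "F x \<le> s"
    proof (rule ccontr)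
      assume "\<not> F x \<le> s"
      then have "{y \<in> Q. r y < r x} \<noteq> {}" using s unfolding F_def by (metis not_less sum.empty)
      then obtain y where y: "y \<in> Q" "r y < r x" "r y = Max (r ` {y \<in> Q. r y < r x})"
        using finite_obtain_Max[of "{y \<in> Q. r y < r x}" r] Q by auto
      have "{z \<in> Q. r z < r x} = {z \<in> Q. r z \<le> r y}"
        using y Q by (auto intro!: Max_ge simp: y(3))
      then have "F x = F y + p y" unfolding Fp[OF y(1)] by (simp add: F_def)
      then have "y \<in> A" using y \<open>\<not> F x \<le> s\<close> by (auto simp: A_def)
      then have "r x \<le> r y" unfolding x(2) using Q by (intro Min_le) (auto simp: A_def)
      then show False using y by simp
    qed
    then show ?thesis using x by (auto simp: A_def)
  qed
qed

lemma nn_integral_finite_valued: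
  assumes Q: "finite Q" and f: "f \<in> measurable M (count_space Q)"
  shows "(\<integral>\<^sup>+w. \<phi> (f w) \<partial>M) = (\<Sum>x\<in>Q. \<phi> x * emeasure M (f -` {x} \<inter> space M))"
proof -
  have [measurable]: "f -` {x} \<inter> space M \<in> sets M" if "x \<in> Q" for x
    using measurable_sets[OF f, of "{x}"] that by simp
  have "\<phi> (f w) = (\<Sum>x\<in>Q. \<phi> x * indicator (f -` {x} \<inter> space M) w)" if "w \<in> space M" for w
  proof -
    have "f w \<in> Q" using measurable_space[OF f that] by simp
    then have "(\<Sum>x\<in>Q. \<phi> x * indicator (f -` {x} \<inter> space M) w) = (\<Sum>x\<in>{f w}. \<phi> x * indicator (f -` {x} \<inter> space M) w)"
      using Q by (intro sum.mono_neutral_right) (auto simp: indicator_def)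
    then show ?thesis using that by (simp add: indicator_def)
  qed
  then have "(\<integral>\<^sup>+w. \<phi> (f w) \<partial>M) = (\<integral>\<^sup>+w. (\<Sum>x\<in>Q. \<phi> x * indicator (f -` {x} \<inter> space M) w) \<partial>M)"
    by (rule nn_integral_cong)
  also have "\<dots> = (\<Sum>x\<in>Q. \<phi> x * emeasure M (f -` {x} \<inter> space M))"
    by (subst nn_integral_sum) (auto intro!: sum.cong nn_integral_cmult_indicator)
  finally show ?thesis .
qed

text \<open>Change of variables for one tile. With the factor \<open>p\<close> on the left the
  formula also covers tiles of length 0.\<close>

lemma emeasure_unif_affine:
  assumes A: "A \<in> sets borel" and p: "0 \<le> p"
  shows "ennreal p * emeasure unif ((\<lambda>u. F + u * p) -` A) = emeasure lborel (A \<inter> {F<..<F + p})"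
proof (cases "p = 0")
  case False
  then have p: "0 < p" using p by simp
  have B: "(\<lambda>u. F + u * p) -` A \<in> sets borel"
    using measurable_sets[of "\<lambda>u. F + u * p" borel borel A] A by simp
  have "emeasure lborel (A \<inter> {F<..<F + p}) = (\<integral>\<^sup>+x. indicator (A \<inter> {F<..<F + p}) x \<partial>lborel)"
    using A by simp
  also have "\<dots> = ennreal p * (\<integral>\<^sup>+u. indicator (A \<inter> {F<..<F + p}) (F + p * u) \<partial>lborel)"
    using nn_integral_real_affine[of "indicator (A \<inter> {F<..<F + p})" p F] p A by simp
  also have "(\<lambda>u. indicator (A \<inter> {F<..<F + p}) (F + p * u) :: ennreal) =
      indicator ({0<..<1} \<inter> (\<lambda>u. F + u * p) -` A)"
    using p by (auto simp: indicator_def mult.commute fun_eq_iff zero_less_mult_iff)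
  also have "(\<integral>\<^sup>+u. indicator ({0<..<1} \<inter> (\<lambda>u. F + u * p) -` A) u \<partial>lborel) =
      emeasure lborel ({0<..<1} \<inter> (\<lambda>u. F + u * p) -` A)"
    using B by (intro nn_integral_indicator) auto
  finally show ?thesis by (simp add: emeasure_unif[OF B])
qed simp

text \<open>An auxiliary uniform variable picks a point \<open>S z\<close> inside the tile belonging
  to \<open>f (fst z)\<close>. Whatever the law of \<open>f\<close>, the position \<open>S\<close>
  is uniform, and \<open>e\<close> recovers the tree point from it. Since \<open>e\<close> is
  monotone for the depth-first order, the kernel read through \<open>e\<close> obeys the minimum
  rule along the interval.\<close>

lemma ultrametric_coding:
  fixes K :: "'q \<Rightarrow> 'q \<Rightarrow> real" and M :: "'a measure"
  assumes "prob_space M" and Q: "finite Q" and f: "f \<in> measurable M (count_space Q)"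
    and sym: "\<And>x y. x \<in> Q \<Longrightarrow> y \<in> Q \<Longrightarrow> K x y = K y x"
    and ultra: "\<And>x y z. x \<in> Q \<Longrightarrow> y \<in> Q \<Longrightarrow> z \<in> Q \<Longrightarrow> min (K x y) (K y z) \<le> K x z"
  obtains S :: "'a \<times> real \<Rightarrow> real" and e :: "real \<Rightarrow> 'q" where
    "S \<in> borel_measurable (M \<Otimes>\<^sub>M unif)" "distr (M \<Otimes>\<^sub>M unif) borel S = unif"
    "e \<in> measurable borel (count_space Q)"
    "\<And>s t u. 0 < s \<Longrightarrow> s \<le> t \<Longrightarrow> t \<le> u \<Longrightarrow> u < 1 \<Longrightarrow> K (e s) (e u) = min (K (e s) (e t)) (K (e t) (e u))"
    "AE z in M \<Otimes>\<^sub>M unif. 0 < S z \<and> S z < 1 \<and> e (S z) = f (fst z)"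
proof -
  interpret M: prob_space M by fact
  interpret U: prob_space unif by (rule prob_space_unif)
  interpret P: pair_sigma_finite M unif ..
  obtain r :: "'q \<Rightarrow> real" where inj: "inj_on r Q"
    and r: "\<And>x y z. x \<in> Q \<Longrightarrow> y \<in> Q \<Longrightarrow> z \<in> Q \<Longrightarrow> r x < r y \<Longrightarrow> r y < r z \<Longrightarrow> K x z = min (K x y) (K y z)"
    by (rule ultrametric_linear_order[OF Q, where K = K]) (blast intro: sym ultra)+
  define p where "p x = M.prob (f -` {x} \<inter> space M)" for x
  have fm: "f -` {x} \<inter> space M \<in> sets M" if "x \<in> Q" for x
    using measurable_sets[OF f, of "{x}"] that by simp
  have fQ: "f w \<in> Q" if "w \<in> space M" for w using measurable_space[OF f that] by simp
  have p0: "0 \<le> p x" for x by (simp add: p_def)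
  have "(\<Sum>x\<in>Q. ennreal (p x)) = (\<integral>\<^sup>+w. 1 \<partial>M)"
    using nn_integral_finite_valued[OF Q f, of "\<lambda>_. 1"] by (simp add: p_def M.emeasure_eq_measure)
  then have p1: "(\<Sum>x\<in>Q. p x) = 1"
    using p0 by (simp add: sum_ennreal M.emeasure_space_1)
  define F where "F x = (\<Sum>y | y \<in> Q \<and> r y < r x. p y)" for x
  note intervals = consecutive_intervals[OF Q inj p0 p1, folded F_def]
  obtain x0 where x0: "x0 \<in> Q" using p1 by fastforce
  \<comment> \<open>The default \<open>x0\<close> outside \<open>[0, 1)\<close> makes
    \<open>e\<close> a Borel function on the whole line with values in \<open>Q\<close>.\<close>
  define e where "e s = (if 0 \<le> s \<and> s < 1 then SOME x. x \<in> Q \<and> F x \<le> s \<and> s < F x + p x else x0)" for s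
  have e: "e s \<in> Q" "F (e s) \<le> s" "s < F (e s) + p (e s)" if "0 \<le> s" "s < 1" for s
    using someI_ex[of "\<lambda>x. x \<in> Q \<and> F x \<le> s \<and> s < F x + p x"] intervals(4)[OF that] that
    unfolding e_def by auto
  have e_unique: "e s = x" if s: "0 \<le> s" "s < 1" and x: "x \<in> Q" "F x \<le> s" "s < F x + p x" for s x
  proof (rule ccontr)
    assume "e s \<noteq> x"
    then consider "r (e s) < r x" | "r x < r (e s)" using inj e(1)[OF s] x by (metis inj_onD linorder_neqE)
    then show False using intervals(1)[of "e s" x] intervals(1)[of x "e s"] e[OF s] x by cases auto
  qed
  have e_meas: "e \<in> measurable borel (count_space Q)"
  proof (rule measurable_count_space_eq2[THEN iffD2, OF Q], intro conjI ballI)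
    show "e \<in> space borel \<rightarrow> Q" using e(1) x0 by (auto simp: e_def)
    fix x assume x: "x \<in> Q"
    have "e -` {x} \<inter> space borel = ({0..<1} \<inter> {F x..<F x + p x}) \<union> (if x = x0 then - {0..<1} else {})"
    proof -
      have "e s = x \<longleftrightarrow> s \<in> ({0..<1} \<inter> {F x..<F x + p x}) \<union> (if x = x0 then - {0..<1} else {})" for s
      proof (cases "0 \<le> s \<and> s < 1")
        case True
        then show ?thesis using e_unique[of s x] e[of s] x by auto
      next
        case False
        then show ?thesis by (auto simp: e_def)
      qed
      then show ?thesis by (intro set_eqI) simp
    qed
    then show "e -` {x} \<inter> space borel \<in> sets borel" by auto
  qed
  have e_mono: "r (e s) \<le> r (e t)" if "0 \<le> s" "s \<le> t" "t < 1" for s t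
    using intervals(1)[of "e t" "e s"] e[of s] e[of t] that by (cases "r (e t) < r (e s)") auto
  define S where "S z = F (f (fst z)) + snd z * p (f (fst z))" for z :: "'a \<times> real"
  have [measurable]: "(\<lambda>w. h (f w)) \<in> borel_measurable M" for h :: "'q \<Rightarrow> real"
    using measurable_compose[OF f, of h borel] by simp
  have S[measurable]: "S \<in> borel_measurable (M \<Otimes>\<^sub>M unif)"
    unfolding S_def by measurable
  have "distr (M \<Otimes>\<^sub>M unif) borel S = unif"
  proof (rule measure_eqI)
    fix A assume "A \<in> sets (distr (M \<Otimes>\<^sub>M unif) borel S)"
    then have A[measurable]: "A \<in> sets borel" by simp
    have "emeasure (distr (M \<Otimes>\<^sub>M unif) borel S) A = emeasure (M \<Otimes>\<^sub>M unif) (S -` A \<inter> space (M \<Otimes>\<^sub>M unif))"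
      by (rule emeasure_distr) auto
    also have "\<dots> = (\<integral>\<^sup>+w. emeasure unif (Pair w -` (S -` A \<inter> space (M \<Otimes>\<^sub>M unif))) \<partial>M)"
      by (rule U.emeasure_pair_measure_alt) (rule measurable_sets[OF S A])
    also have "\<dots> = (\<integral>\<^sup>+w. emeasure unif ((\<lambda>u. F (f w) + u * p (f w)) -` A) \<partial>M)"
      by (intro nn_integral_cong arg_cong2[where f=emeasure]) (auto simp: S_def space_pair_measure)
    also have "\<dots> = (\<Sum>x\<in>Q. emeasure unif ((\<lambda>u. F x + u * p x) -` A) * ennreal (p x))"
      by (subst nn_integral_finite_valued[OF Q f]) (simp add: p_def M.emeasure_eq_measure)
    also have "\<dots> = (\<Sum>x\<in>Q. emeasure lborel (A \<inter> {F x<..<F x + p x}))"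
      by (intro sum.cong refl) (simp add: emeasure_unif_affine[OF A p0, symmetric] mult.commute)
    also have "\<dots> = emeasure lborel (\<Union>x\<in>Q. A \<inter> {F x<..<F x + p x})"
    proof (rule sum_emeasure)
      show "disjoint_family_on (\<lambda>x. A \<inter> {F x<..<F x + p x}) Q"
        unfolding disjoint_family_on_def
      proof (intro ballI impI)
        fix x y assume xy: "x \<in> Q" "y \<in> Q" "x \<noteq> y"
        then have "r x < r y \<or> r y < r x" using inj by (metis inj_onD linorder_neqE)
        then have "F x + p x \<le> F y \<or> F y + p y \<le> F x" using intervals(1) xy by blast
        then show "A \<inter> {F x<..<F x + p x} \<inter> (A \<inter> {F y<..<F y + p y}) = {}" by auto
      qed
    qed (use Q in auto)
    also have "\<dots> = emeasure lborel ({0<..<1} \<inter> A)"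
    proof (rule emeasure_eq_AE)
      \<comment> \<open>The open tiles cover \<open>(0, 1)\<close> except for the left endpoints of
        tiles, a finite set.\<close>
      have "AE s in lborel. s \<notin> F ` Q"
        using Q by (intro AE_not_in countable_imp_null_set_lborel) (simp add: countable_finite)
      then show "AE s in lborel. s \<in> (\<Union>x\<in>Q. A \<inter> {F x<..<F x + p x}) \<longleftrightarrow> s \<in> {0<..<1} \<inter> A"
      proof eventually_elim
        case (elim s)
        show ?case
        proof
          assume "s \<in> (\<Union>x\<in>Q. A \<inter> {F x<..<F x + p x})"
          then obtain x where "x \<in> Q" "s \<in> A" "F x < s" "s < F x + p x" by auto
          then show "s \<in> {0<..<1} \<inter> A" using intervals(2,3)[of x] by auto
        next
          assume s: "s \<in> {0<..<1} \<inter> A"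
          then obtain x where x: "x \<in> Q" "F x \<le> s" "s < F x + p x" using intervals(4)[of s] by auto
          then have "F x < s" using elim by (auto simp: order_le_less)
          then show "s \<in> (\<Union>x\<in>Q. A \<inter> {F x<..<F x + p x})" using x s by auto
        qed
      qed
    qed (use Q in auto)
    finally show "emeasure (distr (M \<Otimes>\<^sub>M unif) borel S) A = emeasure unif A"
      by (simp only: emeasure_unif[OF A])
  qed simp
  have ae: "AE z in M \<Otimes>\<^sub>M unif. 0 < S z \<and> S z < 1 \<and> e (S z) = f (fst z)"
  proof -
    \<comment> \<open>A point of mass 0 has an empty tile and cannot be recovered from a position;
      such points are almost surely not hit.\<close>
    have "AE w in M. p (f w) \<noteq> 0"
    proof (rule AE_I[of _ _ "\<Union>x\<in>{x \<in> Q. p x = 0}. f -` {x} \<inter> space M"])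
      show "{w \<in> space M. \<not> p (f w) \<noteq> 0} \<subseteq> (\<Union>x\<in>{x \<in> Q. p x = 0}. f -` {x} \<inter> space M)"
        using fQ by auto
      have "(\<Union>x\<in>{x \<in> Q. p x = 0}. f -` {x} \<inter> space M) \<in> null_sets M"
        using Q fm by (intro null_sets_UN' countable_finite) (auto simp: null_sets_def p_def M.emeasure_eq_measure)
      then show "emeasure M (\<Union>x\<in>{x \<in> Q. p x = 0}. f -` {x} \<inter> space M) = 0"
        "(\<Union>x\<in>{x \<in> Q. p x = 0}. f -` {x} \<inter> space M) \<in> sets M" by auto
    qed
    then have 1: "AE z in M \<Otimes>\<^sub>M unif. p (f (fst z)) \<noteq> 0"
      by (intro AE_distrD[OF measurable_fst[of M unif]]) (simp only: U.distr_pair_fst)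
    have u: "AE u in unif. 0 < u \<and> u < 1"
      using AE_uniform_measureI[of "{0<..<1::real}" lborel "\<lambda>u. 0 < u \<and> u < 1"] by simp
    have 2: "AE z in M \<Otimes>\<^sub>M unif. 0 < snd z \<and> snd z < 1"
    proof (intro P.AE_pair_measure)
      show "{z \<in> space (M \<Otimes>\<^sub>M unif). 0 < snd z \<and> snd z < 1} \<in> sets (M \<Otimes>\<^sub>M unif)"
        by measurable
    qed (use u in simp)
    show ?thesis
      using 1 2 AE_space
    proof eventually_elim
      case (elim z)
      define x where "x = f (fst z)"
      have x: "x \<in> Q" "0 < p x" using elim fQ p0[of x] by (auto simp: x_def space_pair_measure)
      have "0 < snd z * p x" "snd z * p x < p x" using elim x by auto
      then have *: "F x < S z" "S z < F x + p x" by (auto simp: S_def x_def)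
      then have "0 < S z" "S z < 1" using intervals(2,3)[OF x(1)] by linarith+
      then show ?case using e_unique[of "S z" x] * x by (simp add: x_def)
    qed
  qed
  have "K (e s) (e u) = min (K (e s) (e t)) (K (e t) (e u))" if "0 < s" "s \<le> t" "t \<le> u" "u < 1" for s t u
  proof -
    have q: "e s \<in> Q" "e t \<in> Q" "e u \<in> Q" using e that by auto
    have le: "r (e s) \<le> r (e t)" "r (e t) \<le> r (e u)" using e_mono that by auto
    show ?thesis
    \<comment> \<open>If two of the positions belong to the same tile, the rule reduces to
      \<open>K x y <= K x x\<close>, an instance of the ultrametric inequality.\<close>
    proof (cases "e s = e t \<or> e t = e u")
      case True
      then show ?thesis
        using ultra[of "e s" "e u" "e s"] ultra[of "e u" "e s" "e u"] sym[of "e s" "e u"] q by (auto simp: min_def)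
    next
      case False
      then have "r (e s) < r (e t)" "r (e t) < r (e u)" using le inj q by (metis inj_onD order_le_less)+
      then show ?thesis using r q by blast
    qed
  qed
  from that[OF S \<open>distr (M \<Otimes>\<^sub>M unif) borel S = unif\<close> e_meas this ae] show ?thesis by simp
qed

section \<open>Limits of interval kernels\<close>

text \<open>The diagonal argument for a common bound, applied after division by a bound that may
  depend on the point.\<close>

lemma bounded_pointwise_convergent_subsequence:
  fixes f :: "nat \<Rightarrow> 'a \<Rightarrow> real"
  assumes "countable A" and bdd: "\<And>x. x \<in> A \<Longrightarrow> \<exists>B. \<forall>n. \<bar>f n x\<bar> \<le> B"
  obtains k where "strict_mono (k :: nat \<Rightarrow> nat)" "\<And>x. x \<in> A \<Longrightarrow> convergent (\<lambda>n. f (k n) x)"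
proof -
  obtain B where B: "\<And>x n. x \<in> A \<Longrightarrow> \<bar>f n x\<bar> \<le> B x" using bdd by metis
  define C where "C x = max 1 (B x)" for x
  have C: "\<bar>f n x / C x\<bar> \<le> 1" "0 < C x" if "x \<in> A" for n x
  proof -
    show "0 < C x" by (simp add: C_def)
    then show "\<bar>f n x / C x\<bar> \<le> 1" using B[OF that, of n] by (auto simp: C_def)
  qed
  obtain k where k: "strict_mono (k :: nat \<Rightarrow> nat)" "\<And>x. x \<in> A \<Longrightarrow> \<exists>l. (\<lambda>n. f (k n) x / C x) \<longlonglongrightarrow> l"
    using function_convergent_subsequence[OF \<open>countable A\<close>, of "\<lambda>n x. f n x / C x" 1] C by auto
  show thesis
  proof (rule that[OF k(1)])
    fix x assume x: "x \<in> A"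
    then obtain l where "(\<lambda>n. f (k n) x / C x) \<longlonglongrightarrow> l" using k by blast
    then have "(\<lambda>n. f (k n) x / C x * C x) \<longlonglongrightarrow> l * C x" by (intro tendsto_intros)
    then show "convergent (\<lambda>n. f (k n) x)" using C(2)[OF x] by (auto simp: convergent_def)
  qed
qed

text \<open>Taking the supremum over rational intervals around \<open>[s, t]\<close>, rather than inside it, is what
  preserves the minimum rule at every splitting point.\<close>

lemma interval_kernel_limit:
  fixes g :: "nat \<Rightarrow> real \<Rightarrow> real \<Rightarrow> real"
  assumes mid: "\<And>n s t u. 0 < s \<Longrightarrow> s \<le> t \<Longrightarrow> t \<le> u \<Longrightarrow> u < 1 \<Longrightarrow> g n s u = min (g n s t) (g n t u)"
    and nonneg: "\<And>n s t. 0 < s \<Longrightarrow> s \<le> t \<Longrightarrow> t < 1 \<Longrightarrow> 0 \<le> g n s t"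
    and bdd: "\<And>s t. 0 < s \<Longrightarrow> s < t \<Longrightarrow> t < 1 \<Longrightarrow> \<exists>B. \<forall>n. g n s t \<le> B"
  obtains k :: "nat \<Rightarrow> nat" and h C where "strict_mono k" "countable C"
    "\<And>s t u. 0 < s \<Longrightarrow> s < t \<Longrightarrow> t < u \<Longrightarrow> u < 1 \<Longrightarrow> h s u = min (h s t) (h t u)"
    "\<And>s t. 0 < s \<Longrightarrow> s < t \<Longrightarrow> t < 1 \<Longrightarrow> 0 \<le> h s t"
    "\<And>s t \<sigma> \<tau>. 0 < s \<Longrightarrow> s < t \<Longrightarrow> t < 1 \<Longrightarrow> s \<notin> C \<Longrightarrow> t \<notin> C \<Longrightarrow> \<sigma> \<longlonglongrightarrow> s \<Longrightarrow> \<tau> \<longlonglongrightarrow> t \<Longrightarrow>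
      (\<lambda>n. g (k n) (\<sigma> n) (\<tau> n)) \<longlonglongrightarrow> h s t"
    "\<And>s t \<sigma> \<tau> c. 0 < s \<Longrightarrow> s < t \<Longrightarrow> t < 1 \<Longrightarrow> \<sigma> \<longlonglongrightarrow> s \<Longrightarrow> \<tau> \<longlonglongrightarrow> t \<Longrightarrow> c < h s t \<Longrightarrow>
      \<forall>\<^sub>F n in sequentially. c < g (k n) (\<sigma> n) (\<tau> n)"
proof -
  \<comment> \<open>The minimum rule makes the kernel grow when the interval shrinks.\<close>
  have g_mono: "g n s u \<le> g n s' u'" if "0 < s" "s \<le> s'" "s' \<le> u'" "u' \<le> u" "u < 1" for n s s' u u'
    using mid[of s s' u n] mid[of s' u' u n] that by simp
  define A where "A = {(q, q'). q \<in> \<rat> \<and> q' \<in> \<rat> \<and> 0 < q \<and> q < q' \<and> q' < (1::real)}"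
  have "countable (\<rat> \<times> \<rat> :: (real \<times> real) set)" by (intro countable_SIGMA countable_rat)
  then have "countable A" by (rule countable_subset[rotated]) (auto simp: A_def)
  obtain k where k: "strict_mono (k :: nat \<Rightarrow> nat)"
    and conv: "\<And>x. x \<in> A \<Longrightarrow> convergent (\<lambda>n. g (k n) (fst x) (snd x))"
  proof (rule bounded_pointwise_convergent_subsequence[OF \<open>countable A\<close>, of "\<lambda>n x. g n (fst x) (snd x)"])
    fix x assume "x \<in> A"
    then have x: "0 < fst x" "fst x < snd x" "snd x < 1" by (auto simp: A_def)
    then show "\<exists>B. \<forall>n. \<bar>g n (fst x) (snd x)\<bar> \<le> B"
      using bdd[OF x] nonneg[of "fst x" "snd x"] by force
  qed blast
  define L where "L q q' = lim (\<lambda>n. g (k n) q q')" for q q'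
  have L: "(\<lambda>n. g (k n) q q') \<longlonglongrightarrow> L q q'" if "(q, q') \<in> A" for q q'
    using conv[OF that] unfolding L_def by (simp add: convergent_LIMSEQ_iff)
  have L_mono: "L q r \<le> L q' r'" if "(q, r) \<in> A" "(q', r') \<in> A" "q \<le> q'" "r' \<le> r" for q r q' r'
    by (rule LIMSEQ_le[OF L[OF that(1)] L[OF that(2)]]) (use that in \<open>auto simp: A_def intro!: g_mono\<close>)
  have L_nonneg: "0 \<le> L q r" if "(q, r) \<in> A" for q r
    by (rule LIMSEQ_le_const[OF L[OF that]]) (use that in \<open>auto simp: A_def intro!: nonneg\<close>)
  \<comment> \<open>The minimum rule for intervals that overlap instead of abutting. It is needed
    because rational intervals around \<open>[s, t]\<close> and around \<open>[t, u]\<close> both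
    reach beyond \<open>t\<close>.\<close>
  have L_union: "min (L q q') (L r r') \<le> L q r'"
    if "(q, q') \<in> A" "(r, r') \<in> A" "(q, r') \<in> A" "r < q'" for q q' r r'
  proof (rule LIMSEQ_le[OF tendsto_min[OF L[OF that(1)] L[OF that(2)]] L[OF that(3)]], intro exI allI impI)
    fix n
    show "min (g (k n) q q') (g (k n) r r') \<le> g (k n) q r'"
    proof (cases "q' \<le> r'")
      case True
      then show ?thesis
        using mid[of q q' r' "k n"] g_mono[of r q' r' r' "k n"] that by (auto simp: A_def)
    next
      case False
      then show ?thesis using g_mono[of q q r' q' "k n"] that by (auto simp: A_def)
    qed
  qed
  define P where "P s t = {(q, q'). (q, q') \<in> A \<and> q < s \<and> t < q'}" for s t
  define h where "h s t = (SUP (q, q') \<in> P s t. L q q')" for s t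
  have rat_between: "\<exists>q\<in>\<rat>. a < q \<and> q < b" if "a < b" for a b :: real
    using Rats_dense_in_real[OF that] by blast
  have P_nonempty: "P s t \<noteq> {}" if "0 < s" "s < t" "t < 1" for s t
    using rat_between[of 0 s] rat_between[of t 1] that unfolding P_def A_def by fastforce
  have P_bdd: "bdd_above ((\<lambda>(q, q'). L q q') ` P s t)" if st: "0 < s" "s < t" "t < 1" for s t
  proof -
    obtain r where r: "r \<in> \<rat>" "s < r" "r < t" using rat_between[OF st(2)] by blast
    obtain r' where r': "r' \<in> \<rat>" "r < r'" "r' < t" using rat_between[OF r(3)] by blast
    \<comment> \<open>A rational interval strictly inside \<open>(s, t)\<close> has a larger kernel
      than all those around \<open>[s, t]\<close>, so it bounds the supremum.\<close>
    have "L q q' \<le> L r r'" if "(q, q') \<in> P s t" for q q'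
      using that r r' st by (intro L_mono) (auto simp: P_def A_def)
    then show ?thesis by (intro bdd_aboveI2[of _ _ "L r r'"]) auto
  qed
  have less_h: "c < h s t \<longleftrightarrow> (\<exists>q q'. (q, q') \<in> A \<and> q < s \<and> t < q' \<and> c < L q q')"
    if "0 < s" "s < t" "t < 1" for c s t
    unfolding h_def using less_cSUP_iff[OF P_nonempty[OF that] P_bdd[OF that], of c] by (auto simp: P_def)
  have L_le_h: "L q q' \<le> h s t" if "(q, q') \<in> A" "0 < s" "s < t" "t < 1" "q < s" "t < q'" for q q' s t
    using less_h[OF that(2-4), of "h s t"] that by (meson less_irrefl not_less)
  have h_nonneg: "0 \<le> h s t" if st: "0 < s" "s < t" "t < 1" for s t
  proof -
    obtain q q' where "(q, q') \<in> P s t" using P_nonempty[OF st] by auto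
    then show ?thesis using L_le_h[of q q' s t] L_nonneg[of q q'] st by (auto simp: P_def)
  qed
  have h_mid: "h s u = min (h s t) (h t u)" if st: "0 < s" "s < t" "t < u" "u < 1" for s t u
  proof (rule antisym)
    show "h s u \<le> min (h s t) (h t u)"
    proof (rule dense_le)
      fix c assume "c < h s u"
      then obtain q q' where "(q, q') \<in> A" "q < s" "u < q'" "c < L q q'"
        using less_h[of s u c] st by auto
      then have "c < h s t" "c < h t u" using less_h[of s t c] less_h[of t u c] st by auto
      then show "c \<le> min (h s t) (h t u)" by simp
    qed
    show "min (h s t) (h t u) \<le> h s u"
    proof (rule dense_le)
      fix c assume "c < min (h s t) (h t u)"
      then obtain q q' r r' where *: "(q, q') \<in> A" "q < s" "t < q'" "c < L q q'"
        "(r, r') \<in> A" "r < t" "u < r'" "c < L r r'"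
        using less_h[of s t c] less_h[of t u c] st by auto
      then have A: "(q, r') \<in> A" using st by (auto simp: A_def)
      have "c < L q r'" using L_union[OF *(1,5) A] * by auto
      then show "c \<le> h s u" using less_h[of s u c] A * st by auto
    qed
  qed
  have low: "\<forall>\<^sub>F n in sequentially. c < g (k n) (\<sigma> n) (\<tau> n)"
    if st: "0 < s" "s < t" "t < 1" and lim: "\<sigma> \<longlonglongrightarrow> s" "\<tau> \<longlonglongrightarrow> t" and c: "c < h s t" for s t \<sigma> \<tau> c
  proof -
    obtain q q' where q: "(q, q') \<in> A" "q < s" "t < q'" "c < L q q'" using c less_h[OF st] by blast
    obtain m where m: "s < m" "m < t" using dense[OF st(2)] by blast
    have "\<forall>\<^sub>F n in sequentially. q < \<sigma> n" "\<forall>\<^sub>F n in sequentially. \<sigma> n < m"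
      using order_tendstoD[OF lim(1)] q m by auto
    moreover have "\<forall>\<^sub>F n in sequentially. \<tau> n < q'" "\<forall>\<^sub>F n in sequentially. m < \<tau> n"
      using order_tendstoD[OF lim(2)] q m by auto
    moreover have "\<forall>\<^sub>F n in sequentially. c < g (k n) q q'"
      using order_tendstoD(1)[OF L[OF q(1)] q(4)] .
    ultimately show ?thesis
    proof eventually_elim
      case (elim n)
      then show ?case using g_mono[of q "\<sigma> n" "\<tau> n" q' "k n"] q(1) by (auto simp: A_def)
    qed
  qed
  \<comment> \<open>With one endpoint fixed at a rational \<open>m\<close>, the limit kernel is a
    monotone function of the other, so its discontinuities are countable; \<open>C\<close> collects
    them over all \<open>m\<close>.\<close>
  define C where "C = (\<Union>m \<in> \<rat> \<inter> {0<..<1}. {x \<in> {0<..<m}. \<not> isCont (\<lambda>x. h x m) x} \<union>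
    {x \<in> {m<..<1}. \<not> isCont (\<lambda>x. - h m x) x})"
  have "countable C"
    unfolding C_def
  proof (intro countable_UN countable_Un)
    show "countable (\<rat> \<inter> {0<..<1::real})" by (rule countable_Int1[OF countable_rat])
    fix m :: real assume m: "m \<in> \<rat> \<inter> {0<..<1}"
    have "h x m \<le> h y m" if "0 < x" "x < y" "y < m" for x y
      using h_mid[of x y m] m that by auto
    then have "mono_on {0<..<m} (\<lambda>x. h x m)"
      by (intro mono_onI) (metis greaterThanLessThan_iff order_le_less)
    then show "countable {x \<in> {0<..<m}. \<not> isCont (\<lambda>x. h x m) x}"
      by (intro mono_on_ctble_discont_open) auto
    have "h m y \<le> h m x" if "m < x" "x < y" "y < 1" for x y
      using h_mid[of m x y] m that by auto
    then have "mono_on {m<..<1} (\<lambda>x. - h m x)"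
      by (intro mono_onI) (metis greaterThanLessThan_iff order_le_less neg_le_iff_le)
    then show "countable {x \<in> {m<..<1}. \<not> isCont (\<lambda>x. - h m x) x}"
      by (intro mono_on_ctble_discont_open) auto
  qed
  have main: "(\<lambda>n. g (k n) (\<sigma> n) (\<tau> n)) \<longlonglongrightarrow> h s t"
    if st: "0 < s" "s < t" "t < 1" "s \<notin> C" "t \<notin> C" and lim: "\<sigma> \<longlonglongrightarrow> s" "\<tau> \<longlonglongrightarrow> t" for s t \<sigma> \<tau>
  proof (rule order_tendstoI)
    fix c assume "c < h s t"
    then show "\<forall>\<^sub>F n in sequentially. c < g (k n) (\<sigma> n) (\<tau> n)" using low st lim by blast
  next
    fix c assume c: "h s t < c"
    \<comment> \<open>Splitting at \<open>m\<close> turns \<open>h s t\<close> into a minimum of two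
      functions of one variable each. By continuity of the smaller one, the interval can be shrunk
      at one end with the kernel still below \<open>c\<close>; a rational interval slightly wider
      than the shrunken one then bounds the sequence from above.\<close>
    obtain m where m: "m \<in> \<rat>" "s < m" "m < t" using rat_between[OF st(2)] by blast
    have "isCont (\<lambda>x. h x m) s"
      using st m unfolding C_def by auto
    moreover have "isCont (\<lambda>x. - (- h m x)) t"
      by (rule continuous_minus) (use st m in \<open>auto simp: C_def\<close>)
    ultimately have lims: "((\<lambda>x. h x m) \<longlongrightarrow> h s m) (at_right s)" "((\<lambda>x. h m x) \<longlongrightarrow> h m t) (at_left t)"
      unfolding isCont_def by (auto intro: tendsto_within_subset)
    obtain x y where xy: "s < x" "x < m" "m < y" "y < t" "min (h x m) (h m y) < c"
    proof -
      have "h s m < c \<or> h m t < c" using c h_mid[of s m t] st m by auto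
      then show thesis
      proof
        assume "h s m < c"
        then have "\<forall>\<^sub>F x in at_right s. h x m < c" using order_tendstoD(2)[OF lims(1)] by blast
        moreover have "\<forall>\<^sub>F x in at_right s. x \<in> {s<..<m}" using m by (intro eventually_at_right_real)
        ultimately have "\<forall>\<^sub>F x in at_right s. h x m < c \<and> x \<in> {s<..<m}" by (rule eventually_conj)
        then obtain x where "h x m < c" "x \<in> {s<..<m}"
          using eventually_happens[of _ "at_right s"] by (auto simp: trivial_limit_at_right_real)
        moreover obtain y where "m < y" "y < t" using dense[OF m(3)] by blast
        ultimately show thesis using that[of x y] by auto
      next
        assume "h m t < c"
        then have "\<forall>\<^sub>F x in at_left t. h m x < c" using order_tendstoD(2)[OF lims(2)] by blast
        moreover have "\<forall>\<^sub>F x in at_left t. x \<in> {m<..<t}" using m by (intro eventually_at_left_real)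
        ultimately have "\<forall>\<^sub>F x in at_left t. h m x < c \<and> x \<in> {m<..<t}" by (rule eventually_conj)
        then obtain y where "h m y < c" "y \<in> {m<..<t}"
          using eventually_happens[of _ "at_left t"] by (auto simp: trivial_limit_at_left_real)
        moreover obtain x where "s < x" "x < m" using dense[OF m(2)] by blast
        ultimately show thesis using that[of x y] by auto
      qed
    qed
    obtain q where q: "q \<in> \<rat>" "s < q" "q < x" using rat_between[OF xy(1)] by blast
    obtain q' where q': "q' \<in> \<rat>" "y < q'" "q' < t" using rat_between[OF xy(4)] by blast
    have A: "(q, q') \<in> A" using q q' xy st by (auto simp: A_def)
    have "L q q' \<le> h x y" using q q' xy st A by (intro L_le_h) auto
    also have "h x y = min (h x m) (h m y)" using xy st by (intro h_mid) auto
    finally have "L q q' < c" using xy(5) by linarith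
    then have "\<forall>\<^sub>F n in sequentially. g (k n) q q' < c" using order_tendstoD(2)[OF L[OF A]] by blast
    moreover have "\<forall>\<^sub>F n in sequentially. \<sigma> n < q" "\<forall>\<^sub>F n in sequentially. 0 < \<sigma> n"
      using order_tendstoD[OF lim(1)] q st by auto
    moreover have "\<forall>\<^sub>F n in sequentially. q' < \<tau> n" "\<forall>\<^sub>F n in sequentially. \<tau> n < 1"
      using order_tendstoD[OF lim(2)] q' st by auto
    ultimately show "\<forall>\<^sub>F n in sequentially. g (k n) (\<sigma> n) (\<tau> n) < c"
    proof eventually_elim
      case (elim n)
      then show ?case using g_mono[of "\<sigma> n" q q' "\<tau> n" "k n"] A by (auto simp: A_def)
    qed
  qed
  show thesis
    by (rule that[of k C h]) (fact k \<open>countable C\<close> h_mid h_nonneg main low)+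
qed

section \<open>Laws of distance matrices\<close>

lemma topspace_matrix: "topspace (matrix_topology r) = extensional ({1..r} \<times> {1..r})"
  by (simp add: matrix_topology_def PiE_def)

lemma continuous_map_restrict_matrix:
  "continuous_map euclidean (matrix_topology r) (\<lambda>f. restrict f ({1..r} \<times> {1..r}))"
  unfolding matrix_topology_def continuous_map_componentwise
  by (auto intro!: continuous_on_product_coordinates)

lemma space_borel_of [simp]: "space (borel_of X) = topspace X"
  unfolding borel_of_def by (rule space_measure_of) (auto dest: openin_subset)

lemma sets_borel_of: "sets (borel_of X) = sigma_sets (topspace X) {U. openin X U}"
  unfolding borel_of_def by (rule sets_measure_of) (auto dest: openin_subset)

lemma borel_of_openin: "openin X U \<Longrightarrow> U \<in> sets (borel_of X)"
  by (simp add: sets_borel_of)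

lemma measurable_borel_ofI:
  assumes "\<And>x. x \<in> space M \<Longrightarrow> f x \<in> topspace X"
    and "\<And>U. openin X U \<Longrightarrow> f -` U \<inter> space M \<in> sets M"
  shows "f \<in> measurable M (borel_of X)"
  unfolding borel_of_def using assms by (intro measurable_measure_of) (auto dest: openin_subset)

lemma measurable_continuous_map_borel_of:
  assumes "continuous_map X euclideanreal f" "sets M = sets (borel_of X)"
  shows "f \<in> borel_measurable M"
proof (rule borel_measurableI)
  fix S :: "real set" assume "open S"
  then have "openin X {x \<in> topspace X. f x \<in> S}"
    using assms(1) by (auto simp: continuous_map_def)
  moreover have "f -` S \<inter> space M = {x \<in> topspace X. f x \<in> S}"
    using sets_eq_imp_space_eq[OF assms(2)] by auto
  ultimately show "f -` S \<inter> space M \<in> sets M" using borel_of_openin assms(2) by metis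
qed

text \<open>Padding with zeros gives a matrix \<open>e\<close> indexed by all pairs of naturals, for
  which measurability of the entries is enough. Restriction to the index square is continuous and
  takes \<open>e\<close> to the distance matrix.\<close>

lemma measurable_distance_matrix:
  assumes d: "(\<lambda>(x, y). d x y) \<in> borel_measurable (M \<Otimes>\<^sub>M M)"
  shows "distance_matrix r d \<in> measurable (Pi\<^sub>M {1..r} (\<lambda>_. M)) (borel_of (matrix_topology r))"
proof -
  define e where "e \<xi> = (\<lambda>(i, j). if i \<in> {1..r} \<and> j \<in> {1..r} \<and> i \<noteq> j then d (\<xi> i) (\<xi> j) else 0)"
    for \<xi> :: "nat \<Rightarrow> 'a"
  have eq: "distance_matrix r d \<xi> = restrict (e \<xi>) ({1..r} \<times> {1..r})" for \<xi>
    by (auto simp: distance_matrix_def e_def restrict_def fun_eq_iff)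
  have e: "e \<in> borel_measurable (Pi\<^sub>M {1..r} (\<lambda>_. M))"
  proof (rule measurable_coordinatewise_then_product)
    fix ij :: "nat \<times> nat"
    obtain i j where ij: "ij = (i, j)" by fastforce
    show "(\<lambda>\<xi>. e \<xi> ij) \<in> borel_measurable (Pi\<^sub>M {1..r} (\<lambda>_. M))"
    proof (cases "i \<in> {1..r} \<and> j \<in> {1..r} \<and> i \<noteq> j")
      case True
      then have "(\<lambda>\<xi>. (\<xi> i, \<xi> j)) \<in> measurable (Pi\<^sub>M {1..r} (\<lambda>_. M)) (M \<Otimes>\<^sub>M M)"
        by (intro measurable_Pair measurable_component_singleton) auto
      from measurable_compose[OF this d] show ?thesis using True by (simp add: ij e_def)
    qed (auto simp: ij e_def)
  qed
  show ?thesis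
  proof (rule measurable_borel_ofI)
    show "distance_matrix r d \<xi> \<in> topspace (matrix_topology r)" for \<xi> :: "nat \<Rightarrow> 'a"
      unfolding topspace_matrix eq by simp
    fix U assume U: "openin (matrix_topology r) U"
    have "open {f. restrict f ({1..r} \<times> {1..r}) \<in> U}"
      using U continuous_map_restrict_matrix[of r] by (auto simp: continuous_map_def)
    then have "e -` {f. restrict f ({1..r} \<times> {1..r}) \<in> U} \<inter> space (Pi\<^sub>M {1..r} (\<lambda>_. M)) \<in> sets (Pi\<^sub>M {1..r} (\<lambda>_. M))"
      by (intro measurable_sets[OF e]) auto
    then show "distance_matrix r d -` U \<inter> space (Pi\<^sub>M {1..r} (\<lambda>_. M)) \<in> sets (Pi\<^sub>M {1..r} (\<lambda>_. M))"
      by (simp add: eq vimage_def)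
  qed
qed

lemma tau_borel_prob:
  assumes "prob_space M" "(\<lambda>(x, y). d x y) \<in> borel_measurable (M \<Otimes>\<^sub>M M)"
  shows "tau r d M \<in> borel_prob_measures (matrix_topology r)"
proof -
  interpret M: prob_space M by fact
  have "prob_space (Pi\<^sub>M {1..r} (\<lambda>_. M))" by (rule prob_space_PiM) (rule assms)
  then show ?thesis
    unfolding tau_def borel_prob_measures_def
    using prob_space.prob_space_distr[OF _ measurable_distance_matrix[OF assms(2)]] by simp
qed

lemma integral_tau:
  assumes "(\<lambda>(x, y). d x y) \<in> borel_measurable (M \<Otimes>\<^sub>M M)" "continuous_map (matrix_topology r) euclideanreal f"
  shows "(\<integral>x. f x \<partial>tau r d M) = (\<integral>\<xi>. f (distance_matrix r d \<xi>) \<partial>Pi\<^sub>M {1..r} (\<lambda>_. M))"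
  unfolding tau_def
  by (rule integral_distr[OF measurable_distance_matrix[OF assms(1)]])
    (rule measurable_continuous_map_borel_of[OF assms(2) refl])

lemma distance_matrix_compose:
  "distance_matrix r d (compose {1..r} g \<xi>) = distance_matrix r (\<lambda>x y. d (g x) (g y)) \<xi>"
  by (auto simp: distance_matrix_def compose_def restrict_def fun_eq_iff)

lemma distance_matrix_cong:
  assumes "\<And>i j. i \<in> {1..r} \<Longrightarrow> j \<in> {1..r} \<Longrightarrow> i \<noteq> j \<Longrightarrow> d (\<xi> i) (\<xi> j) = d' (\<xi>' i) (\<xi>' j)"
  shows "distance_matrix r d \<xi> = distance_matrix r d' \<xi>'"
  using assms by (auto simp: distance_matrix_def restrict_def fun_eq_iff)

text \<open>Independent samples from an image measure are images of independent samples, so the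
  random points can be moved to a more convenient probability space.\<close>

lemma tau_distr:
  assumes P: "prob_space P" and g: "g \<in> measurable P N"
    and d: "(\<lambda>(x, y). d x y) \<in> borel_measurable (N \<Otimes>\<^sub>M N)"
  shows "tau r d (distr P N g) = tau r (\<lambda>x y. d (g x) (g y)) P"
proof -
  have "prob_space (distr P N g)" by (rule prob_space.prob_space_distr[OF P g])
  then have eq: "Pi\<^sub>M {1..r} (\<lambda>_. distr P N g) = distr (Pi\<^sub>M {1..r} (\<lambda>_. P)) (Pi\<^sub>M {1..r} (\<lambda>_. distr P N g)) (compose {1..r} g)"
    using distr_PiM_finite_prob_space'[of "{1..r}" "\<lambda>_. P" "\<lambda>_. distr P N g" g] P g
    by (simp add: measurable_distr_eq2 distr_distr distr_id2 cong: distr_cong)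
  have d': "(\<lambda>(x, y). d x y) \<in> borel_measurable (distr P N g \<Otimes>\<^sub>M distr P N g)"
    using d by (simp cong: measurable_cong_sets)
  have comp: "compose {1..r} g \<in> measurable (Pi\<^sub>M {1..r} (\<lambda>_. P)) (Pi\<^sub>M {1..r} (\<lambda>_. distr P N g))"
    unfolding compose_def using g by (intro measurable_restrict) (auto intro: measurable_compose[OF measurable_component_singleton])
  show ?thesis
    unfolding tau_def
    by (subst eq, subst distr_distr[OF measurable_distance_matrix[OF d'] comp])
      (simp only: o_def distance_matrix_compose)
qed

text \<open>Two distinct coordinates of a product have the product law. The pair is compared with
  the product over \<open>bool\<close>, embedded into the index set by \<open>t\<close>.\<close>

lemma AE_PiM_pair:
  assumes P: "prob_space P" and ij: "i \<in> I" "j \<in> I" "i \<noteq> j"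
    and ae: "AE z in P \<Otimes>\<^sub>M P. R (fst z) (snd z)"
  shows "AE \<xi> in Pi\<^sub>M I (\<lambda>_. P). R (\<xi> i) (\<xi> j)"
proof -
  interpret P: prob_space P by fact
  have m1: "(\<lambda>x. (x True, x False)) \<in> measurable (Pi\<^sub>M UNIV (case_bool P P)) (P \<Otimes>\<^sub>M P)"
    using measurable_component_singleton[of True UNIV "case_bool P P"]
      measurable_component_singleton[of False UNIV "case_bool P P"]
    by (intro measurable_Pair) auto
  have m2: "AE z in distr (Pi\<^sub>M UNIV (case_bool P P)) (P \<Otimes>\<^sub>M P) (\<lambda>x. (x True, x False)). R (fst z) (snd z)"
    unfolding pair_measure_eq_distr_PiM[OF P.sigma_finite_measure_axioms P.sigma_finite_measure_axioms, symmetric]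
    by (rule ae)
  have "AE x in Pi\<^sub>M UNIV (case_bool P P). R (x True) (x False)"
    using AE_distrD[OF m1 m2] by simp
  also have "case_bool P P = (\<lambda>_. P)" by (auto simp: fun_eq_iff split: bool.split)
  finally have 1: "AE x in Pi\<^sub>M (UNIV :: bool set) (\<lambda>_. P). R (x True) (x False)" .
  define t where "t = case_bool i j"
  have t: "inj_on t UNIV" "t \<in> UNIV \<rightarrow> I"
    using ij by (auto simp: t_def inj_on_def split: bool.splits)
  have m3: "distr (Pi\<^sub>M I (\<lambda>_. P)) (Pi\<^sub>M UNIV (\<lambda>_. P)) (\<lambda>\<omega>. \<lambda>n\<in>UNIV. \<omega> (t n)) = Pi\<^sub>M (UNIV :: bool set) (\<lambda>_. P)"
    using distr_PiM_reindex[of I "\<lambda>_. P" t UNIV] P t by simp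
  have m4: "(\<lambda>\<omega>. \<lambda>n\<in>UNIV. \<omega> (t n)) \<in> measurable (Pi\<^sub>M I (\<lambda>_. P)) (Pi\<^sub>M (UNIV :: bool set) (\<lambda>_. P))"
    using t by (intro measurable_restrict measurable_component_singleton) auto
  have "AE x in distr (Pi\<^sub>M I (\<lambda>_. P)) (Pi\<^sub>M UNIV (\<lambda>_. P)) (\<lambda>\<omega>. \<lambda>n\<in>UNIV. \<omega> (t n)). R (x True) (x False)"
    unfolding m3 by (rule 1)
  from AE_distrD[OF m4 this] have "AE \<omega> in Pi\<^sub>M I (\<lambda>_. P). R ((\<lambda>n\<in>UNIV. \<omega> (t n)) True) ((\<lambda>n\<in>UNIV. \<omega> (t n)) False)" .
  then show ?thesis by (simp add: t_def)
qed

lemma AE_PiM_all_pairs: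
  assumes P: "prob_space P" and ae: "AE z in P \<Otimes>\<^sub>M P. R (fst z) (snd z)"
  shows "AE \<xi> in Pi\<^sub>M {1..r::nat} (\<lambda>_. P). \<forall>i\<in>{1..r}. \<forall>j\<in>{1..r}. i \<noteq> j \<longrightarrow> R (\<xi> i) (\<xi> j)"
proof (intro AE_ball_countable[THEN iffD2] ballI)
  fix i j assume "i \<in> {1..r}" "j \<in> {1..r}"
  then show "AE \<xi> in Pi\<^sub>M {1..r} (\<lambda>_. P). i \<noteq> j \<longrightarrow> R (\<xi> i) (\<xi> j)"
    using AE_PiM_pair[OF P _ _ _ ae, of i "{1..r}" j] by (cases "i = j") auto
qed auto

text \<open>The diagonal entries are set to 0, so only distances of independent points enter and
  almost everywhere equality under the product measure is enough.\<close>

lemma tau_cong_AE: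
  assumes P: "prob_space P"
    and d: "(\<lambda>(x, y). d x y) \<in> borel_measurable (P \<Otimes>\<^sub>M P)" "(\<lambda>(x, y). d' x y) \<in> borel_measurable (P \<Otimes>\<^sub>M P)"
    and ae: "AE z in P \<Otimes>\<^sub>M P. d (fst z) (snd z) = d' (fst z) (snd z)"
  shows "tau r d P = tau r d' P"
  unfolding tau_def
proof (rule distr_cong_AE[OF refl refl _ measurable_distance_matrix[OF d(1)] measurable_distance_matrix[OF d(2)]])
  show "AE \<xi> in Pi\<^sub>M {1..r} (\<lambda>_. P). distance_matrix r d \<xi> = distance_matrix r d' \<xi>"
    using AE_PiM_all_pairs[OF P ae, of r] by eventually_elim (auto intro!: distance_matrix_cong)
qed

lemma tendsto_distance_matrix:
  assumes f: "continuous_map (matrix_topology r) euclideanreal f"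
    and lim: "\<And>i j. i \<in> {1..r} \<Longrightarrow> j \<in> {1..r} \<Longrightarrow> i \<noteq> j \<Longrightarrow> (\<lambda>n. d n (\<xi> n i) (\<xi> n j)) \<longlonglongrightarrow> d' (\<xi>' i) (\<xi>' j)"
  shows "(\<lambda>n. f (distance_matrix r (d n) (\<xi> n))) \<longlonglongrightarrow> f (distance_matrix r d' \<xi>')"
proof -
  have "limitin (matrix_topology r) (\<lambda>n. distance_matrix r (d n) (\<xi> n)) (distance_matrix r d' \<xi>') sequentially"
    unfolding matrix_topology_def limitin_componentwise
    using lim by (auto simp: distance_matrix_def)
  from continuous_map_limit[OF f this] show ?thesis by (simp add: o_def)
qed

section \<open>Limits of coded trees\<close>

lemma prob_unif_interval: "0 \<le> s \<Longrightarrow> s \<le> t \<Longrightarrow> t \<le> 1 \<Longrightarrow> measure unif {s<..<t} = t - s"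
proof -
  assume *: "0 \<le> s" "s \<le> t" "t \<le> 1"
  then have "{0<..<1} \<inter> {s<..<t} = {s<..<t}" by auto
  then have "emeasure unif {s<..<t} = ennreal (t - s)" using * by (subst emeasure_unif) auto
  then show ?thesis using * by (simp add: measure_def)
qed

lemma AE_unif:
  assumes "countable C"
  shows "AE s in unif. 0 < s \<and> s < 1 \<and> s \<notin> C"
proof -
  have "AE s in lborel. s \<notin> C"
    using assms by (intro AE_not_in countable_imp_null_set_lborel)
  then have "AE s in lborel. s \<in> {0<..<1} \<longrightarrow> 0 < s \<and> s < 1 \<and> s \<notin> C"
    by eventually_elim auto
  then show ?thesis by (intro AE_uniform_measureI) auto
qed

text \<open>Characteristic functions converge by dominated convergence, and Levy's uniqueness
  theorem identifies the limit law. It is applied to uniform positions.\<close>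

lemma distr_eq_if_pointwise_limit:
  fixes X :: "nat \<Rightarrow> 'a \<Rightarrow> real" and Y :: "'a \<Rightarrow> real"
  assumes "prob_space \<Omega>" and [measurable]: "\<And>n. X n \<in> borel_measurable \<Omega>" "Y \<in> borel_measurable \<Omega>"
    and eq: "\<And>n. distr \<Omega> borel (X n) = \<mu>" and lim: "\<And>w. w \<in> space \<Omega> \<Longrightarrow> (\<lambda>n. X n w) \<longlonglongrightarrow> Y w"
  shows "distr \<Omega> borel Y = \<mu>"
proof (rule Levy_uniqueness)
  interpret prob_space \<Omega> by fact
  show "real_distribution (distr \<Omega> borel Y)" by (rule real_distribution_distr) simp
  show "real_distribution \<mu>" unfolding eq[of 0, symmetric] by (rule real_distribution_distr) simp
  show "char (distr \<Omega> borel Y) = char \<mu>"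
  proof
    fix t
    have "(\<lambda>n. CLINT w|\<Omega>. iexp (t * X n w)) \<longlonglongrightarrow> (CLINT w|\<Omega>. iexp (t * Y w))"
    proof (rule integral_dominated_convergence[where w = "\<lambda>_. 1"])
      show "AE w in \<Omega>. (\<lambda>n. iexp (t * X n w)) \<longlonglongrightarrow> iexp (t * Y w)"
        by (intro AE_I2 tendsto_intros lim)
    qed auto
    moreover have "(CLINT w|\<Omega>. iexp (t * X n w)) = char \<mu> t" for n
      unfolding eq[of n, symmetric] char_def by (subst integral_distr) auto
    ultimately have "char \<mu> t = (CLINT w|\<Omega>. iexp (t * Y w))"
      by (simp add: LIMSEQ_unique[OF tendsto_const])
    then show "char (distr \<Omega> borel Y) t = char \<mu> t"
      unfolding char_def by (subst integral_distr) auto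
  qed
qed

text \<open>Position and height are coded together by one real number \<open>W\<close>. Its laws
  live on \<open>[0, 1]\<close>, hence subconverge weakly, and Skorohod's theorem provides copies
  \<open>Y n\<close> converging pointwise on one space; \<open>g\<close> is the limit of the coded
  kernels along a further subsequence. Limit positions almost surely avoid the exceptional set of
  \<open>g\<close> and differ from each other, so the sampled distances converge and dominated
  convergence gives the integrals. \<open>D\<close> stands for any measurable version of the limit
  distance.\<close>

lemma coding_limit:
  fixes M :: "nat \<Rightarrow> 'a measure" and f :: "nat \<Rightarrow> 'a \<Rightarrow> 'q" and K :: "nat \<Rightarrow> 'q \<Rightarrow> 'q \<Rightarrow> real"
  assumes prob: "\<And>n. prob_space (M n)" and Q: "\<And>n. finite (Q n)"
    and f: "\<And>n. f n \<in> measurable (M n) (count_space (Q n))"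
    and sym: "\<And>n x y. x \<in> Q n \<Longrightarrow> y \<in> Q n \<Longrightarrow> K n x y = K n y x"
    and ultra: "\<And>n x y z. x \<in> Q n \<Longrightarrow> y \<in> Q n \<Longrightarrow> z \<in> Q n \<Longrightarrow> min (K n x y) (K n y z) \<le> K n x z"
    and nonneg: "\<And>n x y. x \<in> Q n \<Longrightarrow> y \<in> Q n \<Longrightarrow> 0 \<le> K n x y"
    and h: "\<And>n. h n \<in> borel_measurable (M n)"
    and hK: "\<And>n w. w \<in> space (M n) \<Longrightarrow> K n (f n w) (f n w) \<le> h n w"
    and tight: "\<And>\<epsilon>. 0 < \<epsilon> \<Longrightarrow> \<exists>B. \<forall>n. measure (M n) {w \<in> space (M n). B < h n w} < \<epsilon>"
  obtains k :: "nat \<Rightarrow> nat" and \<Omega> :: "real measure" and S H :: "real \<Rightarrow> real" and g where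
    "strict_mono k" "prob_space \<Omega>" "S \<in> borel_measurable \<Omega>" "H \<in> borel_measurable \<Omega>"
    "distr \<Omega> borel S = unif"
    "\<And>s t u. 0 < s \<Longrightarrow> s < t \<Longrightarrow> t < u \<Longrightarrow> u < 1 \<Longrightarrow> g s u = min (g s t) (g t u)"
    "\<And>s t. 0 < s \<Longrightarrow> s < t \<Longrightarrow> t < 1 \<Longrightarrow> 0 \<le> g s t"
    "AE w in \<Omega>. \<forall>t. 0 < t \<longrightarrow> t < 1 \<longrightarrow> (S w < t \<longrightarrow> g (S w) t \<le> H w) \<and> (t < S w \<longrightarrow> g t (S w) \<le> H w)"
    "\<And>r F D. continuous_map (matrix_topology r) euclideanreal F \<Longrightarrow> bounded (F ` topspace (matrix_topology r)) \<Longrightarrow>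
      (\<lambda>(x, y). D x y) \<in> borel_measurable (\<Omega> \<Otimes>\<^sub>M \<Omega>) \<Longrightarrow>
      (AE z in \<Omega> \<Otimes>\<^sub>M \<Omega>. D (fst z) (snd z) = H (fst z) + H (snd z) -
        2 * g (min (S (fst z)) (S (snd z))) (max (S (fst z)) (S (snd z)))) \<Longrightarrow>
      (\<lambda>n. \<integral>x. F x \<partial>tau r (\<lambda>x y. h (k n) x + h (k n) y - 2 * K (k n) (f (k n) x) (f (k n) y)) (M (k n)))
        \<longlonglongrightarrow> (\<integral>x. F x \<partial>tau r D \<Omega>)"
proof -
  interpret M: prob_space "M n" for n by (rule prob)
  interpret U: prob_space unif by (rule prob_space_unif)
  define P where "P n = M n \<Otimes>\<^sub>M unif" for n
  interpret P: pair_prob_space "M n" unif for n ..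
  define R where "R n S e \<longleftrightarrow> S \<in> borel_measurable (P n) \<and> distr (P n) borel S = unif \<and> e \<in> measurable borel (count_space (Q n)) \<and>
    (\<forall>s t u. 0 < s \<longrightarrow> s \<le> t \<longrightarrow> t \<le> u \<longrightarrow> u < 1 \<longrightarrow> K n (e s) (e u) = min (K n (e s) (e t)) (K n (e t) (e u))) \<and>
    (AE z in P n. 0 < S z \<and> S z < 1 \<and> e (S z) = f n (fst z))" for n S e
  have "\<exists>S e. R n S e" for n
    unfolding P_def R_def
    by (rule ultrametric_coding[OF prob Q f, of n "K n"]) (blast intro: sym ultra)+
  then obtain S0 e where R: "\<And>n. R n (S0 n) (e n)" by metis
  then have S0: "S0 n \<in> borel_measurable (P n)" "distr (P n) borel (S0 n) = unif"
    and e: "e n \<in> measurable borel (count_space (Q n))"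
    and ae0: "AE z in P n. 0 < S0 n z \<and> S0 n z < 1 \<and> e n (S0 n z) = f n (fst z)" for n
    unfolding R_def by blast+
  have mid0: "K n (e n s) (e n u) = min (K n (e n s) (e n t)) (K n (e n t) (e n u))"
    if "0 < s" "s \<le> t" "t \<le> u" "u < 1" for n s t u
    using R[of n] that unfolding R_def by blast
  have eQ: "e n s \<in> Q n" for n s using measurable_space[OF e, of s n] by simp
  have fQ: "f n w \<in> Q n" if "w \<in> space (M n)" for n w using measurable_space[OF f that] by simp
  have h0: "0 \<le> h n w" if "w \<in> space (M n)" for n w
    using nonneg[OF fQ[OF that] fQ[OF that]] hK[OF that] by simp
  define g0 where "g0 n s t = K n (e n s) (e n t)" for n s t
  have hfst[measurable]: "(\<lambda>z. h n (fst z)) \<in> borel_measurable (P n)" for n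
    unfolding P_def using measurable_compose[OF measurable_fst h] .
  have prob_h: "measure (P n) {z \<in> space (P n). B < h n (fst z)} = measure (M n) {w \<in> space (M n). B < h n w}" for n B
  proof -
    have "measure (M n) {w \<in> space (M n). B < h n w} = measure (distr (P n) (M n) fst) {w \<in> space (M n). B < h n w}"
      unfolding P_def by (simp only: U.distr_pair_fst)
    also have "\<dots> = measure (P n) (fst -` {w \<in> space (M n). B < h n w} \<inter> space (P n))"
      by (rule measure_distr) (use h in \<open>auto simp: P_def\<close>)
    also have "fst -` {w \<in> space (M n). B < h n w} \<inter> space (P n) = {z \<in> space (P n). B < h n (fst z)}"
      by (auto simp: P_def space_pair_measure)
    finally show ?thesis by simp
  qed
  \<comment> \<open>Positions in \<open>(s, t)\<close> have probability \<open>t - s\<close>, and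
    the height at each of them is at least \<open>g0 n s t\<close>. A level exceeded by the height
    with probability less than \<open>t - s\<close> must therefore bound \<open>g0 n s t\<close>,
    uniformly in \<open>n\<close>.\<close>
  have bdd: "\<exists>B. \<forall>n. g0 n s t \<le> B" if st: "0 < s" "s < t" "t < 1" for s t
  proof -
    obtain B where B: "\<And>n. measure (M n) {w \<in> space (M n). B < h n w} < t - s"
      using tight[of "t - s"] st by auto
    have "g0 n s t \<le> B" for n
    proof (rule ccontr)
      assume not: "\<not> g0 n s t \<le> B"
      have "t - s = measure (distr (P n) borel (S0 n)) {s<..<t}"
        unfolding S0(2) using prob_unif_interval[of s t] st by simp
      also have "\<dots> = measure (P n) (S0 n -` {s<..<t} \<inter> space (P n))"
        by (rule measure_distr[OF S0(1)]) simp
      also have "\<dots> \<le> measure (P n) {z \<in> space (P n). B < h n (fst z)}"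
      proof (rule P.P.finite_measure_mono_AE[folded P_def])
        show "AE z in P n. z \<in> S0 n -` {s<..<t} \<inter> space (P n) \<longrightarrow> z \<in> {z \<in> space (P n). B < h n (fst z)}"
          using ae0[of n] AE_space
        proof eventually_elim
          case (elim z)
          show ?case
          proof
            assume "z \<in> S0 n -` {s<..<t} \<inter> space (P n)"
            then have z: "s < S0 n z" "S0 n z < t" by auto
            have "g0 n s t \<le> g0 n (S0 n z) (S0 n z)"
              using mid0[of s "S0 n z" t n] mid0[of "S0 n z" "S0 n z" t n] z st by (simp add: g0_def)
            also have "\<dots> \<le> h n (fst z)"
              using elim hK[of "fst z" n] by (simp add: g0_def P_def space_pair_measure mem_Times_iff)
            finally show "z \<in> {z \<in> space (P n). B < h n (fst z)}" using not elim by auto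
          qed
        qed
      qed measurable
      also have "\<dots> < t - s" using B[of n] prob_h by simp
      finally show False by simp
    qed
    then show ?thesis by blast
  qed
  \<comment> \<open>The map from \<open>a\<close> to \<open>a / (1 + a)\<close> compresses heights
    into \<open>[0, 1)\<close>, as the section requires; \<open>hh\<close> undoes it.\<close>
  define W where "W n z = schoenberg_section (S0 n z, h n (fst z) / (1 + h n (fst z)))" for n z
  have W[measurable]: "W n \<in> borel_measurable (P n)" for n
    unfolding W_def using S0(1)[of n]
    by (intro measurable_compose[OF _ measurable_schoenberg_section] measurable_Pair) simp_all
  define hh where "hh w = schoenberg 1 w / (1 - schoenberg 1 w)" for w
  have [measurable]: "hh \<in> borel_measurable borel" unfolding hh_def by measurable
  have aeW: "AE z in P n. schoenberg 0 (W n z) = S0 n z \<and> schoenberg 1 (W n z) = h n (fst z) / (1 + h n (fst z)) \<and>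
      hh (W n z) = h n (fst z) \<and> e n (schoenberg 0 (W n z)) = f n (fst z) \<and> 0 < S0 n z \<and> S0 n z < 1 \<and> 0 \<le> h n (fst z)
      \<and> fst z \<in> space (M n)" for n
    using ae0[of n] AE_space
  proof eventually_elim
    case (elim z)
    have w: "fst z \<in> space (M n)" using elim by (auto simp: P_def space_pair_measure)
    define a where "a = h n (fst z)"
    have a: "0 \<le> a" using h0[OF w] by (simp add: a_def)
    then have "0 \<le> a / (1 + a)" "a / (1 + a) < 1" by auto
    then have *: "schoenberg 0 (W n z) = S0 n z" "schoenberg 1 (W n z) = a / (1 + a)"
      using schoenberg_section[of "S0 n z" "a / (1 + a)"] elim by (auto simp: W_def a_def)
    have "hh (W n z) = a / (1 + a) / (1 - a / (1 + a))" unfolding hh_def *(2) ..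
    also have "\<dots> = a" using a by (simp add: field_simps)
    finally show ?case using * w a elim by (simp add: a_def)
  qed
  define lam where "lam n = distr (P n) borel (W n)" for n
  have lam: "real_distribution (lam n)" for n
    unfolding lam_def P_def by (rule P.P.real_distribution_distr) (use W in \<open>simp add: P_def\<close>)
  have "tight lam"
    unfolding tight_def
  proof (intro conjI allI impI lam)
    fix \<epsilon> :: real assume "0 < \<epsilon>"
    \<comment> \<open>Tightness is phrased with left-open intervals, and \<open>W\<close> may take
      the value 0, so the interval starts at -1.\<close>
    have "measure (lam n) {-1<..1} = 1" for n
    proof -
      interpret real_distribution "lam n" by (rule lam)
      have "W n z \<in> {-1<..1}" for z
        using schoenberg_section_bounds[of "(S0 n z, h n (fst z) / (1 + h n (fst z)))"]
        unfolding W_def by auto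
      then have "AE z in P n. W n z \<in> {-1<..1}" by simp
      then have "AE w in lam n. w \<in> {-1<..1}"
        unfolding lam_def by (subst AE_distr_iff) auto
      then show ?thesis by (subst prob_eq_1) auto
    qed
    then show "\<exists>a b. a < b \<and> (\<forall>n. 1 - \<epsilon> < measure (lam n) {a<..b})"
      using \<open>0 < \<epsilon>\<close> by (intro exI[of _ "-1"] exI[of _ 1]) simp
  qed
  then obtain k2 L where k2: "strict_mono (k2 :: nat \<Rightarrow> nat)" and L: "real_distribution L" "weak_conv_m (lam \<circ> id \<circ> k2) L"
    using tight_imp_convergent_subsubsequence[OF _ strict_mono_id] by blast
  have "real_distribution ((lam \<circ> id \<circ> k2) n)" for n using lam by simp
  from Skorohod[OF this L] obtain \<Omega> :: "real measure" and Y0 Y' where "prob_space \<Omega>"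
    and Y0: "\<And>n. Y0 n \<in> borel_measurable \<Omega>" and dY0: "\<And>n. distr \<Omega> borel (Y0 n) = lam (k2 n)"
    and Y'[measurable]: "Y' \<in> borel_measurable \<Omega>"
    and lim0: "\<And>w. w \<in> space \<Omega> \<Longrightarrow> (\<lambda>n. Y0 n w) \<longlonglongrightarrow> Y' w"
    by force
  interpret \<Omega>: prob_space \<Omega> by fact
  obtain k1 g C where k1: "strict_mono (k1 :: nat \<Rightarrow> nat)" and C: "countable C"
    and mid: "\<And>s t u. 0 < s \<Longrightarrow> s < t \<Longrightarrow> t < u \<Longrightarrow> u < 1 \<Longrightarrow> g s u = min (g s t) (g t u)"
    and g0nn: "\<And>s t. 0 < s \<Longrightarrow> s < t \<Longrightarrow> t < 1 \<Longrightarrow> 0 \<le> g s t"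
    and conv: "\<And>s t \<sigma> \<tau>. 0 < s \<Longrightarrow> s < t \<Longrightarrow> t < 1 \<Longrightarrow> s \<notin> C \<Longrightarrow> t \<notin> C \<Longrightarrow> \<sigma> \<longlonglongrightarrow> s \<Longrightarrow> \<tau> \<longlonglongrightarrow> t \<Longrightarrow>
      (\<lambda>n. g0 (k2 (k1 n)) (\<sigma> n) (\<tau> n)) \<longlonglongrightarrow> g s t"
    and low: "\<And>s t \<sigma> \<tau> c. 0 < s \<Longrightarrow> s < t \<Longrightarrow> t < 1 \<Longrightarrow> \<sigma> \<longlonglongrightarrow> s \<Longrightarrow> \<tau> \<longlonglongrightarrow> t \<Longrightarrow> c < g s t \<Longrightarrow>
      \<forall>\<^sub>F n in sequentially. c < g0 (k2 (k1 n)) (\<sigma> n) (\<tau> n)"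
  proof (rule interval_kernel_limit[of "\<lambda>n. g0 (k2 n)"])
    show "g0 (k2 n) s u = min (g0 (k2 n) s t) (g0 (k2 n) t u)" if "0 < s" "s \<le> t" "t \<le> u" "u < 1" for n s t u
      using mid0[OF that] by (simp add: g0_def)
    show "0 \<le> g0 (k2 n) s t" for n s t unfolding g0_def by (rule nonneg[OF eQ eQ])
    show "\<exists>B. \<forall>n. g0 (k2 n) s t \<le> B" if "0 < s" "s < t" "t < 1" for s t using bdd[OF that] by blast
  qed blast
  define k where "k = k2 \<circ> k1"
  define Y where "Y n = Y0 (k1 n)" for n
  have k: "strict_mono k" unfolding k_def using k2 k1 by (rule strict_mono_o)
  have Y[measurable]: "Y n \<in> borel_measurable \<Omega>" and dY: "distr \<Omega> borel (Y n) = lam (k n)" for n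
    using Y0 dY0 by (simp_all add: Y_def k_def)
  have lim: "(\<lambda>n. Y n w) \<longlonglongrightarrow> Y' w" if "w \<in> space \<Omega>" for w
    unfolding Y_def using LIMSEQ_subseq_LIMSEQ[OF lim0[OF that] k1] by (simp add: o_def)
  define S where "S w = schoenberg 0 (Y' w)" for w
  define H where "H w = hh (Y' w)" for w
  define Sn where "Sn n w = schoenberg 0 (Y n w)" for n w
  have [measurable]: "S \<in> borel_measurable \<Omega>" "H \<in> borel_measurable \<Omega>" "Sn n \<in> borel_measurable \<Omega>" for n
    unfolding S_def H_def Sn_def by measurable
  have lim_sch: "(\<lambda>n. schoenberg j (Y n w)) \<longlonglongrightarrow> schoenberg j (Y' w)" if "w \<in> space \<Omega>" for j w
    using continuous_on_tendsto_compose[OF continuous_schoenberg lim[OF that]] by simp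
  \<comment> \<open>Almost sure statements about the coded variable depend on its law only, so they
    pass to the Skorohod copies.\<close>
  have transfer: "AE w in \<Omega>. p (Y n w)"
    if p: "{w. p w} \<in> sets borel" and ae: "AE z in P (k n). p (W (k n) z)" for p n
  proof -
    have "AE w in lam (k n). p w"
      unfolding lam_def using p ae by (subst AE_distr_iff[OF W]) auto
    then have "AE w in distr \<Omega> borel (Y n). p w" unfolding dY .
    then show ?thesis by (rule AE_distrD[OF Y])
  qed
  have dSn: "distr \<Omega> borel (Sn n) = unif" for n
  proof -
    have "distr \<Omega> borel (Sn n) = distr (distr \<Omega> borel (Y n)) borel (schoenberg 0)"
      by (subst distr_distr) (auto simp: Sn_def[abs_def] o_def)
    also have "\<dots> = distr (P (k n)) borel (\<lambda>z. schoenberg 0 (W (k n) z))"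
      unfolding dY lam_def by (subst distr_distr) (auto simp: o_def)
    also have "\<dots> = distr (P (k n)) borel (S0 (k n))"
    proof (rule distr_cong_AE)
      show "AE z in P (k n). schoenberg 0 (W (k n) z) = S0 (k n) z" using aeW[of "k n"] by eventually_elim auto
    qed (use S0(1) in auto)
    finally show ?thesis by (simp only: S0(2))
  qed
  have dS: "distr \<Omega> borel S = unif"
  proof (rule distr_eq_if_pointwise_limit[OF \<open>prob_space \<Omega>\<close> _ _ dSn])
    show "(\<lambda>n. Sn n w) \<longlonglongrightarrow> S w" if "w \<in> space \<Omega>" for w
      unfolding Sn_def S_def by (rule lim_sch[OF that])
  qed auto
  have aeS: "AE w in \<Omega>. 0 < S w \<and> S w < 1 \<and> S w \<notin> B" if "countable B" for B
  proof -
    have "AE s in distr \<Omega> borel S. 0 < s \<and> s < 1 \<and> s \<notin> B" unfolding dS by (rule AE_unif[OF that])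
    from AE_distrD[OF _ this] show ?thesis by simp
  qed
  have Ke: "(\<lambda>w. K n (e n (schoenberg 0 w)) (e n (schoenberg 0 w))) \<in> borel_measurable borel" for n
    using measurable_compose[OF measurable_compose[OF measurable_schoenberg e], of "\<lambda>x. K n x x" n borel 0] by simp
  have ae_n: "AE w in \<Omega>. \<forall>n. 0 < Sn n w \<and> Sn n w < 1 \<and> g0 (k n) (Sn n w) (Sn n w) \<le> hh (Y n w)"
    unfolding AE_all_countable
  proof
    fix n
    have "AE w in \<Omega>. (\<lambda>w. 0 < schoenberg 0 w \<and> schoenberg 0 w < 1 \<and>
        K (k n) (e (k n) (schoenberg 0 w)) (e (k n) (schoenberg 0 w)) \<le> hh w) (Y n w)"
    proof (rule transfer)
      show "{w. 0 < schoenberg 0 w \<and> schoenberg 0 w < 1 \<and>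
          K (k n) (e (k n) (schoenberg 0 w)) (e (k n) (schoenberg 0 w)) \<le> hh w} \<in> sets borel"
        using Ke[of "k n"] by measurable
      show "AE z in P (k n). 0 < schoenberg 0 (W (k n) z) \<and> schoenberg 0 (W (k n) z) < 1 \<and>
          K (k n) (e (k n) (schoenberg 0 (W (k n) z))) (e (k n) (schoenberg 0 (W (k n) z))) \<le> hh (W (k n) z)"
        using aeW[of "k n"] by eventually_elim (auto simp: hK)
    qed
    then show "AE w in \<Omega>. 0 < Sn n w \<and> Sn n w < 1 \<and> g0 (k n) (Sn n w) (Sn n w) \<le> hh (Y n w)"
      by (simp add: Sn_def g0_def)
  qed
  \<comment> \<open>A compressed height equal to 1 would be an infinite height. The continuous
    cutoff \<open>\<phi>\<close>, which is 0 up to \<open>b\<close> and 1 from 1 on, carries the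
    uniform tail bound over to the limit.\<close>
  have aeA: "AE w in \<Omega>. schoenberg 1 (Y' w) < 1"
  proof -
    have "measure \<Omega> {w \<in> space \<Omega>. 1 \<le> schoenberg 1 (Y' w)} \<le> \<epsilon>" if \<epsilon>: "0 < \<epsilon>" for \<epsilon>
    proof -
      obtain B0 where B0: "\<And>n. measure (M n) {w \<in> space (M n). B0 < h n w} < \<epsilon>" using tight[OF \<epsilon>] by blast
      define B where "B = max B0 0"
      define b where "b = B / (1 + B)"
      have b: "0 \<le> b" "b < 1" by (auto simp: b_def B_def)
      define \<phi> where "\<phi> a = max 0 (min 1 ((a - b) / (1 - b)))" for a :: real
      have [measurable]: "\<phi> \<in> borel_measurable borel" unfolding \<phi>_def by measurable
      have \<phi>: "0 \<le> \<phi> a" "\<phi> a \<le> 1" for a by (auto simp: \<phi>_def)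
      have int: "integrable \<Omega> (\<lambda>w. \<phi> (schoenberg 1 (X w)))" if [measurable]: "X \<in> borel_measurable \<Omega>" for X
        by (rule \<Omega>.integrable_const_bound[where B = 1]) (use \<phi> in auto)
      have "(\<lambda>n. \<integral>w. \<phi> (schoenberg 1 (Y n w)) \<partial>\<Omega>) \<longlonglongrightarrow> (\<integral>w. \<phi> (schoenberg 1 (Y' w)) \<partial>\<Omega>)"
      proof (rule integral_dominated_convergence[where w = "\<lambda>_. 1"])
        show "AE w in \<Omega>. (\<lambda>n. \<phi> (schoenberg 1 (Y n w))) \<longlonglongrightarrow> \<phi> (schoenberg 1 (Y' w))"
          unfolding \<phi>_def using b by (intro AE_I2 tendsto_intros lim_sch) auto
      qed (use \<phi> in auto)
      moreover have "(\<integral>w. \<phi> (schoenberg 1 (Y n w)) \<partial>\<Omega>) \<le> \<epsilon>" for n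
      proof -
        have "(\<integral>w. \<phi> (schoenberg 1 (Y n w)) \<partial>\<Omega>) \<le> (\<integral>w. indicator {w. b < schoenberg 1 (Y n w)} w \<partial>\<Omega>)"
        proof (rule integral_mono[OF int[OF Y]])
          show "integrable \<Omega> (indicator {w. b < schoenberg 1 (Y n w)} :: real \<Rightarrow> real)"
            by (rule \<Omega>.integrable_const_bound[where B = 1]) auto
          show "\<phi> (schoenberg 1 (Y n w)) \<le> indicator {w. b < schoenberg 1 (Y n w)} w" for w
            using b \<phi>(2)[of "schoenberg 1 (Y n w)"] by (auto simp: indicator_def \<phi>_def divide_nonpos_pos)
        qed
        also have "\<dots> = measure \<Omega> (Y n -` {w. b < schoenberg 1 w} \<inter> space \<Omega>)"
          by (simp add: vimage_def Int_def conj_commute)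
        also have "\<dots> = measure (lam (k n)) {w. b < schoenberg 1 w}"
          unfolding dY[symmetric] by (rule measure_distr[symmetric]) auto
        also have "\<dots> = measure (P (k n)) (W (k n) -` {w. b < schoenberg 1 w} \<inter> space (P (k n)))"
          unfolding lam_def by (rule measure_distr) auto
        also have "\<dots> \<le> measure (P (k n)) {z \<in> space (P (k n)). B0 < h (k n) (fst z)}"
        proof (rule P.P.finite_measure_mono_AE[folded P_def])
          show "AE z in P (k n). z \<in> W (k n) -` {w. b < schoenberg 1 w} \<inter> space (P (k n)) \<longrightarrow>
            z \<in> {z \<in> space (P (k n)). B0 < h (k n) (fst z)}"
            using aeW[of "k n"]
          proof eventually_elim
            case (elim z)
            define a where "a = h (k n) (fst z)"
            have "B < a" if "B / (1 + B) < a / (1 + a)"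
            proof -
              have "0 \<le> a" "0 \<le> B" using elim by (auto simp: a_def B_def)
              then show ?thesis using that by (simp add: field_simps)
            qed
            then show ?case using elim by (auto simp: a_def b_def B_def)
          qed
        qed measurable
        also have "\<dots> \<le> \<epsilon>" unfolding prob_h using B0[of "k n"] by simp
        finally show ?thesis .
      qed
      ultimately have "(\<integral>w. \<phi> (schoenberg 1 (Y' w)) \<partial>\<Omega>) \<le> \<epsilon>"
        by (intro LIMSEQ_le_const2) auto
      moreover have "measure \<Omega> {w \<in> space \<Omega>. 1 \<le> schoenberg 1 (Y' w)} =
          (\<integral>w. indicator {w. 1 \<le> schoenberg 1 (Y' w)} w \<partial>\<Omega>)"
        by (simp add: Int_def conj_commute)
      moreover have "\<dots> \<le> (\<integral>w. \<phi> (schoenberg 1 (Y' w)) \<partial>\<Omega>)"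
      proof (rule integral_mono[OF _ int[OF Y']])
        show "integrable \<Omega> (indicator {w. 1 \<le> schoenberg 1 (Y' w)} :: real \<Rightarrow> real)"
          by (rule \<Omega>.integrable_const_bound[where B = 1]) auto
        show "indicator {w. 1 \<le> schoenberg 1 (Y' w)} w \<le> \<phi> (schoenberg 1 (Y' w))" for w
          using b by (auto simp: indicator_def \<phi>_def)
      qed
      ultimately show ?thesis by simp
    qed
    then have "measure \<Omega> {w \<in> space \<Omega>. 1 \<le> schoenberg 1 (Y' w)} \<le> 0" by (rule field_le_epsilon[of _ 0, simplified])
    then have "measure \<Omega> {w \<in> space \<Omega>. 1 \<le> schoenberg 1 (Y' w)} = 0" by (simp add: measure_le_0_iff)
    then have "AE w in \<Omega>. w \<notin> {w \<in> space \<Omega>. 1 \<le> schoenberg 1 (Y' w)}"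
      by (intro \<Omega>.AE_prob_1 AE_not_in) (auto simp: null_sets_def \<Omega>.emeasure_eq_measure)
    then show ?thesis using AE_space by eventually_elim auto
  qed
  have limH: "(\<lambda>n. hh (Y n w)) \<longlonglongrightarrow> H w" if "w \<in> space \<Omega>" "schoenberg 1 (Y' w) < 1" for w
    unfolding hh_def H_def using that by (intro tendsto_intros lim_sch) auto
  \<comment> \<open>Here \<open>t\<close> ranges over all of \<open>(0, 1)\<close>, exceptional
    positions included, so the one-sided bound \<open>low\<close> is used. For each \<open>n\<close>
    the height dominates the kernel of every interval that contains the position, because shrinking
    the interval to a point only raises the kernel.\<close>
  have aeH: "AE w in \<Omega>. \<forall>t. 0 < t \<longrightarrow> t < 1 \<longrightarrow> (S w < t \<longrightarrow> g (S w) t \<le> H w) \<and> (t < S w \<longrightarrow> g t (S w) \<le> H w)"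
    using aeS[OF countable_empty] ae_n aeA AE_space
  proof eventually_elim
    case (elim w)
    have limS: "(\<lambda>n. Sn n w) \<longlonglongrightarrow> S w" unfolding Sn_def S_def by (rule lim_sch) (use elim in simp)
    have Sn: "0 < Sn n w" "Sn n w < 1" "g0 (k n) (Sn n w) (Sn n w) \<le> hh (Y n w)" for n using elim by auto
    have limH': "(\<lambda>n. hh (Y n w)) \<longlonglongrightarrow> H w" using limH elim by simp
    show ?case
    proof (intro allI impI conjI)
      fix t :: real assume t: "0 < t" "t < 1" "S w < t"
      show "g (S w) t \<le> H w"
      proof (rule dense_le)
        fix c assume "c < g (S w) t"
        then have "\<forall>\<^sub>F n in sequentially. c < g0 (k n) (Sn n w) t"
          unfolding k_def o_def using low[OF _ t(3,2) limS tendsto_const] elim by auto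
        moreover have "\<forall>\<^sub>F n in sequentially. Sn n w < t" using order_tendstoD(2)[OF limS t(3)] .
        ultimately have "\<forall>\<^sub>F n in sequentially. c \<le> hh (Y n w)"
        proof eventually_elim
          case (elim n)
          then show ?case using mid0[of "Sn n w" "Sn n w" t "k n"] Sn[of n] t by (simp add: g0_def)
        qed
        then show "c \<le> H w" by (rule tendsto_lowerbound[OF limH']) simp
      qed
    next
      fix t :: real assume t: "0 < t" "t < 1" "t < S w"
      show "g t (S w) \<le> H w"
      proof (rule dense_le)
        fix c assume "c < g t (S w)"
        then have "\<forall>\<^sub>F n in sequentially. c < g0 (k n) t (Sn n w)"
          unfolding k_def o_def using low[OF t(1,3) _ tendsto_const limS] elim by auto
        moreover have "\<forall>\<^sub>F n in sequentially. t < Sn n w" using order_tendstoD(1)[OF limS t(3)] .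
        ultimately have "\<forall>\<^sub>F n in sequentially. c \<le> hh (Y n w)"
        proof eventually_elim
          case (elim n)
          then show ?case using mid0[of t "Sn n w" "Sn n w" "k n"] Sn[of n] t by (simp add: g0_def)
        qed
        then show "c \<le> H w" by (rule tendsto_lowerbound[OF limH']) simp
      qed
    qed
  qed
  interpret \<Omega>\<Omega>: pair_prob_space \<Omega> \<Omega> ..
  \<comment> \<open>The predicate may be nonmeasurable, so a measurable null set takes the place of
    its complement.\<close>
  have ae_pair: "AE z in N \<Otimes>\<^sub>M N. p (fst z) \<and> p (snd z)"
    if N: "prob_space N" and p: "AE x in N. p x" for N :: "'z measure" and p
  proof -
    interpret N: prob_space N by fact
    interpret NN: pair_prob_space N N ..
    obtain Z where Z: "Z \<in> sets N" "emeasure N Z = 0" "{x \<in> space N. \<not> p x} \<subseteq> Z" using p by (auto elim: AE_E)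
    have "AE x in N. x \<notin> Z" using Z by (intro AE_not_in) (auto simp: null_sets_def)
    then have "AE z in N \<Otimes>\<^sub>M N. fst z \<notin> Z \<and> snd z \<notin> Z"
      using Z(1) by (intro NN.AE_pair_measure) auto
    then show ?thesis using AE_space by eventually_elim (use Z(3) in \<open>auto simp: space_pair_measure\<close>)
  qed
  \<comment> \<open>The law of \<open>S\<close> has no atoms.\<close>
  have ae_good: "AE z in \<Omega> \<Otimes>\<^sub>M \<Omega>. S (fst z) \<noteq> S (snd z)"
  proof (rule \<Omega>\<Omega>.AE_pair_measure)
    show "{z \<in> space (\<Omega> \<Otimes>\<^sub>M \<Omega>). S (fst z) \<noteq> S (snd z)} \<in> sets (\<Omega> \<Otimes>\<^sub>M \<Omega>)" by measurable
    show "AE x in \<Omega>. AE y in \<Omega>. S (fst (x, y)) \<noteq> S (snd (x, y))"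
    proof (rule AE_I2)
      fix x
      show "AE y in \<Omega>. S (fst (x, y)) \<noteq> S (snd (x, y))" using aeS[OF countable_insert[OF countable_empty, of "S x"]] by (rule eventually_mono) auto
    qed
  qed
  have main: "(\<lambda>n. \<integral>x. F x \<partial>tau r (\<lambda>x y. h (k n) x + h (k n) y - 2 * K (k n) (f (k n) x) (f (k n) y)) (M (k n)))
        \<longlonglongrightarrow> (\<integral>x. F x \<partial>tau r D \<Omega>)"
    if F: "continuous_map (matrix_topology r) euclideanreal F" "bounded (F ` topspace (matrix_topology r))"
      and D: "(\<lambda>(x, y). D x y) \<in> borel_measurable (\<Omega> \<Otimes>\<^sub>M \<Omega>)"
        "AE z in \<Omega> \<Otimes>\<^sub>M \<Omega>. D (fst z) (snd z) = H (fst z) + H (snd z) -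
          2 * g (min (S (fst z)) (S (snd z))) (max (S (fst z)) (S (snd z)))" for r F D
  proof -
    define \<Psi> where "\<Psi> n w w' = hh w + hh w' - 2 * K (k n) (e (k n) (schoenberg 0 w)) (e (k n) (schoenberg 0 w'))" for n w w'
    have K2: "(\<lambda>z. K n (\<alpha> (fst z)) (\<beta> (snd z))) \<in> borel_measurable (A \<Otimes>\<^sub>M A)"
      if "\<alpha> \<in> measurable A (count_space (Q n))" "\<beta> \<in> measurable A (count_space (Q n))"
      for n \<alpha> \<beta> and A :: "'z measure"
    proof -
      have "(\<lambda>z. (\<alpha> (fst z), \<beta> (snd z))) \<in> measurable (A \<Otimes>\<^sub>M A) (count_space (Q n) \<Otimes>\<^sub>M count_space (Q n))"
        using that by (intro measurable_Pair measurable_compose[OF measurable_fst] measurable_compose[OF measurable_snd])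
      then have "(\<lambda>z. (\<alpha> (fst z), \<beta> (snd z))) \<in> measurable (A \<Otimes>\<^sub>M A) (count_space (Q n \<times> Q n))"
        by (simp add: pair_measure_countable[OF countable_finite countable_finite] Q)
      from measurable_compose[OF this, of "\<lambda>q. K n (fst q) (snd q)" borel] show ?thesis by simp
    qed
    have esch: "(\<lambda>w. e n (schoenberg 0 w)) \<in> measurable borel (count_space (Q n))" for n
      by (rule measurable_compose[OF measurable_schoenberg e])
    have \<Psi>m: "(\<lambda>(w, w'). \<Psi> n w w') \<in> borel_measurable (borel \<Otimes>\<^sub>M borel)" for n
      unfolding \<Psi>_def case_prod_beta using K2[OF esch esch, of "k n"] by measurable
    have dm: "(\<lambda>(x, y). h (k n) x + h (k n) y - 2 * K (k n) (f (k n) x) (f (k n) y)) \<in> borel_measurable (M (k n) \<Otimes>\<^sub>M M (k n))" for n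
      unfolding case_prod_beta using K2[OF f f, of "k n"] h[of "k n"] by measurable
    have pull: "(\<lambda>(x, y). d (X x) (X y)) \<in> borel_measurable (A \<Otimes>\<^sub>M A)"
      if X: "X \<in> measurable A B" and d: "(\<lambda>(x, y). d x y) \<in> borel_measurable (B \<Otimes>\<^sub>M B)"
      for A :: "'u measure" and B :: "'w measure" and X and d :: "'w \<Rightarrow> 'w \<Rightarrow> real"
    proof -
      have "(\<lambda>z. (X (fst z), X (snd z))) \<in> measurable (A \<Otimes>\<^sub>M A) (B \<Otimes>\<^sub>M B)"
        using X by (intro measurable_Pair measurable_compose[OF measurable_fst] measurable_compose[OF measurable_snd])
      from measurable_compose[OF this d] show ?thesis by (simp add: case_prod_beta)
    qed
    \<comment> \<open>The law is followed from the tree to the product with the auxiliary variable,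
      then to the coded variable, to its law on the line, and finally to the Skorohod copy.\<close>
    have eq: "tau r (\<lambda>x y. h (k n) x + h (k n) y - 2 * K (k n) (f (k n) x) (f (k n) y)) (M (k n)) =
        tau r (\<lambda>x y. \<Psi> n (Y n x) (Y n y)) \<Omega>" for n
    proof -
      have Pn: "prob_space (P (k n))" unfolding P_def by (rule P.P.prob_space_axioms)
      have fstm: "fst \<in> measurable (P (k n)) (M (k n))" unfolding P_def by (rule measurable_fst)
      let ?d = "\<lambda>x y. h (k n) x + h (k n) y - 2 * K (k n) (f (k n) x) (f (k n) y)"
      have "tau r ?d (M (k n)) = tau r ?d (distr (P (k n)) (M (k n)) fst)"
        unfolding P_def by (simp only: U.distr_pair_fst)
      also have "\<dots> = tau r (\<lambda>x y. ?d (fst x) (fst y)) (P (k n))"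
        by (rule tau_distr[OF Pn fstm dm])
      also have "\<dots> = tau r (\<lambda>x y. \<Psi> n (W (k n) x) (W (k n) y)) (P (k n))"
      proof (rule tau_cong_AE[OF Pn pull[OF fstm dm] pull[OF W \<Psi>m]])
        show "AE z in P (k n) \<Otimes>\<^sub>M P (k n). ?d (fst (fst z)) (fst (snd z)) = \<Psi> n (W (k n) (fst z)) (W (k n) (snd z))"
          using ae_pair[OF Pn aeW[of "k n"]] by eventually_elim (auto simp: \<Psi>_def)
      qed
      also have "\<dots> = tau r (\<Psi> n) (lam (k n))"
        unfolding lam_def by (rule tau_distr[OF Pn W \<Psi>m, symmetric])
      also have "\<dots> = tau r (\<lambda>x y. \<Psi> n (Y n x) (Y n y)) \<Omega>"
        unfolding dY[symmetric] by (rule tau_distr[OF \<open>prob_space \<Omega>\<close> Y \<Psi>m])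
      finally show ?thesis .
    qed
    obtain B where B: "\<And>x. x \<in> topspace (matrix_topology r) \<Longrightarrow> \<bar>F x\<bar> \<le> B"
      using F(2) by (auto simp: bounded_iff)
    have dmat: "distance_matrix r d \<xi> \<in> topspace (matrix_topology r)" for d :: "real \<Rightarrow> real \<Rightarrow> real" and \<xi>
      by (simp add: topspace_matrix distance_matrix_def)
    have "prob_space (Pi\<^sub>M {1..r} (\<lambda>_. \<Omega>))" by (rule prob_space_PiM) (rule \<open>prob_space \<Omega>\<close>)
    then interpret Pi: prob_space "Pi\<^sub>M {1..r} (\<lambda>_. \<Omega>)" .
    note Fm = measurable_continuous_map_borel_of[OF F(1) refl]
    have "(\<lambda>n. \<integral>\<xi>. F (distance_matrix r (\<lambda>x y. \<Psi> n (Y n x) (Y n y)) \<xi>) \<partial>Pi\<^sub>M {1..r} (\<lambda>_. \<Omega>))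
      \<longlonglongrightarrow> (\<integral>\<xi>. F (distance_matrix r D \<xi>) \<partial>Pi\<^sub>M {1..r} (\<lambda>_. \<Omega>))"
    proof (rule integral_dominated_convergence[where w = "\<lambda>_. B"])
      show "(\<lambda>\<xi>. F (distance_matrix r D \<xi>)) \<in> borel_measurable (Pi\<^sub>M {1..r} (\<lambda>_. \<Omega>))"
        by (rule measurable_compose[OF measurable_distance_matrix[OF D(1)] Fm])
      show "(\<lambda>\<xi>. F (distance_matrix r (\<lambda>x y. \<Psi> n (Y n x) (Y n y)) \<xi>)) \<in> borel_measurable (Pi\<^sub>M {1..r} (\<lambda>_. \<Omega>))" for n
        by (rule measurable_compose[OF measurable_distance_matrix[OF pull[OF Y \<Psi>m]] Fm])
      define R where "R x y \<longleftrightarrow> (\<lambda>n. \<Psi> n (Y n x) (Y n y)) \<longlonglongrightarrow> D x y" for x y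
      have "AE z in \<Omega> \<Otimes>\<^sub>M \<Omega>. R (fst z) (snd z)"
        using D(2) ae_good ae_pair[OF \<open>prob_space \<Omega>\<close> aeS[OF C]] ae_pair[OF \<open>prob_space \<Omega>\<close> aeA]
          ae_pair[OF \<open>prob_space \<Omega>\<close> ae_n] AE_space
      proof eventually_elim
        case (elim z)
        obtain x y where z: "z = (x, y)" by (cases z)
        have sp: "x \<in> space \<Omega>" "y \<in> space \<Omega>" using elim by (auto simp: z space_pair_measure)
        have limS: "(\<lambda>n. Sn n v) \<longlonglongrightarrow> S v" if "v \<in> space \<Omega>" for v
          unfolding Sn_def S_def by (rule lim_sch[OF that])
        have g0_sym: "g0 n s t = g0 n t s" for n s t unfolding g0_def by (rule sym[OF eQ eQ])
        have "(\<lambda>n. g0 (k n) (Sn n x) (Sn n y)) \<longlonglongrightarrow> g (min (S x) (S y)) (max (S x) (S y))"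
        proof (cases "S x < S y")
          case True
          then show ?thesis
            using conv[OF _ _ _ _ _ limS[OF sp(1)] limS[OF sp(2)]] elim by (simp add: z k_def)
        next
          case False
          then have "S y < S x" using elim by (simp add: z)
          then have "(\<lambda>n. g0 (k n) (Sn n y) (Sn n x)) \<longlonglongrightarrow> g (S y) (S x)"
            using conv[OF _ _ _ _ _ limS[OF sp(2)] limS[OF sp(1)]] elim by (simp add: z k_def)
          moreover have "(\<lambda>n. g0 (k n) (Sn n x) (Sn n y)) = (\<lambda>n. g0 (k n) (Sn n y) (Sn n x))"
            by (intro ext g0_sym)
          ultimately show ?thesis using \<open>S y < S x\<close> by (simp only: min.absorb2 max.absorb1 less_imp_le)
        qed
        moreover have "(\<lambda>n. hh (Y n x)) \<longlonglongrightarrow> H x" "(\<lambda>n. hh (Y n y)) \<longlonglongrightarrow> H y"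
          using limH sp elim by (auto simp: z)
        ultimately have "(\<lambda>n. hh (Y n x) + hh (Y n y) - 2 * g0 (k n) (Sn n x) (Sn n y)) \<longlonglongrightarrow>
            H x + H y - 2 * g (min (S x) (S y)) (max (S x) (S y))" by (intro tendsto_intros)
        then show ?case using elim by (simp add: R_def z \<Psi>_def g0_def Sn_def)
      qed
      from AE_PiM_all_pairs[OF \<open>prob_space \<Omega>\<close> this, of r]
      show "AE \<xi> in Pi\<^sub>M {1..r} (\<lambda>_. \<Omega>). (\<lambda>n. F (distance_matrix r (\<lambda>x y. \<Psi> n (Y n x) (Y n y)) \<xi>)) \<longlonglongrightarrow> F (distance_matrix r D \<xi>)"
      proof eventually_elim
        case (elim \<xi>)
        show ?case by (rule tendsto_distance_matrix[OF F(1)]) (use elim in \<open>auto simp: R_def\<close>)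
      qed
      show "integrable (Pi\<^sub>M {1..r} (\<lambda>_. \<Omega>)) (\<lambda>_. B)" by (rule Pi.integrable_const)
    qed (use B[OF dmat] in auto)
    then show ?thesis
      unfolding eq integral_tau[OF pull[OF Y \<Psi>m] F(1)] integral_tau[OF D(1) F(1)] .
  qed
  show thesis
    by (rule that[of k \<Omega> S H g]) (fact k \<open>prob_space \<Omega>\<close> dS mid g0nn aeH main | simp)+
qed

section \<open>The four-point condition\<close>

definition gromov_product :: "('a \<Rightarrow> 'a \<Rightarrow> real) \<Rightarrow> 'a \<Rightarrow> 'a \<Rightarrow> 'a \<Rightarrow> real" where
  "gromov_product \<rho> b x y = (\<rho> b x + \<rho> b y - \<rho> x y) / 2"

text \<open>The last conjunct is the four-point condition.\<close>

definition tree_like :: "'a set \<Rightarrow> ('a \<Rightarrow> 'a \<Rightarrow> real) \<Rightarrow> bool" where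
  "tree_like X \<rho> \<longleftrightarrow>
     (\<forall>x\<in>X. \<rho> x x = 0) \<and> (\<forall>x\<in>X. \<forall>y\<in>X. \<rho> x y = \<rho> y x) \<and>
     (\<forall>x\<in>X. \<forall>y\<in>X. \<forall>z\<in>X. \<rho> x z \<le> \<rho> x y + \<rho> y z) \<and>
     (\<forall>b\<in>X. \<forall>x\<in>X. \<forall>y\<in>X. \<forall>z\<in>X.
        min (gromov_product \<rho> b x y) (gromov_product \<rho> b y z) \<le> gromov_product \<rho> b x z)"

text \<open>The witness \<open>w\<close> is the median of \<open>b\<close>, \<open>x\<close>,
  \<open>y\<close>: its distance from \<open>x\<close> is the Gromov product of \<open>b\<close> and
  \<open>y\<close> at \<open>x\<close>. Then the Gromov product of \<open>x\<close> and
  \<open>y\<close> at \<open>b\<close> is the distance from \<open>b\<close> to \<open>w\<close>.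
  Any \<open>z\<close> is separated by \<open>w\<close> from \<open>x\<close> or from
  \<open>y\<close>, and on that side the triangle inequality bounds the Gromov product at
  \<open>b\<close> by the same distance.\<close>

lemma tree_like_if_medians:
  assumes refl: "\<And>x. x \<in> X \<Longrightarrow> \<rho> x x = 0"
    and sym: "\<And>x y. x \<in> X \<Longrightarrow> y \<in> X \<Longrightarrow> \<rho> x y = \<rho> y x"
    and tri: "\<And>x y z. x \<in> X \<Longrightarrow> y \<in> X \<Longrightarrow> z \<in> X \<Longrightarrow> \<rho> x z \<le> \<rho> x y + \<rho> y z"
    and median: "\<And>b x y. b \<in> X \<Longrightarrow> x \<in> X \<Longrightarrow> y \<in> X \<Longrightarrow> \<exists>w\<in>X. \<rho> x w = (\<rho> b x + \<rho> x y - \<rho> b y) / 2 \<and>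
      (\<forall>z\<in>X. \<rho> x z = \<rho> x w + \<rho> w z \<or> \<rho> z y = \<rho> z w + \<rho> w y)"
  shows "tree_like X \<rho>"
proof -
  have "min (gromov_product \<rho> b x z) (gromov_product \<rho> b z y) \<le> gromov_product \<rho> b x y"
    if X: "b \<in> X" "x \<in> X" "y \<in> X" "z \<in> X" for b x y z
  proof -
    obtain w where w: "w \<in> X" "\<rho> x w = (\<rho> b x + \<rho> x y - \<rho> b y) / 2"
      and thru: "\<And>z. z \<in> X \<Longrightarrow> \<rho> x z = \<rho> x w + \<rho> w z \<or> \<rho> z y = \<rho> z w + \<rho> w y"
      using median[OF X(1-3)] by blast
    have "\<rho> x y = \<rho> x w + \<rho> w y"
      using thru[OF X(3)] tri[of x w y] tri[of x y w] refl[OF X(3)] sym[of y w] X w(1) by linarith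
    moreover have "\<rho> b x = \<rho> b w + \<rho> x w \<and> \<rho> b y = \<rho> b w + \<rho> w y"
    proof -
      have "2 * \<rho> x w = \<rho> b x + \<rho> x y - \<rho> b y" using w(2) by simp
      then show ?thesis using calculation thru[OF X(1)] sym[OF w(1) X(1)] sym[OF X(2,1)] by argo
    qed
    ultimately have "gromov_product \<rho> b x z \<le> gromov_product \<rho> b x y \<or>
        gromov_product \<rho> b z y \<le> gromov_product \<rho> b x y"
      using thru[OF X(4)] tri[OF X(1) w(1) X(4)] sym[OF X(4) w(1)] unfolding gromov_product_def by argo
    then show ?thesis by (simp add: min_le_iff_disj)
  qed
  then show ?thesis unfolding tree_like_def using refl sym tri by blast
qed

lemma mdist_self: "x \<in> mspace T \<Longrightarrow> mdist T x x = 0"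
  by simp

text \<open>Either the geodesic passes through \<open>p\<close>, and the distance splits there, or
  it connects its ends without \<open>p\<close>.\<close>

lemma real_tree_through:
  assumes T: "real_tree T" and x: "x \<in> mspace T" and z: "z \<in> mspace T" and p: "p \<in> mspace T"
  shows "mdist T x z = mdist T x p + mdist T p z \<or> connected_component_of (minus_point T p) x z"
proof (cases "x = z")
  case True
  show ?thesis
  proof (cases "x = p")
    case False
    then have "x \<in> topspace (minus_point T p)" using x by (simp add: minus_point_def)
    then show ?thesis using True by (simp add: connected_component_of_refl)
  qed (use True p in auto)
next
  case False
  then obtain \<gamma> where \<gamma>: "geodesic T x z \<gamma>" using T x z unfolding real_tree_def by blast
  show ?thesis
  proof (cases "\<exists>s\<in>{0..mdist T x z}. \<gamma> s = p")
    case True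
    then show ?thesis using geodesic_D[OF \<gamma>] by force
  next
    case False
    then show ?thesis using geodesic_connected_component[OF \<gamma> x z] by blast
  qed
qed

lemma tree_like_real_tree:
  assumes T: "real_tree T"
  shows "tree_like (mspace T) (mdist T)"
proof (rule tree_like_if_medians)
  fix b x y assume X: "b \<in> mspace T" "x \<in> mspace T" "y \<in> mspace T"
  define s where "s = (mdist T b x + mdist T x y - mdist T b y) / 2"
  have s: "0 \<le> s" "s \<le> mdist T x y"
    using mdist_triangle[of b T x y] mdist_triangle[of b T y x] mdist_triangle[of x T b y] X
    unfolding s_def by (auto simp: mdist_commute field_simps)
  show "\<exists>w\<in>mspace T. mdist T x w = (mdist T b x + mdist T x y - mdist T b y) / 2 \<and>
      (\<forall>z\<in>mspace T. mdist T x z = mdist T x w + mdist T w z \<or> mdist T z y = mdist T z w + mdist T w y)"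
  \<comment> \<open>Real trees guarantee separation at interior points of a geodesic only. If the
    median is an end, that end itself serves as \<open>w\<close>; otherwise \<open>z\<close> cannot
    be connected to both ends in the complement of the median.\<close>
  proof (cases "s = 0 \<or> s = mdist T x y")
    case True
    then show ?thesis
    proof
      assume "s = 0"
      then show ?thesis using X by (intro bexI[of _ x]) (auto simp: s_def)
    next
      assume "s = mdist T x y"
      then show ?thesis using X unfolding s_def by (intro bexI[of _ y]) auto
    qed
  next
    case False
    then have s': "0 < s" "s < mdist T x y" using s by auto
    then have "x \<noteq> y" using X mdist_self by fastforce
    then obtain \<gamma> where \<gamma>: "geodesic T x y \<gamma>"
      and sep: "\<not> connected_component_of (minus_point T (\<gamma> s)) x y"
      using T X s' unfolding real_tree_def by (metis greaterThanLessThan_iff)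
    have \<gamma>s: "\<gamma> s \<in> mspace T" "mdist T x (\<gamma> s) = s" using geodesic_D[OF \<gamma>] s by auto
    show ?thesis
    proof (intro bexI[of _ "\<gamma> s"] conjI ballI)
      show "mdist T x (\<gamma> s) = (mdist T b x + mdist T x y - mdist T b y) / 2" using \<gamma>s by (simp add: s_def)
      fix z assume z: "z \<in> mspace T"
      show "mdist T x z = mdist T x (\<gamma> s) + mdist T (\<gamma> s) z \<or> mdist T z y = mdist T z (\<gamma> s) + mdist T (\<gamma> s) y"
        using real_tree_through[OF T X(2) z \<gamma>s(1)] real_tree_through[OF T z X(3) \<gamma>s(1)] sep
        by (blast intro: connected_component_of_trans)
    qed (rule \<gamma>s)
  qed
qed (auto simp: mdist_commute mdist_triangle)

section \<open>Separability of long dendrons\<close>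

lemma countable_disjoint_positive:
  assumes "finite_measure M" and disj: "disjoint_family_on B I"
    and pos: "\<And>i. i \<in> I \<Longrightarrow> 0 < measure M (B i)"
  shows "countable I"
proof -
  interpret finite_measure M by fact
  have sets: "B i \<in> sets M" if "i \<in> I" for i
    using pos[OF that] by (metis measure_notin_sets less_irrefl)
  have "(\<lambda>i. measure M (B i)) summable_on I"
  proof (rule nonneg_bdd_above_summable_on)
    have "(\<Sum>i\<in>F. measure M (B i)) \<le> measure M (space M)" if F: "finite F" "F \<subseteq> I" for F
    proof -
      have "(\<Sum>i\<in>F. measure M (B i)) = measure M (\<Union>i\<in>F. B i)"
        using F sets disj by (intro finite_measure_finite_Union[symmetric])
          (auto intro: disjoint_family_on_mono)
      also have "\<dots> \<le> measure M (space M)" by (rule bounded_measure)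
      finally show ?thesis .
    qed
    then show "bdd_above (sum (\<lambda>i. measure M (B i)) ` {F. F \<subseteq> I \<and> finite F})"
      by (intro bdd_aboveI2[of _ _ "measure M (space M)"]) auto
  qed simp
  then have "countable {i \<in> I. measure M (B i) \<noteq> 0}" by (rule summable_countable_real)
  then show ?thesis by (rule countable_subset[rotated]) (use pos in force)
qed

text \<open>\<open>P h\<close> consists of the points at distance \<open>h\<close> from a root
  \<open>b\<close> beyond which the tree continues. Above each of them sits a branch of positive
  mass, and these branches are disjoint, so \<open>P h\<close> is countable. Following a geodesic
  from \<open>b\<close> almost to its end and stopping at a rational distance shows density.\<close>

lemma long_dendron_separable:
  assumes D: "long_dendron T \<nu>"
  obtains Q where "countable Q" "Q \<subseteq> mspace T" "\<And>x e. x \<in> mspace T \<Longrightarrow> 0 < e \<Longrightarrow> \<exists>q\<in>Q. mdist T x q < e"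
proof -
  have T: "real_tree T" and branch: "\<And>B. B \<in> branches T \<Longrightarrow> 0 < measure \<nu> (B \<times> {0..})"
    and "prob_space \<nu>" using D by (auto simp: long_dendron_def borel_prob_measures_def)
  then interpret prob_space \<nu> by simp
  obtain b where b: "b \<in> mspace T" using T by (auto simp: real_tree_def)
  have "\<exists>\<gamma>. geodesic T b x \<gamma>" if "x \<in> mspace T" "x \<noteq> b" for x
    using T b that unfolding real_tree_def by metis
  then obtain \<gamma> where \<gamma>: "\<And>x. x \<in> mspace T \<Longrightarrow> x \<noteq> b \<Longrightarrow> geodesic T b x (\<gamma> x)" by metis
  have sep: "\<not> connected_component_of (minus_point T (\<gamma> x h)) b x"
    if "x \<in> mspace T" "x \<noteq> b" "0 < h" "h < mdist T b x" for x h
    using T b that \<gamma>[of x] unfolding real_tree_def by (metis greaterThanLessThan_iff)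
  define P where "P h = {\<gamma> x h | x. x \<in> mspace T \<and> x \<noteq> b \<and> h < mdist T b x}" for h
  have P_sub: "P h \<subseteq> mspace T" if "0 < h" for h
    using that geodesic_D(1)[OF \<gamma>] by (auto simp: P_def)
  have P_countable: "countable (P h)" if h: "0 < h" for h
  proof -
    have "\<forall>p\<in>P h. \<exists>x. x \<in> mspace T \<and> x \<noteq> b \<and> h < mdist T b x \<and> p = \<gamma> x h" by (auto simp: P_def)
    then obtain x where x: "\<And>p. p \<in> P h \<Longrightarrow> x p \<in> mspace T \<and> x p \<noteq> b \<and> h < mdist T b (x p) \<and> p = \<gamma> (x p) h"
      by metis
    define B where "B p = connected_component_of_set (minus_point T p) (x p)" for p
    \<comment> \<open>A point \<open>z\<close> beyond \<open>p\<close> has a geodesic from the root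
      through \<open>p\<close>, at parameter \<open>h\<close>. So \<open>z\<close> determines
      \<open>p\<close>, which gives disjointness.\<close>
    have B: "\<gamma> z h = p" if p: "p \<in> P h" and z: "z \<in> B p" for p z
    proof -
      have conn: "connected_component_of (minus_point T p) (x p) z" using z by (simp add: B_def)
      then have zT: "z \<in> mspace T"
        by (auto dest!: connected_component_of_equiv[THEN iffD1] simp: minus_point_def)
      have nz: "\<not> connected_component_of (minus_point T p) b z"
        using sep[of "x p" h] x[OF p] h conn by (metis connected_component_of_sym connected_component_of_trans)
      have "p \<noteq> b"
      proof
        assume "p = b"
        have "mdist T b p = h" using geodesic_D(2)[OF \<gamma>, of "x p" h] x[OF p] h by simp
        then show False using \<open>p = b\<close> b h by (simp add: mdist_self)
      qed
      then have "b \<in> topspace (minus_point T p)" using b by (simp add: minus_point_def)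
      then have "z \<noteq> b" using nz by (auto simp: connected_component_of_refl)
      then obtain s where s: "s \<in> {0..mdist T b z}" "\<gamma> z s = p"
        using geodesic_connected_component[OF \<gamma>[OF zT] b zT, of p] nz by blast
      have "s = mdist T b p" using geodesic_D(2)[OF \<gamma>[OF zT \<open>z \<noteq> b\<close>] s(1)] s(2) by simp
      also have "\<dots> = h" using geodesic_D(2)[OF \<gamma>, of "x p" h] x[OF p] h by simp
      finally show ?thesis using s by simp
    qed
    show ?thesis
    proof (rule countable_disjoint_positive[where B = "\<lambda>p. B p \<times> {0..}" and M = \<nu>])
      show "disjoint_family_on (\<lambda>p. B p \<times> {0::real..}) (P h)"
        using B by (auto simp: disjoint_family_on_def)
      fix p assume p: "p \<in> P h"
      have "x p \<noteq> p"
        using geodesic_D(2)[OF \<gamma>, of "x p" h] x[OF p] h by (metis atLeastAtMost_iff less_imp_le less_irrefl)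
      then have "x p \<in> topspace (minus_point T p)" using x[OF p] by (simp add: minus_point_def)
      then have "B p \<in> branches T"
        unfolding branches_def B_def connected_components_of_def using P_sub[OF h] p by blast
      then show "0 < measure \<nu> (B p \<times> {0..})" by (rule branch)
    qed (rule finite_measure_axioms)
  qed
  show thesis
  proof (rule that[of "insert b (\<Union>h\<in>\<rat> \<inter> {0<..}. P h)"])
    show "countable (insert b (\<Union>h\<in>\<rat> \<inter> {0<..}. P h))"
      by (intro countable_insert countable_UN countable_Int1 countable_rat P_countable) auto
    show "insert b (\<Union>h\<in>\<rat> \<inter> {0<..}. P h) \<subseteq> mspace T" using P_sub b by auto
    fix x and e :: real assume x: "x \<in> mspace T" and e: "0 < e"
    show "\<exists>q\<in>insert b (\<Union>h\<in>\<rat> \<inter> {0<..}. P h). mdist T x q < e"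
    proof (cases "x = b")
      case False
      then have "0 < mdist T b x" using b x by (metis mdist_nonneg mdist_zero order_le_less)
      then obtain h where h: "h \<in> \<rat>" "max 0 (mdist T b x - e) < h" "h < mdist T b x"
        using Rats_dense_in_real[of "max 0 (mdist T b x - e)" "mdist T b x"] e by auto
      then have "\<gamma> x h \<in> P h" using x False by (auto simp: P_def)
      moreover have "mdist T x (\<gamma> x h) < e"
        using geodesic_D(3)[OF \<gamma>[OF x False], of h] h by (auto simp: mdist_commute)
      ultimately show ?thesis using h by auto
    qed (use x e in \<open>auto simp: mdist_self\<close>)
  qed
qed

section \<open>Graph distance in finite trees\<close>

locale finite_tree_graph =
  fixes V :: "'v set" and E :: "'v set set"
  assumes tree: "finite_tree V E"
begin

abbreviation gd :: "'v \<Rightarrow> 'v \<Rightarrow> nat" where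
  "gd \<equiv> graph_dist V E"

lemma edge_in_V: "{u, v} \<in> E \<Longrightarrow> u \<in> V \<and> v \<in> V \<and> u \<noteq> v"
  using tree unfolding finite_tree_def finite_simple_graph_def by (force simp: doubleton_eq_iff)

lemma gd_le: "walk V E u xs v \<Longrightarrow> length xs = Suc n \<Longrightarrow> gd u v \<le> n"
  unfolding graph_dist_def by (rule Least_le) blast

lemma gd_walk:
  assumes "u \<in> V" "v \<in> V"
  obtains xs where "walk V E u xs v" "length xs = Suc (gd u v)"
proof -
  obtain xs where xs: "walk V E u xs v" using tree assms unfolding finite_tree_def by blast
  then have "\<exists>n xs. walk V E u xs v \<and> length xs = Suc n"
    by (intro exI[of _ "length xs - 1"] exI[of _ xs]) (auto simp: walk_def)
  then have "\<exists>xs. walk V E u xs v \<and> length xs = Suc (gd u v)"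
    unfolding graph_dist_def by (rule LeastI_ex)
  then show ?thesis using that by blast
qed

lemma gd_self [simp]: "u \<in> V \<Longrightarrow> gd u u = 0"
  using gd_le[of u "[u]" u 0] by (simp add: walk_def)

lemma gd_eq_0:
  assumes "u \<in> V" "v \<in> V" "gd u v = 0" shows "u = v"
proof -
  obtain xs where xs: "walk V E u xs v" "length xs = Suc 0" using gd_walk[OF assms(1,2)] assms(3) by metis
  then obtain a where "xs = [a]" by (auto simp: length_Suc_conv)
  then show ?thesis using xs by (auto simp: walk_def)
qed

lemma gd_commute:
  assumes "u \<in> V" "v \<in> V" shows "gd u v = gd v u"
proof -
  have *: "gd v u \<le> gd u v" if uv: "u \<in> V" "v \<in> V" for u v
  proof -
    obtain xs where xs: "walk V E u xs v" "length xs = Suc (gd u v)" using gd_walk[OF uv] .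
    then have "walk V E v (rev xs) u"
      by (auto simp: walk_def hd_rev last_rev insert_commute)
    then show ?thesis using gd_le[of v "rev xs" u] xs by simp
  qed
  show ?thesis using *[OF assms] *[OF assms(2,1)] by simp
qed

lemma gd_edge: "{u, v} \<in> E \<Longrightarrow> gd u v = 1"
proof -
  assume e: "{u, v} \<in> E"
  then have "walk V E u [u, v] v" using edge_in_V[OF e] by (auto simp: walk_def)
  then have "gd u v \<le> 1" using gd_le[of u "[u, v]" v 1] by simp
  moreover have "gd u v \<noteq> 0" using gd_eq_0[of u v] edge_in_V[OF e] by auto
  ultimately show ?thesis by simp
qed

lemma gd_triangle:
  assumes "u \<in> V" "v \<in> V" "w \<in> V" shows "gd u w \<le> gd u v + gd v w"
proof -
  obtain xs where xs: "walk V E u xs v" "length xs = Suc (gd u v)" using gd_walk[OF assms(1,2)] .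
  obtain ys where ys: "walk V E v ys w" "length ys = Suc (gd v w)" using gd_walk[OF assms(2,3)] .
  obtain zs where zs: "ys = v # zs" using ys by (cases ys) (auto simp: walk_def)
  have "walk V E u (xs @ zs) w"
    using xs ys zs by (cases zs) (auto simp: walk_def successively_append_iff)
  then show ?thesis using gd_le[of u "xs @ zs" w "gd u v + gd v w"] xs ys zs by simp
qed

lemma gd_predecessor:
  assumes "u \<in> V" "v \<in> V" "u \<noteq> v"
  obtains w where "w \<in> V" "{w, v} \<in> E" "gd u v = Suc (gd u w)"
proof -
  obtain xs where xs: "walk V E u xs v" "length xs = Suc (gd u v)" using gd_walk[OF assms(1,2)] .
  have "xs \<noteq> []" "last xs = v" using xs by (auto simp: walk_def)
  then obtain ys where ys: "xs = ys @ [v]" by (metis append_butlast_last_id)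
  then have "ys \<noteq> []" using xs assms by (auto simp: walk_def)
  then obtain zs w where zs: "ys = zs @ [w]" by (metis rev_exhaust)
  have w: "w \<in> V" "{w, v} \<in> E" "walk V E u (zs @ [w]) w"
    using xs by (auto simp: walk_def ys zs successively_append_iff hd_append split: if_splits)
  have "gd u w \<le> length zs" using gd_le[OF w(3)] by simp
  moreover have "gd u v \<le> gd u w + 1" using gd_triangle[OF assms(1) w(1) assms(2)] gd_edge[OF w(2)] by simp
  ultimately have "gd u v = Suc (gd u w)" using xs(2) by (simp add: ys zs)
  then show ?thesis using that w by blast
qed

definition avoid :: "'v set \<Rightarrow> 'v \<Rightarrow> 'v \<Rightarrow> bool" where
  "avoid e a b \<longleftrightarrow> {a, b} \<in> E \<and> {a, b} \<noteq> e"

lemma avoid_sym: "(avoid e)\<^sup>*\<^sup>* a b \<Longrightarrow> (avoid e)\<^sup>*\<^sup>* b a"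
  by (rule sympD[OF symp_rtranclp]) (auto simp: symp_def avoid_def insert_commute)

text \<open>A distinct path from \<open>u\<close> to \<open>v\<close> without the edge has at least
  three vertices, and the edge closes it to a cycle.\<close>

lemma bridge:
  assumes e: "{u, v} \<in> E"
  shows "\<not> (avoid {u, v})\<^sup>*\<^sup>* u v"
proof
  assume "(avoid {u, v})\<^sup>*\<^sup>* u v"
  then obtain xs where "rtrancl_path (avoid {u, v}) u xs v" by (auto simp: rtranclp_eq_rtrancl_path)
  then obtain ys where ys: "rtrancl_path (avoid {u, v}) u ys v" "distinct (u # ys)"
    by (rule rtrancl_path_distinct)
  have "walk V E a (a # zs) b" if "rtrancl_path (avoid {u, v}) a zs b" "a \<in> V" for a b zs
    using that
  proof (induction rule: rtrancl_path.induct)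
    case (step x y zs z)
    then have "{x, y} \<in> E" by (simp add: avoid_def)
    then show ?case using step edge_in_V by (auto simp: walk_def)
  qed (simp add: walk_def)
  then have w: "walk V E u (u # ys) v" using ys edge_in_V[OF e] by blast
  have "length ys \<noteq> 0" using w edge_in_V[OF e] by (auto simp: walk_def)
  moreover have "length ys \<noteq> 1"
  proof
    assume "length ys = 1"
    then have "ys = [v]" using w by (auto simp: walk_def length_Suc_conv)
    then show False using ys(1) by (auto simp: avoid_def elim: rtrancl_path.cases)
  qed
  ultimately have "2 \<le> length ys" by linarith
  then have "graph_cycle V E (u # ys)"
    using w ys(2) e by (auto simp: graph_cycle_def walk_def insert_commute)
  then show False using tree unfolding finite_tree_def by blast
qed

text \<open>Vertices before \<open>t\<close> on a shortest path from \<open>x\<close> are closer to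
  \<open>x\<close> than both \<open>u\<close> and \<open>v\<close>, so the path does not use that
  edge.\<close>

lemma avoid_near:
  assumes "x \<in> V" "t \<in> V" "{u, v} \<in> E" "gd x t \<le> gd x u" "gd x t \<le> gd x v"
  shows "(avoid {u, v})\<^sup>*\<^sup>* x t"
  using assms(2,4,5)
proof (induction "gd x t" arbitrary: t)
  case 0
  then show ?case using gd_eq_0[OF assms(1)] by auto
next
  case (Suc n)
  then have "x \<noteq> t" using assms(1) by auto
  then obtain w where w: "w \<in> V" "{w, t} \<in> E" "gd x t = Suc (gd x w)"
    using gd_predecessor[OF assms(1) Suc.prems(1)] by blast
  have "avoid {u, v} w t"
    using w Suc.prems by (auto simp: avoid_def doubleton_eq_iff)
  moreover have "(avoid {u, v})\<^sup>*\<^sup>* x w" using Suc w by auto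
  ultimately show ?case by simp
qed

text \<open>If both ends of an edge were equally far from \<open>x\<close>, both could be reached
  without the edge, which would not be a bridge.\<close>

lemma gd_edge_cases:
  assumes "x \<in> V" "{u, v} \<in> E"
  shows "gd x v = Suc (gd x u) \<or> gd x u = Suc (gd x v)"
proof -
  have uv: "u \<in> V" "v \<in> V" using edge_in_V[OF assms(2)] by auto
  have "gd x u \<noteq> gd x v"
    using avoid_near[OF assms(1) uv(1) assms(2)] avoid_near[OF assms(1) uv(2) assms(2)]
      bridge[OF assms(2)] avoid_sym by (metis order_refl rtranclp_trans)
  moreover have "gd x u \<le> gd x v + 1" "gd x v \<le> gd x u + 1"
    using gd_triangle[OF assms(1) uv(2,1)] gd_triangle[OF assms(1) uv] gd_edge[OF assms(2)]
      gd_commute[OF uv] by auto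
  ultimately show ?thesis by linarith
qed

text \<open>\<open>x\<close> lies on the side of \<open>u\<close> and \<open>y\<close> on the side
  of \<open>v\<close>. By induction on the distance from \<open>x\<close>, each vertex is either
  reachable without the edge or at least as far from \<open>x\<close> as a path through the edge
  suggests; the bridge rules out the first alternative for \<open>y\<close>.\<close>

lemma gd_crossing:
  assumes x: "x \<in> V" and y: "y \<in> V" and e: "{u, v} \<in> E"
    and xu: "gd x v = Suc (gd x u)" and yv: "gd y u = Suc (gd y v)"
  shows "gd x y = Suc (gd x u + gd v y)"
proof -
  have uv: "u \<in> V" "v \<in> V" using edge_in_V[OF e] by auto
  have xu': "(avoid {u, v})\<^sup>*\<^sup>* x u" and yv': "(avoid {u, v})\<^sup>*\<^sup>* y v"
    using avoid_near[OF x uv(1) e] avoid_near[OF y uv(2) e] xu yv by auto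
  have "(avoid {u, v})\<^sup>*\<^sup>* x t \<or> Suc (gd x u + gd v t) \<le> gd x t" if "t \<in> V" for t
    using that
  proof (induction "gd x t" arbitrary: t)
    case 0
    then show ?case using gd_eq_0[OF x] by auto
  next
    case (Suc n)
    then have "x \<noteq> t" using x by auto
    then obtain w where w: "w \<in> V" "{w, t} \<in> E" "gd x t = Suc (gd x w)"
      using gd_predecessor[OF x Suc.prems] by blast
    then consider "(avoid {u, v})\<^sup>*\<^sup>* x w" | "Suc (gd x u + gd v w) \<le> gd x w" using Suc by auto
    then show ?case
    proof cases
      case 1
      show ?thesis
      proof (cases "{w, t} = {u, v}")
        case True
        then consider "w = u" "t = v" | "w = v" "t = u" by (auto simp: doubleton_eq_iff)
        then show ?thesis
        proof cases
          case 2
          then show ?thesis using 1 xu' bridge[OF e] avoid_sym by (meson rtranclp_trans)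
        qed (use xu uv in auto)
      next
        case False
        then have "avoid {u, v} w t" using w by (simp add: avoid_def)
        then show ?thesis using 1 by auto
      qed
    next
      case 2
      then show ?thesis using w gd_triangle[OF uv(2) w(1) Suc.prems] gd_edge[OF w(2)] by auto
    qed
  qed
  then have "Suc (gd x u + gd v y) \<le> gd x y"
    using y xu' yv' bridge[OF e] avoid_sym by (meson rtranclp_trans)
  moreover have "gd x y \<le> gd x u + gd u v + gd v y"
    using gd_triangle[OF x uv(1) y] gd_triangle[OF uv y] by simp
  ultimately show ?thesis using gd_edge[OF e] by simp
qed

text \<open>Let \<open>p\<close> and \<open>q\<close> be the neighbours of \<open>w\<close> towards
  \<open>x\<close> and \<open>y\<close>. If \<open>z\<close> is farther from \<open>p\<close> than
  from \<open>w\<close>, every path from \<open>z\<close> to \<open>x\<close> crosses the edge to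
  \<open>p\<close>, and likewise for \<open>q\<close>. If \<open>z\<close> were nearer to both
  neighbours, crossing from \<open>p\<close> through \<open>w\<close> to \<open>q\<close> would
  force different distances from \<open>z\<close> to \<open>p\<close> and \<open>q\<close>.\<close>

lemma gd_through:
  assumes X: "x \<in> V" "y \<in> V" "w \<in> V" "z \<in> V" and w: "gd x y = gd x w + gd w y"
  shows "gd x z = gd x w + gd w z \<or> gd z y = gd z w + gd w y"
proof (cases "w = x \<or> w = y")
  case False
  obtain p where p: "p \<in> V" "{p, w} \<in> E" "gd x w = Suc (gd x p)"
    using gd_predecessor[OF X(1,3)] False by metis
  obtain q where q: "q \<in> V" "{q, w} \<in> E" "gd y w = Suc (gd y q)"
    using gd_predecessor[OF X(2,3)] False by metis
  have e: "{w, p} \<in> E" "{w, q} \<in> E" using p q by (auto simp: insert_commute)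
  have one: "gd p w = 1" "gd w q = 1" using gd_edge p q e by auto
  have sym: "gd y w = gd w y" "gd y q = gd q y" "gd x z = gd z x" "gd x w = gd w x" "gd x p = gd p x" "gd z w = gd w z"
    using gd_commute X p q by auto
  have pq: "gd p q = 2"
  proof -
    have "gd x y \<le> gd x p + gd p q + gd q y"
      using gd_triangle[OF X(1) p(1) X(2)] gd_triangle[OF p(1) q(1) X(2)] by simp
    moreover have "gd p q \<le> gd p w + gd w q" by (rule gd_triangle[OF p(1) X(3) q(1)])
    ultimately show ?thesis using w p q one sym by linarith
  qed
  consider "gd z q = Suc (gd z w)" | "gd z p = Suc (gd z w)"
    | "gd z w = Suc (gd z q)" "gd z w = Suc (gd z p)"
    using gd_edge_cases[OF X(4) e(1)] gd_edge_cases[OF X(4) e(2)] by blast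
  then show ?thesis
  proof cases
    case 1
    then show ?thesis using gd_crossing[OF X(4,2) e(2) 1 q(3)] q sym by linarith
  next
    case 2
    then show ?thesis using gd_crossing[OF X(4,1) e(1) 2 p(3)] p sym by linarith
  next
    case 3
    have "gd p q = Suc (gd p w)" using pq one by simp
    then have "gd p z = Suc (gd p w + gd q z)" using gd_crossing[OF p(1) X(4) e(2) _ 3(1)] by simp
    then show ?thesis using 3 one gd_commute[OF X(4) p(1)] gd_commute[OF X(4) q(1)] by simp
  qed
qed (use X w in auto)

text \<open>Trees are bipartite. This makes the Gromov products integers, so that medians are
  vertices.\<close>

lemma gd_parity:
  assumes b: "b \<in> V" and x: "x \<in> V" and y: "y \<in> V"
  shows "even (gd b x + gd x y + gd b y)"
  using y
proof (induction "gd x y" arbitrary: y)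
  case 0
  then show ?case using gd_eq_0[OF x] x by auto
next
  case (Suc n)
  then have "x \<noteq> y" using x by auto
  then obtain w where w: "w \<in> V" "{w, y} \<in> E" "gd x y = Suc (gd x w)"
    using gd_predecessor[OF x Suc.prems] by blast
  then have "even (gd b x + gd x w + gd b w)" using Suc by auto
  then show ?case using w gd_edge_cases[OF b w(2)] by auto
qed

lemma gd_point_between:
  assumes x: "x \<in> V" and y: "y \<in> V" and "n \<le> gd x y"
  obtains w where "w \<in> V" "gd x w = n" "gd x y = n + gd w y"
proof -
  have "\<exists>w\<in>V. gd x w = n \<and> gd x y = n + gd w y"
    using y assms(3)
  proof (induction "gd x y" arbitrary: y)
    case 0
    then show ?case using x by (intro bexI[of _ y]) auto
  next
    case (Suc m)
    show ?case
    proof (cases "n = gd x y")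
      case True
      then show ?thesis using Suc.prems by (intro bexI[of _ y]) auto
    next
      case False
      have "x \<noteq> y" using Suc x by auto
      then obtain v where v: "v \<in> V" "{v, y} \<in> E" "gd x y = Suc (gd x v)"
        using gd_predecessor[OF x Suc.prems(1)] by blast
      then obtain w where w: "w \<in> V" "gd x w = n" "gd x v = n + gd w v"
        using Suc(1)[of v] Suc(2,4) False by auto
      have "gd w y \<le> gd w v + 1" using gd_triangle[OF w(1) v(1) Suc.prems(1)] gd_edge[OF v(2)] by simp
      moreover have "gd x y \<le> gd x w + gd w y" using gd_triangle[OF x w(1) Suc.prems(1)] .
      ultimately show ?thesis using w v by (intro bexI[of _ w]) auto
    qed
  qed
  then show ?thesis using that by blast
qed

lemma tree_like_rescaled:
  assumes c: "0 < c"
  shows "tree_like V (rescaled_dist c V E)"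
proof (rule tree_like_if_medians)
  fix x y z assume "x \<in> V" "y \<in> V" "z \<in> V"
  then have "real (gd x z) \<le> real (gd x y) + real (gd y z)"
    using gd_triangle[of x y z] by linarith
  then show "rescaled_dist c V E x z \<le> rescaled_dist c V E x y + rescaled_dist c V E y z"
    using mult_left_mono[of "real (gd x z)" "real (gd x y) + real (gd y z)" c] c
    by (simp add: rescaled_dist_def distrib_left)
next
  fix b x y assume X: "b \<in> V" "x \<in> V" "y \<in> V"
  obtain n where n: "gd b x + gd x y = gd b y + 2 * n"
  proof -
    have "gd b y \<le> gd b x + gd x y" by (rule gd_triangle[OF X])
    moreover have "even (gd b x + gd x y - gd b y)"
      using gd_parity[OF X] calculation by simp
    ultimately show ?thesis using that[of "(gd b x + gd x y - gd b y) div 2"] by auto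
  qed
  have "gd b x \<le> gd b y + gd x y" using gd_triangle[OF X(1,3,2)] gd_commute[OF X(2,3)] by simp
  then have "n \<le> gd x y" using n by linarith
  then obtain w where w: "w \<in> V" "gd x w = n" "gd x y = n + gd w y"
    using gd_point_between[OF X(2,3)] by blast
  show "\<exists>w\<in>V. rescaled_dist c V E x w =
        (rescaled_dist c V E b x + rescaled_dist c V E x y - rescaled_dist c V E b y) / 2 \<and>
      (\<forall>z\<in>V. rescaled_dist c V E x z = rescaled_dist c V E x w + rescaled_dist c V E w z \<or>
        rescaled_dist c V E z y = rescaled_dist c V E z w + rescaled_dist c V E w y)"
  proof (intro bexI[of _ w] conjI ballI)
    have "real (gd b x) + real (gd x y) - real (gd b y) = 2 * real n"
      using arg_cong[OF n, of real] by simp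
    then have "c * (real (gd b x) + real (gd x y) - real (gd b y)) = 2 * (c * real n)" by simp
    then show "rescaled_dist c V E x w =
        (rescaled_dist c V E b x + rescaled_dist c V E x y - rescaled_dist c V E b y) / 2"
      using w by (simp add: rescaled_dist_def algebra_simps)
    fix z assume "z \<in> V"
    then have "gd x z = gd x w + gd w z \<or> gd z y = gd z w + gd w y"
      using gd_through[OF X(2,3) w(1), of z] w by auto
    then show "rescaled_dist c V E x z = rescaled_dist c V E x w + rescaled_dist c V E w z \<or>
        rescaled_dist c V E z y = rescaled_dist c V E z w + rescaled_dist c V E w y"
      by (auto simp: rescaled_dist_def distrib_left)
  qed (rule w)
qed (auto simp: rescaled_dist_def gd_commute)

end

section \<open>Tree-like probability spaces\<close>

text \<open>The common form of all three cases. \<open>a\<close> is the second coordinate in a long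
  dendron and 0 otherwise. \<open>\<rho>\<close> is only a pseudometric, as it ignores that
  coordinate; hence separability is stated through a countable dense set, and measurability in one
  variable at a time.\<close>

definition tree_space :: "'a measure \<Rightarrow> ('a \<Rightarrow> 'a \<Rightarrow> real) \<Rightarrow> ('a \<Rightarrow> real) \<Rightarrow> bool" where
  "tree_space M \<rho> a \<longleftrightarrow>
     prob_space M \<and> tree_like (space M) \<rho> \<and> (\<forall>y\<in>space M. (\<lambda>x. \<rho> x y) \<in> borel_measurable M) \<and>
     a \<in> borel_measurable M \<and> (\<forall>x\<in>space M. 0 \<le> a x) \<and>
     (\<exists>Q. countable Q \<and> Q \<subseteq> space M \<and> (\<forall>x\<in>space M. \<forall>e>0. \<exists>q\<in>Q. \<rho> x q < e))"

lemma tree_like_nonneg: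
  assumes "tree_like X \<rho>" "x \<in> X" "y \<in> X" shows "0 \<le> \<rho> x y"
proof -
  have "\<rho> x x \<le> \<rho> x y + \<rho> y x" "\<rho> x y = \<rho> y x" "\<rho> x x = 0"
    using assms unfolding tree_like_def by blast+
  then show ?thesis by simp
qed

text \<open>By density \<open>\<rho> x y\<close> is the infimum of
  \<open>\<rho> x q + \<rho> y q\<close> over countably many \<open>q\<close>, which gives joint
  measurability.\<close>

lemma tree_space_measurable:
  assumes "tree_space M \<rho> a"
  shows "(\<lambda>(x, y). \<rho> x y) \<in> borel_measurable (M \<Otimes>\<^sub>M M)"
    and "(\<lambda>(x, y). \<rho> x y + a x + a y) \<in> borel_measurable (M \<Otimes>\<^sub>M M)"
proof -
  interpret M: prob_space M using assms by (simp add: tree_space_def)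
  obtain Q where Q: "countable Q" "Q \<subseteq> space M" "\<And>x e. x \<in> space M \<Longrightarrow> 0 < e \<Longrightarrow> \<exists>q\<in>Q. \<rho> x q < e"
    using assms unfolding tree_space_def by blast
  have t: "tree_like (space M) \<rho>" using assms by (simp add: tree_space_def)
  have meas: "(\<lambda>x. \<rho> x q) \<in> borel_measurable M" if "q \<in> Q" for q
    using assms that Q(2) unfolding tree_space_def by blast
  have tri: "\<rho> x z \<le> \<rho> x y + \<rho> y z" and sym: "\<rho> x y = \<rho> y x" if "x \<in> space M" "y \<in> space M" "z \<in> space M" for x y z
    using t that unfolding tree_like_def by blast+
  have "\<exists>x. x \<in> space M" using M.not_empty by blast
  then have "Q \<noteq> {}" using Q(3)[of _ 1] by force
  have eq: "\<rho> x y = (INF q\<in>Q. \<rho> x q + \<rho> y q)" if xy: "x \<in> space M" "y \<in> space M" for x y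
  proof (rule antisym)
    show "\<rho> x y \<le> (INF q\<in>Q. \<rho> x q + \<rho> y q)"
      using tri[of x _ y] sym[of y _ x] xy Q(2) \<open>Q \<noteq> {}\<close> by (intro cINF_greatest) (metis subsetD)+
    have bdd: "bdd_below ((\<lambda>q. \<rho> x q + \<rho> y q) ` Q)"
      using tree_like_nonneg[OF t] xy Q(2) by (intro bdd_belowI2[of _ 0]) (auto intro!: add_nonneg_nonneg)
    show "(INF q\<in>Q. \<rho> x q + \<rho> y q) \<le> \<rho> x y"
    proof (rule field_le_epsilon)
      fix e :: real assume "0 < e"
      then obtain q where q: "q \<in> Q" "\<rho> x q < e / 2" using Q(3)[OF xy(1), of "e / 2"] by auto
      then have "q \<in> space M" using Q(2) by blast
      have "(INF q\<in>Q. \<rho> x q + \<rho> y q) \<le> \<rho> x q + \<rho> y q" by (rule cINF_lower[OF bdd q(1)])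
      also have "\<dots> \<le> \<rho> x y + e"
        using tri[OF xy(2,1) \<open>q \<in> space M\<close>] sym[OF xy(2,1) xy(1)] q by linarith
      finally show "(INF q\<in>Q. \<rho> x q + \<rho> y q) \<le> \<rho> x y + e" .
    qed
  qed
  have "(\<lambda>z. INF q\<in>Q. \<rho> (fst z) q + \<rho> (snd z) q) \<in> borel_measurable (M \<Otimes>\<^sub>M M)"
  proof (rule borel_measurable_cINF[OF Q(1)])
    fix q assume "q \<in> Q"
    then show "(\<lambda>z. \<rho> (fst z) q + \<rho> (snd z) q) \<in> borel_measurable (M \<Otimes>\<^sub>M M)"
      using measurable_compose[OF measurable_fst meas] measurable_compose[OF measurable_snd meas]
      by (intro borel_measurable_add) auto
  next
    fix z assume "z \<in> space (M \<Otimes>\<^sub>M M)"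
    then show "bdd_below ((\<lambda>q. \<rho> (fst z) q + \<rho> (snd z) q) ` Q)"
      using tree_like_nonneg[OF t] Q(2)
      by (intro bdd_belowI2[of _ 0]) (auto simp: space_pair_measure intro!: add_nonneg_nonneg)
  qed
  then show 1: "(\<lambda>(x, y). \<rho> x y) \<in> borel_measurable (M \<Otimes>\<^sub>M M)"
    by (rule measurable_cong[THEN iffD1, rotated]) (auto simp: space_pair_measure eq)
  have [measurable]: "a \<in> borel_measurable M" using assms by (simp add: tree_space_def)
  show "(\<lambda>(x, y). \<rho> x y + a x + a y) \<in> borel_measurable (M \<Otimes>\<^sub>M M)"
    using 1 unfolding case_prod_beta by measurable
qed

lemma continuous_map_mdist_right:
  assumes "y \<in> mspace T"
  shows "continuous_map (mtopology_of T) euclideanreal (\<lambda>x. mdist T x y)"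
  using assms by (intro continuous_map_mdist continuous_map_id[unfolded id_def]) simp_all

lemma tree_space_long_dendron:
  assumes "long_dendron T \<nu>"
  shows "tree_space \<nu> (\<lambda>p q. mdist T (fst p) (fst q)) snd"
proof -
  let ?X = "prod_topology (mtopology_of T) (top_of_set {0::real..})"
  have T: "real_tree T" and "prob_space \<nu>" and sets: "sets \<nu> = sets (borel_of ?X)"
    using assms by (auto simp: long_dendron_def borel_prob_measures_def)
  have space: "space \<nu> = mspace T \<times> {0..}" using sets_eq_imp_space_eq[OF sets] by simp
  obtain Q where Q: "countable Q" "Q \<subseteq> mspace T" "\<And>x e. x \<in> mspace T \<Longrightarrow> 0 < e \<Longrightarrow> \<exists>q\<in>Q. mdist T x q < e"
    using long_dendron_separable[OF assms] by metis
  have like: "tree_like (mspace T) (mdist T)" by (rule tree_like_real_tree[OF T])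
  have "tree_like (space \<nu>) (\<lambda>p q. mdist T (fst p) (fst q))"
    unfolding space tree_like_def gromov_product_def
    using like[unfolded tree_like_def gromov_product_def] by (auto simp: mem_Times_iff)
  moreover have "(\<lambda>p. mdist T (fst p) (fst q)) \<in> borel_measurable \<nu>" if "q \<in> space \<nu>" for q
  proof -
    have "fst q \<in> mspace T" using that by (auto simp: space)
    then have "continuous_map ?X euclideanreal (\<lambda>p. mdist T (fst p) (fst q))"
      using continuous_map_compose[OF continuous_map_fst continuous_map_mdist_right, of "fst q" T] by (simp add: o_def)
    then show ?thesis by (rule measurable_continuous_map_borel_of[OF _ sets])
  qed
  moreover have "snd \<in> borel_measurable \<nu>"
  proof (rule measurable_continuous_map_borel_of[OF _ sets])
    show "continuous_map ?X euclideanreal snd"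
      using continuous_map_snd continuous_map_into_fulltopology by blast
  qed
  moreover have "\<exists>Q. countable Q \<and> Q \<subseteq> space \<nu> \<and> (\<forall>x\<in>space \<nu>. \<forall>e>0. \<exists>q\<in>Q. mdist T (fst x) (fst q) < e)"
    \<comment> \<open>The distance ignores the second coordinate, so any fixed value of it yields a
      dense set.\<close>
    using Q by (intro exI[of _ "Q \<times> {0}"]) (fastforce simp: space)
  ultimately show ?thesis using \<open>prob_space \<nu>\<close> unfolding tree_space_def by (auto simp: space)
qed

lemma tree_space_measured_real_tree:
  assumes "measured_real_tree T \<mu>"
  shows "tree_space \<mu> (mdist T) (\<lambda>_. 0)"
proof -
  interpret M: Metric_space "mspace T" "mdist T" by simp
  have T: "real_tree T" and "prob_space \<mu>" and sets: "sets \<mu> = sets (borel_of (mtopology_of T))"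
    and sep: "separable_space (mtopology_of T)"
    using assms by (auto simp: measured_real_tree_def borel_prob_measures_def)
  have space: "space \<mu> = mspace T" using sets_eq_imp_space_eq[OF sets] by simp
  obtain Q where Q: "countable Q" "Q \<subseteq> mspace T" "mtopology_of T closure_of Q = mspace T"
    using sep unfolding separable_space_def by auto
  have "\<exists>q\<in>Q. mdist T x q < e" if "x \<in> mspace T" "0 < e" for x e
  proof -
    have "x \<in> M.mtopology closure_of Q" using Q(3) that by (simp add: mtopology_of_def)
    then show ?thesis using that by (auto simp: M.metric_closure_of)
  qed
  moreover have "(\<lambda>x. mdist T x y) \<in> borel_measurable \<mu>" if "y \<in> space \<mu>" for y
    using that by (intro measurable_continuous_map_borel_of[OF continuous_map_mdist_right sets]) (simp add: space)
  ultimately show ?thesis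
    unfolding tree_space_def space
    using \<open>prob_space \<mu>\<close> tree_like_real_tree[OF T] Q by auto
qed

lemma tree_space_finite_tree:
  assumes c: "0 < c" and t: "finite_tree V E"
  shows "tree_space (uniform_count_measure V) (rescaled_dist c V E) (\<lambda>_. 0)"
proof -
  have V: "finite V" "V \<noteq> {}" using t by (auto simp: finite_tree_def finite_simple_graph_def)
  interpret finite_tree_graph V E by (rule finite_tree_graph.intro) (rule t)
  have "tree_like V (rescaled_dist c V E)" by (rule tree_like_rescaled[OF c])
  moreover have "f \<in> borel_measurable (uniform_count_measure V)" for f :: "'a \<Rightarrow> real"
    by (rule measurableI) (auto simp: sets_uniform_count_measure space_uniform_count_measure)
  moreover have "\<exists>q\<in>V. rescaled_dist c V E x q < e" if "x \<in> V" "0 < e" for x e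
    using that by (intro bexI[of _ x]) (auto simp: rescaled_dist_def)
  ultimately show ?thesis
    unfolding tree_space_def using prob_space_uniform_count_measure[OF V] V
    by (auto simp: space_uniform_count_measure countable_finite intro!: exI[of _ V])
qed

section \<open>The limit dendron\<close>

text \<open>By separability every open set is a countable union of cells, each a ball around a dense
  point times a rational interval, and preimages of cells are measurable because
  \<open>tdist\<close> is a combination of countable suprema of coordinates.\<close>

lemma (in tree_kernel) measurable_into_tree_borel:
  fixes M :: "'w measure" and A :: "'w \<Rightarrow> real"
  assumes X: "\<And>w. w \<in> space M \<Longrightarrow> X w \<in> points" and A: "\<And>w. w \<in> space M \<Longrightarrow> 0 \<le> A w"
    and Xm: "\<And>i. (\<lambda>w. X w i) \<in> borel_measurable M" and Am: "A \<in> borel_measurable M"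
  shows "(\<lambda>w. (X w, A w)) \<in> measurable M (borel_of (prod_topology (mtopology_of tree) (top_of_set {0..})))"
proof -
  obtain D where D: "countable D" "D \<subseteq> points" "\<And>p e. p \<in> points \<Longrightarrow> 0 < e \<Longrightarrow> \<exists>q\<in>D. tdist p q < e"
    using separable_tree by blast
  have meet_meas: "(\<lambda>w. meet (X w) (q w)) \<in> borel_measurable M"
    if "\<And>i. (\<lambda>w. q w i) \<in> borel_measurable M" for q
    unfolding meet_def using Xm that by (intro borel_measurable_cSUP bdd_meet X) auto
  have tdist_meas [measurable]: "(\<lambda>w. tdist (X w) q) \<in> borel_measurable M" for q
    unfolding tdist_def using meet_meas[of X] meet_meas[of "\<lambda>_. q"] Xm by simp
  define cell where "cell = (\<lambda>(q, u, e). {p \<in> points. tdist p q < e} \<times> ({0..} \<inter> {t. \<bar>t - u\<bar> < (e::real)}))"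
  show ?thesis
  proof (rule measurable_borel_ofI)
    show "(X w, A w) \<in> topspace (prod_topology (mtopology_of tree) (top_of_set {0..}))" if "w \<in> space M" for w
      using X[OF that] A[OF that] by simp
    fix U assume U: "openin (prod_topology (mtopology_of tree) (top_of_set {0::real..})) U"
    define I where "I = {i \<in> D \<times> \<rat> \<times> \<rat>. cell i \<subseteq> U}"
    have "countable (D \<times> (\<rat> :: real set) \<times> (\<rat> :: real set))" by (intro countable_SIGMA D(1) countable_rat)
    then have I: "countable I" by (rule countable_subset[rotated]) (auto simp: I_def)
    have "\<exists>i\<in>I. (p, t) \<in> cell i" if pt: "(p, t) \<in> U" for p t
    proof -
      obtain V V' where V: "openin (mtopology_of tree) V" "openin (top_of_set {0..}) V'" "p \<in> V" "t \<in> V'" "V \<times> V' \<subseteq> U"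
        using U[unfolded openin_prod_topology_alt, rule_format, OF pt] by (elim exE conjE)
      obtain d where d: "0 < d" "\<And>q. q \<in> points \<Longrightarrow> tdist p q < d \<Longrightarrow> q \<in> V" and p: "p \<in> points"
        using V(1,3) unfolding openin_tree by blast
      obtain d' where d': "0 < d'" "\<And>u. 0 \<le> u \<Longrightarrow> \<bar>u - t\<bar> < d' \<Longrightarrow> u \<in> V'" and t: "0 \<le> t"
        using V(2,4) unfolding openin_euclidean_subtopology_iff by (force simp: dist_real_def)
      obtain e where e: "e \<in> \<rat>" "0 < e" "e < min d d' / 2"
        using Rats_dense_in_real[of 0 "min d d' / 2"] d d' by auto
      obtain q where q: "q \<in> D" "tdist p q < e" using D(3)[OF p e(2)] by blast
      obtain u where u: "u \<in> \<rat>" "t < u" "u < t + e" using Rats_dense_in_real[of t "t + e"] e by auto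
      have "cell (q, u, e) \<subseteq> V \<times> V'"
      proof -
        have "p' \<in> V" if "p' \<in> points" "tdist p' q < e" for p'
        proof (rule d(2)[OF that(1)])
          have "tdist p p' \<le> tdist p q + tdist q p'" using tdist_triangle[OF p _ that(1), of q] q D(2) by blast
          then show "tdist p p' < d" using q that e tdist_commute[of q p'] by linarith
        qed
        moreover have "t' \<in> V'" if "0 \<le> t'" "\<bar>t' - u\<bar> < e" for t'
          by (rule d'(2)[OF that(1)]) (use that u e in linarith)
        ultimately show ?thesis by (auto simp: cell_def)
      qed
      then have "(q, u, e) \<in> I" using q u e V(5) by (auto simp: I_def)
      moreover have "(p, t) \<in> cell (q, u, e)" using p q u t by (auto simp: cell_def)
      ultimately show ?thesis by blast
    qed
    then have "U = (\<Union>i\<in>I. cell i)" by (auto simp: I_def)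
    then have "(\<lambda>w. (X w, A w)) -` U \<inter> space M = (\<Union>i\<in>I. {w \<in> space M. (X w, A w) \<in> cell i})" by auto
    moreover have "{w \<in> space M. (X w, A w) \<in> cell i} \<in> sets M" for i
    proof -
      obtain q u e where i: "i = (q, u, e)" by (cases i)
      have "{w \<in> space M. (X w, A w) \<in> cell i} = {w \<in> space M. tdist (X w) q < e \<and> \<bar>A w - u\<bar> < e}"
        using X A by (auto simp: cell_def i)
      also have "\<dots> \<in> sets M" using Am by measurable
      finally show ?thesis .
    qed
    ultimately show "(\<lambda>w. (X w, A w)) -` U \<inter> space M \<in> sets M" using I by auto
  qed
qed

text \<open>A sample with position \<open>s\<close> goes to the point whose coordinate
  \<open>i\<close> is the kernel, reduced by \<open>m\<close>, of the smallest interval containing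
  both \<open>s\<close> and the label \<open>[a i, b i]\<close>. Meets of such points reproduce
  \<open>g\<close> up to \<open>m\<close>, and \<open>m\<close> cancels in the distances. Taking
  \<open>D\<close> as the pullback of the dendron distance makes it measurable and turns equality of
  the laws into an instance of \<open>tau_distr\<close>.\<close>

lemma limit_dendron:
  fixes \<Omega> :: "'w measure" and S H :: "'w \<Rightarrow> real"
  assumes "prob_space \<Omega>" and S[measurable]: "S \<in> borel_measurable \<Omega>" and H[measurable]: "H \<in> borel_measurable \<Omega>"
    and dS: "distr \<Omega> borel S = unif"
    and mid: "\<And>s t u. 0 < s \<Longrightarrow> s < t \<Longrightarrow> t < u \<Longrightarrow> u < 1 \<Longrightarrow> g s u = min (g s t) (g t u)"
    and nonneg: "\<And>s t. 0 < s \<Longrightarrow> s < t \<Longrightarrow> t < 1 \<Longrightarrow> 0 \<le> g s t"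
    and aeH: "AE w in \<Omega>. \<forall>t. 0 < t \<longrightarrow> t < 1 \<longrightarrow> (S w < t \<longrightarrow> g (S w) t \<le> H w) \<and> (t < S w \<longrightarrow> g t (S w) \<le> H w)"
  obtains T :: "(nat \<Rightarrow> real) metric" and \<nu> and D where
    "long_dendron T \<nu>" "(\<lambda>(x, y). D x y) \<in> borel_measurable (\<Omega> \<Otimes>\<^sub>M \<Omega>)"
    "AE z in \<Omega> \<Otimes>\<^sub>M \<Omega>. D (fst z) (snd z) = H (fst z) + H (snd z) -
        2 * g (min (S (fst z)) (S (snd z))) (max (S (fst z)) (S (snd z)))"
    "\<And>r. tau r (dendron_dist T) \<nu> = tau r D \<Omega>"
proof -
  interpret \<Omega>: prob_space \<Omega> by fact
  interpret \<Omega>\<Omega>: pair_prob_space \<Omega> \<Omega> ..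
  have g_mono: "g s t \<le> g s' t'" if "0 < s" "s \<le> s'" "s' < t'" "t' \<le> t" "t < 1" for s s' t t'
  proof -
    have "g s t \<le> g s' t" using mid[of s s' t] that by (cases "s = s'") auto
    also have "\<dots> \<le> g s' t'" using mid[of s' t' t] that by (cases "t = t'") auto
    finally show ?thesis .
  qed
  \<comment> \<open>The ultrametric property of the kernel in terms of intervals: the union of two
    intervals that meet inherits the smaller value.\<close>
  have g_union: "min (g s t) (g s' t') \<le> g (min s s') (max t t')"
    if st: "0 < s" "s < t" "t < 1" "0 < s'" "s' < t'" "t' < 1" and meet: "s' \<le> t" "s \<le> t'" for s t s' t'
  proof -
    consider "s \<le> s'" "t' \<le> t" | "s' \<le> s" "t \<le> t'" | "s < s'" "t < t'" | "s' < s" "t' < t" by linarith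
    then show ?thesis
    proof cases
      case 3
      then show ?thesis using mid[of s t t'] g_mono[of s' t t' t'] st meet by (auto simp: min_def max_def)
    next
      case 4
      then show ?thesis using mid[of s' t' t] g_mono[of s t' t t] st meet by (auto simp: min_def max_def)
    qed (auto simp: min_def max_def)
  qed
  define L where "L = {(q, q'). q \<in> \<rat> \<and> q' \<in> \<rat> \<and> 0 < q \<and> q < q' \<and> q' < (1::real)}"
  have "countable (\<rat> \<times> \<rat> :: (real \<times> real) set)" by (intro countable_SIGMA countable_rat)
  then have "countable L" by (rule countable_subset[rotated]) (auto simp: L_def)
  have rat_between: "\<exists>q\<in>\<rat>. x < q \<and> q < y" if "x < y" for x y :: real
    using Rats_dense_in_real[OF that] by blast
  have "L \<noteq> {}"
  proof -
    obtain q :: real where "q \<in> \<rat>" "0 < q" "q < 1" using rat_between[of 0 1] by auto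
    moreover obtain q' :: real where "q' \<in> \<rat>" "q < q'" "q' < 1" using rat_between[of q 1] calculation by auto
    ultimately show ?thesis by (auto simp: L_def)
  qed
  define a where "a i = fst (from_nat_into L i)" for i
  define b where "b i = snd (from_nat_into L i)" for i
  have ab: "0 < a i" "a i < b i" "b i < 1" for i
    using from_nat_into[OF \<open>L \<noteq> {}\<close>, of i] by (auto simp: a_def b_def L_def)
  have label: "\<exists>i. s < a i \<and> b i < t" if st: "0 \<le> s" "s < t" "t \<le> 1" for s t
  proof -
    obtain q where q: "q \<in> \<rat>" "s < q" "q < t" using rat_between[OF st(2)] by blast
    obtain q' where q': "q' \<in> \<rat>" "q < q'" "q' < t" using rat_between[OF q(3)] by blast
    have "(q, q') \<in> L" using q q' st by (auto simp: L_def)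
    then obtain i where "from_nat_into L i = (q, q')"
      using range_from_nat_into[OF \<open>L \<noteq> {}\<close> \<open>countable L\<close>] by (metis imageE)
    then show ?thesis using q q' by (intro exI[of _ i]) (auto simp: a_def b_def)
  qed
  have label_outer: "\<exists>i. a i < s \<and> t < b i" if st: "0 < s" "s < t" "t < 1" for s t
  proof -
    obtain q where q: "q \<in> \<rat>" "0 < q" "q < s" using rat_between[OF st(1)] by blast
    obtain q' where q': "q' \<in> \<rat>" "t < q'" "q' < 1" using rat_between[OF st(3)] by blast
    have "(q, q') \<in> L" using q q' st by (auto simp: L_def)
    then obtain i where "from_nat_into L i = (q, q')"
      using range_from_nat_into[OF \<open>L \<noteq> {}\<close> \<open>countable L\<close>] by (metis imageE)
    then show ?thesis using q q' by (intro exI[of _ i]) (auto simp: a_def b_def)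
  qed
  define m where "m = (INF i. g (a i) (b i))"
  have bdd: "bdd_below (range (\<lambda>i. g (a i) (b i)))"
    using nonneg ab by (intro bdd_belowI2[of _ 0]) auto
  have m_le: "m \<le> g s t" if st: "0 < s" "s < t" "t < 1" for s t
  proof -
    obtain i where i: "a i < s" "t < b i" using label_outer[OF st] by blast
    have "m \<le> g (a i) (b i)" unfolding m_def by (rule cINF_lower[OF bdd]) simp
    also have "\<dots> \<le> g s t" by (rule g_mono) (use i ab[of i] st in auto)
    finally show ?thesis .
  qed
  have m_approx: "\<exists>i. g (a i) (b i) < m + e" if "0 < e" for e
    using cINF_less_iff[OF _ bdd, of "m + e"] that by (auto simp: m_def)
  \<comment> \<open>Labels are rational intervals rather than rational points, so that the diagonal of \<open>G\<close> is finite;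
    subtracting \<open>m\<close> removes the trunk below the first branch point, which carries no mass.\<close>
  define G where "G i j = g (min (a i) (a j)) (max (b i) (b j)) - m" for i j
  interpret tree_kernel G
  proof
    fix i j k
    show "0 \<le> G i j" unfolding G_def using m_le[of "min (a i) (a j)" "max (b i) (b j)"] ab[of i] ab[of j] by auto
    show "G i j = G j i" by (simp add: G_def min.commute max.commute)
    have "min (g (min (a i) (a j)) (max (b i) (b j))) (g (min (a j) (a k)) (max (b j) (b k)))
      \<le> g (min (min (a i) (a j)) (min (a j) (a k))) (max (max (b i) (b j)) (max (b j) (b k)))"
      by (rule g_union) (use ab[of i] ab[of j] ab[of k] in \<open>auto simp: min_def max_def\<close>)
    also have "\<dots> \<le> g (min (a i) (a k)) (max (b i) (b k))"
      by (rule g_mono) (use ab[of i] ab[of j] ab[of k] in \<open>auto simp: min_def max_def\<close>)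
    finally show "min (G i j) (G j k) \<le> G i k" by (simp add: G_def flip: min_diff_distrib_left)
  qed
  define lo where "lo i s = min s (a i)" for i s
  define hi where "hi i s = max s (b i)" for i s
  have lohi: "0 < lo i s" "lo i s < hi i s" "hi i s < 1" "lo i s \<le> s" "s \<le> hi i s" "lo i s \<le> a i" "b i \<le> hi i s"
    if "0 < s" "s < 1" for i s
    using ab[of i] that by (auto simp: lo_def hi_def)
  \<comment> \<open>\<open>g\<close> is controlled only for \<open>0 < s < t < 1\<close>, and as a
    function of \<open>s\<close> the kernel of the hull is not monotone. It is written as the
    minimum of an increasing and a decreasing function, each extended by 0 where \<open>g\<close> is
    not controlled, so that it is Borel.\<close>
  define \<Phi> where "\<Phi> i s = min (if s \<le> 0 then 0 else if s < a i then g s (b i) else g (a i) (b i))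
    (if 1 \<le> s then 0 else if b i < s then g (a i) s else g (a i) (b i))" for i s
  have \<Phi>m[measurable]: "\<Phi> i \<in> borel_measurable borel" for i
  proof -
    let ?h1 = "\<lambda>s. if s \<le> 0 then 0 else if s < a i then g s (b i) else g (a i) (b i)"
    let ?h2 = "\<lambda>s. if 1 \<le> s then 0 else if b i < s then g (a i) s else g (a i) (b i)"
    have "mono ?h1"
      using ab[of i] nonneg by (auto simp: mono_def intro!: g_mono)
    then have 1: "?h1 \<in> borel_measurable borel" by (rule borel_measurable_mono)
    have "mono (\<lambda>s. - ?h2 s)"
      using ab[of i] nonneg by (auto simp: mono_def intro!: g_mono)
    then have "(\<lambda>s. - ?h2 s) \<in> borel_measurable borel" by (rule borel_measurable_mono)
    then have "?h2 \<in> borel_measurable borel" by (simp only: borel_measurable_uminus_eq)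
    with 1 show ?thesis unfolding \<Phi>_def[abs_def] by (intro borel_measurable_min)
  qed
  have \<Phi>: "\<Phi> i s = g (lo i s) (hi i s)" if "0 < s" "s < 1" for i s
  proof -
    have "g s (b i) \<le> g (a i) (b i)" if "s < a i" using ab[of i] \<open>0 < s\<close> that by (intro g_mono) auto
    moreover have "g (a i) s \<le> g (a i) (b i)" if "b i < s" using ab[of i] \<open>s < 1\<close> that by (intro g_mono) auto
    ultimately show ?thesis
      using that ab[of i] by (auto simp: \<Phi>_def lo_def hi_def min_def max_def)
  qed
  \<comment> \<open>Outside this almost sure event samples are sent to the root with excess 0, so
    that \<open>X\<close> and \<open>A\<close> take admissible values everywhere.\<close>
  define good where "good w \<longleftrightarrow> 0 < S w \<and> S w < 1 \<and> (\<forall>i. \<Phi> i (S w) \<le> H w)" for w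
  have good_meas[measurable]: "Measurable.pred \<Omega> good" unfolding good_def by measurable
  have aeS: "AE w in \<Omega>. 0 < S w \<and> S w < 1 \<and> S w \<notin> C" if "countable C" for C
  proof -
    have "AE s in distr \<Omega> borel S. 0 < s \<and> s < 1 \<and> s \<notin> C" unfolding dS by (rule AE_unif[OF that])
    from AE_distrD[OF S this] show ?thesis .
  qed
  have ae_good: "AE w in \<Omega>. good w"
    using aeH aeS[OF countable_empty]
  proof eventually_elim
    case (elim w)
    then have s: "0 < S w" "S w < 1" by auto
    have "\<Phi> i (S w) \<le> H w" for i
    proof (cases "S w < b i")
      case True
      have "\<Phi> i (S w) \<le> g (S w) (b i)"
        unfolding \<Phi>[OF s] by (rule g_mono) (use lohi[OF s, of i] True in auto)
      also have "\<dots> \<le> H w" using elim True ab[of i] by auto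
      finally show ?thesis .
    next
      case False
      then have "a i < S w" using ab[of i] by linarith
      have "\<Phi> i (S w) \<le> g (a i) (S w)"
        unfolding \<Phi>[OF s] by (rule g_mono) (use lohi[OF s, of i] \<open>a i < S w\<close> in auto)
      also have "\<dots> \<le> H w" using elim \<open>a i < S w\<close> ab[of i] by auto
      finally show ?thesis .
    qed
    then show ?case using s by (simp add: good_def)
  qed
  define X where "X w = (\<lambda>i. if good w then \<Phi> i (S w) - m else 0)" for w
  have Xgood: "X w i = g (lo i (S w)) (hi i (S w)) - m" if "good w" for w i
    using that \<Phi>[of "S w" i] by (auto simp: X_def good_def)
  have X_point: "X w \<in> points" for w
  proof (cases "good w")
    case True
    then have s: "0 < S w" "S w < 1" by (auto simp: good_def)
    show ?thesis
      unfolding points_def mem_Collect_eq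
    proof (intro conjI allI)
      fix i j
      show "0 \<le> X w i" using m_le lohi[OF s] by (simp add: Xgood[OF True])
      show "bdd_above (range (X w))"
        using True by (intro bdd_aboveI2[of _ _ "H w - m"]) (auto simp: X_def good_def)
      have "min (g (lo i (S w)) (hi i (S w))) (g (lo j (S w)) (hi j (S w)))
          \<le> g (min (lo i (S w)) (lo j (S w))) (max (hi i (S w)) (hi j (S w)))"
        by (rule g_union) (use lohi[OF s, of i] lohi[OF s, of j] in auto)
      also have "\<dots> \<le> g (min (a i) (a j)) (max (b i) (b j))"
        by (rule g_mono) (use lohi[OF s, of i] lohi[OF s, of j] ab[of i] ab[of j] in \<open>auto simp: min_def max_def\<close>)
      finally show "min (X w i) (X w j) \<le> G i j" by (simp add: Xgood[OF True] G_def flip: min_diff_distrib_left)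
      have "min (g (lo i (S w)) (hi i (S w))) (g (min (a i) (a j)) (max (b i) (b j)))
          \<le> g (min (lo i (S w)) (min (a i) (a j))) (max (hi i (S w)) (max (b i) (b j)))"
        by (rule g_union) (use lohi[OF s, of i] ab[of i] ab[of j] in \<open>auto simp: min_def max_def\<close>)
      also have "\<dots> \<le> g (lo j (S w)) (hi j (S w))"
        by (rule g_mono) (use lohi[OF s, of i] lohi[OF s, of j] ab[of i] ab[of j] in
          \<open>auto simp: lo_def hi_def min_def max_def\<close>)
      finally show "min (X w i) (G i j) \<le> X w j" by (simp add: Xgood[OF True] G_def flip: min_diff_distrib_left)
    qed
  next
    case False
    then have "X w = (\<lambda>_. 0)" by (simp add: X_def)
    then show ?thesis using root_point by simp
  qed
  have meet_less: "meet (X x) (X y) = g (S x) (S y) - m" if xy: "good x" "good y" "S x < S y" for x y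
  proof -
    have s: "0 < S x" "S x < 1" "0 < S y" "S y < 1" using xy by (auto simp: good_def)
    show ?thesis
    proof (rule antisym)
      show "meet (X x) (X y) \<le> g (S x) (S y) - m"
      proof (rule meet_leI)
        fix i
        have "min (g (lo i (S x)) (hi i (S x))) (g (lo i (S y)) (hi i (S y)))
          \<le> g (min (lo i (S x)) (lo i (S y))) (max (hi i (S x)) (hi i (S y)))"
          by (rule g_union) (use lohi[OF s(1,2), of i] lohi[OF s(3,4), of i] ab[of i] in auto)
        also have "\<dots> \<le> g (S x) (S y)"
          by (rule g_mono) (use lohi[OF s(1,2), of i] lohi[OF s(3,4), of i] xy(3) in auto)
        finally show "min (X x i) (X y i) \<le> g (S x) (S y) - m" by (simp add: Xgood xy flip: min_diff_distrib_left)
      qed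
      \<comment> \<open>A label strictly between the two positions attains the supremum, since both
        hulls then stay inside \<open>[S x, S y]\<close>.\<close>
      obtain i where i: "S x < a i" "b i < S y" using label[of "S x" "S y"] s xy(3) by auto
      have "g (S x) (S y) \<le> g (lo i (S x)) (hi i (S x))" "g (S x) (S y) \<le> g (lo i (S y)) (hi i (S y))"
        by (rule g_mono; use i s ab[of i] in \<open>simp add: lo_def hi_def\<close>)+
      then have "g (S x) (S y) - m \<le> min (X x i) (X y i)" by (simp add: Xgood xy)
      also have "\<dots> \<le> meet (X x) (X y)" by (rule meet_ge[OF X_point])
      finally show "g (S x) (S y) - m \<le> meet (X x) (X y)" .
    qed
  qed
  have meet_X: "meet (X x) (X y) = g (min (S x) (S y)) (max (S x) (S y)) - m" if "good x" "good y" "S x \<noteq> S y" for x y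
    using meet_less[of x y] meet_less[of y x] that meet_commute[of "X x"] by (cases "S x < S y") auto
  define A where "A w = (if good w then H w - m - meet (X w) (X w) else 0)" for w
  have A0: "0 \<le> A w" for w
  proof (cases "good w")
    case True
    have "meet (X w) (X w) \<le> H w - m"
      by (rule meet_leI) (use True in \<open>auto simp: X_def good_def\<close>)
    then show ?thesis using True by (simp add: A_def)
  qed (simp add: A_def)
  have Xm[measurable]: "(\<lambda>w. X w i) \<in> borel_measurable \<Omega>" for i
    unfolding X_def by measurable
  have "(\<lambda>w. meet (X w) (X w)) \<in> borel_measurable \<Omega>"
    unfolding meet_def using Xm by (intro borel_measurable_cSUP bdd_meet X_point) auto
  then have Am[measurable]: "A \<in> borel_measurable \<Omega>"
    unfolding A_def by measurable
  define Z where "Z w = (X w, A w)" for w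
  define N where "N = borel_of (prod_topology (mtopology_of tree) (top_of_set {0::real..}))"
  have Z: "Z \<in> measurable \<Omega> N"
    unfolding Z_def N_def by (rule measurable_into_tree_borel) (auto simp: X_point A0)
  define \<nu> where "\<nu> = distr \<Omega> N Z"
  \<comment> \<open>Positions are uniform, so a branch has positive mass as soon as it receives all
    good samples from some interval of positions.\<close>
  have posE: "0 < measure \<Omega> {w \<in> space \<Omega>. good w \<and> u < S w \<and> S w < v}" if uv: "0 \<le> u" "u < v" "v \<le> 1" for u v
  proof -
    have "0 < measure (distr \<Omega> borel S) {u<..<v}"
      unfolding dS using prob_unif_interval[of u v] uv by simp
    also have "measure (distr \<Omega> borel S) {u<..<v} = measure \<Omega> (S -` {u<..<v} \<inter> space \<Omega>)"
      by (rule measure_distr) auto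
    also have "\<dots> = measure \<Omega> {w \<in> space \<Omega>. good w \<and> u < S w \<and> S w < v}"
    proof (rule \<Omega>.finite_measure_eq_AE)
      show "AE w in \<Omega>. (w \<in> S -` {u<..<v} \<inter> space \<Omega>) = (w \<in> {w \<in> space \<Omega>. good w \<and> u < S w \<and> S w < v})"
        using ae_good by eventually_elim auto
    qed measurable
    finally show ?thesis .
  qed
  have long: "long_dendron tree \<nu>"
    unfolding long_dendron_def
  proof (intro conjI ballI)
    show "real_tree tree" by (rule real_tree_tree)
    show "\<nu> \<in> borel_prob_measures (prod_topology (mtopology_of tree) (top_of_set {0..}))"
      unfolding borel_prob_measures_def \<nu>_def using \<Omega>.prob_space_distr[OF Z] by (simp add: N_def)
    fix B assume B: "B \<in> branches tree"
    note Bprops = branch_open_and_contains[OF B]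
    have "openin (prod_topology (mtopology_of tree) (top_of_set {0::real..})) (B \<times> {0..})"
      using Bprops(1) openin_topspace[of "top_of_set {0::real..}"] by (auto simp: openin_prod_Times_iff)
    then have BN: "B \<times> {0..} \<in> sets N" unfolding N_def by (rule borel_of_openin)
    have "measure \<nu> (B \<times> {0..}) = measure \<Omega> (Z -` (B \<times> {0..}) \<inter> space \<Omega>)"
      unfolding \<nu>_def by (rule measure_distr[OF Z BN])
    moreover have ex: "0 < measure \<Omega> (Z -` (B \<times> {0..}) \<inter> space \<Omega>)"
      if uv: "0 \<le> u" "u < v" "v \<le> 1" and sub: "\<And>w. good w \<Longrightarrow> u < S w \<Longrightarrow> S w < v \<Longrightarrow> X w \<in> B" for u v
    proof -
      have "measure \<Omega> {w \<in> space \<Omega>. good w \<and> u < S w \<and> S w < v} \<le> measure \<Omega> (Z -` (B \<times> {0..}) \<inter> space \<Omega>)"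
        using sub A0 measurable_sets[OF Z BN] by (intro \<Omega>.finite_measure_mono) (auto simp: Z_def)
      then show ?thesis using posE[OF uv] by linarith
    qed
    have "0 < measure \<Omega> (Z -` (B \<times> {0..}) \<inter> space \<Omega>)"
      using Bprops(2)
    proof
      assume "\<exists>i. \<forall>x\<in>points. G i i \<le> x i \<longrightarrow> x \<in> B"
      \<comment> \<open>Positions inside the label interval have it as their hull, so their
        coordinate \<open>i\<close> equals \<open>G i i\<close>.\<close>
      then obtain i where i: "\<And>x. x \<in> points \<Longrightarrow> G i i \<le> x i \<Longrightarrow> x \<in> B" by blast
      show ?thesis
      proof (rule ex[of "a i" "b i"])
        fix w assume w: "good w" "a i < S w" "S w < b i"
        show "X w \<in> B"
          by (rule i[OF X_point]) (use w in \<open>simp add: Xgood G_def lo_def hi_def\<close>)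
      qed (use ab[of i] in auto)
    next
      assume "\<exists>p\<in>points. 0 < meet p p \<and> (\<forall>x\<in>points. meet x p < meet p p \<longrightarrow> x \<in> B)"
      then obtain p where p: "p \<in> points" "0 < meet p p" "\<And>x. x \<in> points \<Longrightarrow> meet x p < meet p p \<Longrightarrow> x \<in> B" by blast
      \<comment> \<open>As \<open>m\<close> is an infimum, some label interval has kernel below
        \<open>m\<close> plus the height of \<open>p\<close>. Positions to its left and to its right
        meet below that height, so they cannot both lie above \<open>p\<close>: one of the two outer
        intervals is mapped into \<open>B\<close> entirely.\<close>
      obtain i where i: "g (a i) (b i) < m + meet p p" using m_approx[OF p(2)] by blast
      show ?thesis
      proof (rule ccontr)
        assume not: "\<not> ?thesis"
        have "\<not> (\<forall>w. good w \<longrightarrow> 0 < S w \<longrightarrow> S w < a i \<longrightarrow> X w \<in> B)" using ex[of 0 "a i"] ab[of i] not by auto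
        then obtain x where x: "good x" "0 < S x" "S x < a i" "X x \<notin> B" by blast
        have "\<not> (\<forall>w. good w \<longrightarrow> b i < S w \<longrightarrow> S w < 1 \<longrightarrow> X w \<in> B)" using ex[of "b i" 1] ab[of i] not by auto
        then obtain y where y: "good y" "b i < S y" "S y < 1" "X y \<notin> B" by blast
        have "\<not> meet (X x) p < meet p p" "\<not> meet (X y) p < meet p p"
          using p(3)[OF X_point] x(4) y(4) by blast+
        then have "meet p p \<le> meet (X x) p" "meet p p \<le> meet p (X y)"
          by (simp_all add: meet_commute[of p "X y"])
        then have "meet p p \<le> meet (X x) (X y)"
          using meet_ultra[OF X_point p(1) X_point, of x y] by linarith
        also have "\<dots> = g (S x) (S y) - m" using meet_less[OF x(1) y(1)] x y ab[of i] by auto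
        also have "g (S x) (S y) \<le> g (a i) (b i)" by (rule g_mono) (use x y ab[of i] in auto)
        finally show False using i by simp
      qed
    qed
    ultimately show "0 < measure \<nu> (B \<times> {0..})" by simp
  qed
  have dd: "(\<lambda>(x, y). dendron_dist tree x y) \<in> borel_measurable (\<nu> \<Otimes>\<^sub>M \<nu>)"
    using tree_space_measurable(2)[OF tree_space_long_dendron[OF long]]
    by (simp add: dendron_dist_def case_prod_beta)
  then have ddN: "(\<lambda>(x, y). dendron_dist tree x y) \<in> borel_measurable (N \<Otimes>\<^sub>M N)"
    by (simp add: \<nu>_def cong: measurable_cong_sets)
  define D where "D x y = dendron_dist tree (Z x) (Z y)" for x y
  have Dm: "(\<lambda>(x, y). D x y) \<in> borel_measurable (\<Omega> \<Otimes>\<^sub>M \<Omega>)"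
  proof -
    have "(\<lambda>z. (Z (fst z), Z (snd z))) \<in> measurable (\<Omega> \<Otimes>\<^sub>M \<Omega>) (N \<Otimes>\<^sub>M N)"
      using Z by (intro measurable_Pair measurable_compose[OF measurable_fst] measurable_compose[OF measurable_snd])
    from measurable_compose[OF this ddN] show ?thesis by (simp add: case_prod_beta D_def)
  qed
  have "AE z in \<Omega> \<Otimes>\<^sub>M \<Omega>. good (fst z) \<and> good (snd z) \<and> S (fst z) \<noteq> S (snd z)"
  proof (rule \<Omega>\<Omega>.AE_pair_measure)
    show "{z \<in> space (\<Omega> \<Otimes>\<^sub>M \<Omega>). good (fst z) \<and> good (snd z) \<and> S (fst z) \<noteq> S (snd z)} \<in> sets (\<Omega> \<Otimes>\<^sub>M \<Omega>)"
      by measurable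
    show "AE x in \<Omega>. AE y in \<Omega>. good (fst (x, y)) \<and> good (snd (x, y)) \<and> S (fst (x, y)) \<noteq> S (snd (x, y))"
      using ae_good
    proof eventually_elim
      case (elim x)
      show ?case using ae_good aeS[OF countable_insert[OF countable_empty, of "S x"]]
        by eventually_elim (use elim in auto)
    qed
  qed
  then have "AE z in \<Omega> \<Otimes>\<^sub>M \<Omega>. D (fst z) (snd z) = H (fst z) + H (snd z) -
        2 * g (min (S (fst z)) (S (snd z))) (max (S (fst z)) (S (snd z)))"
  proof eventually_elim
    case (elim z)
    then have "D (fst z) (snd z) = tdist (X (fst z)) (X (snd z)) + A (fst z) + A (snd z)"
      by (simp add: D_def dendron_dist_def Z_def mdist_tree X_point)
    then show ?case using elim meet_X[of "fst z" "snd z"] by (simp add: tdist_def A_def)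
  qed
  moreover have "tau r (dendron_dist tree) \<nu> = tau r D \<Omega>" for r
    unfolding \<nu>_def D_def by (rule tau_distr[OF \<open>prob_space \<Omega>\<close> Z ddN])
  ultimately show thesis by (rule that[OF long Dm])
qed

section \<open>Subsequential convergence\<close>

text \<open>Choose \<open>B k\<close>, independent of \<open>n\<close>, so that the distance exceeds
  it with probability at most \<open>(1/4) ^ k\<close>. Weighting these events by
  \<open>2 ^ k\<close> gives a function \<open>\<phi>\<close> with integral at most 2, so by Fubini
  some point \<open>b\<close> has a section with integral below 3. This single point then obeys the
  tail bounds \<open>3 * (1/2) ^ k\<close> for all \<open>k\<close> at once.\<close>

lemma exists_tight_root:
  fixes M :: "nat \<Rightarrow> 'a measure"
  assumes prob: "\<And>n. prob_space (M n)"
    and d: "\<And>n. (\<lambda>(x, y). d n x y) \<in> borel_measurable (M n \<Otimes>\<^sub>M M n)"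
    and tight: "tight (\<lambda>n. distance_law (d n) (M n))"
  obtains b where "\<And>n. b n \<in> space (M n)"
    "\<And>\<epsilon>. 0 < \<epsilon> \<Longrightarrow> \<exists>B. \<forall>n. measure (M n) {x \<in> space (M n). B < d n (b n) x} < \<epsilon>"
proof -
  interpret M: prob_space "M n" for n by (rule prob)
  interpret MM: pair_prob_space "M n" "M n" for n ..
  define E where "E B n = {z \<in> space (M n \<Otimes>\<^sub>M M n). B < d n (fst z) (snd z)}" for B n
  have d': "(\<lambda>z. d n (fst z) (snd z)) \<in> borel_measurable (M n \<Otimes>\<^sub>M M n)" for n
    using d[of n] by (simp add: case_prod_beta)
  have E_sets[measurable]: "E B n \<in> sets (M n \<Otimes>\<^sub>M M n)" for B n
    unfolding E_def using d' by measurable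
  have "\<exists>B. \<forall>n. measure (M n \<Otimes>\<^sub>M M n) (E B n) \<le> (1/4) ^ k" for k :: nat
  proof -
    obtain u v where uv: "u < v" "\<And>n. 1 - (1/4) ^ k < measure (distance_law (d n) (M n)) {u<..v}"
      using tight unfolding tight_def by (metis zero_less_power zero_less_divide_1_iff zero_less_numeral)
    have "measure (M n \<Otimes>\<^sub>M M n) (E v n) \<le> (1/4) ^ k" for n
    proof -
      let ?A = "(\<lambda>(x, y). d n x y) -` {u<..v} \<inter> space (M n \<Otimes>\<^sub>M M n)"
      have A: "?A \<in> sets (M n \<Otimes>\<^sub>M M n)" using d by (rule measurable_sets) simp
      have "measure (distance_law (d n) (M n)) {u<..v} = measure (M n \<Otimes>\<^sub>M M n) ?A"
        unfolding distance_law_def by (rule measure_distr[OF d]) simp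
      moreover have "measure (M n \<Otimes>\<^sub>M M n) (E v n) \<le> measure (M n \<Otimes>\<^sub>M M n) (space (M n \<Otimes>\<^sub>M M n) - ?A)"
        using A by (intro MM.P.finite_measure_mono) (auto simp: E_def)
      moreover have "\<dots> = 1 - measure (M n \<Otimes>\<^sub>M M n) ?A" by (rule MM.P.prob_compl[OF A])
      ultimately show ?thesis using uv(2)[of n] by linarith
    qed
    then show ?thesis by blast
  qed
  then obtain B where B: "\<And>k n. measure (M n \<Otimes>\<^sub>M M n) (E (B k) n) \<le> (1/4) ^ k" by metis
  define \<phi> where "\<phi> n z = (\<Sum>k. ennreal (2 ^ k) * indicator (E (B k) n) z)" for n and z :: "'a \<times> 'a"
  have \<phi>m[measurable]: "\<phi> n \<in> borel_measurable (M n \<Otimes>\<^sub>M M n)" for n unfolding \<phi>_def by measurable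
  have "(\<integral>\<^sup>+z. \<phi> n z \<partial>(M n \<Otimes>\<^sub>M M n)) \<le> 2" for n
  proof -
    have "(\<integral>\<^sup>+z. \<phi> n z \<partial>(M n \<Otimes>\<^sub>M M n)) = (\<Sum>k. ennreal (2 ^ k) * emeasure (M n \<Otimes>\<^sub>M M n) (E (B k) n))"
      unfolding \<phi>_def by (subst nn_integral_suminf) (auto intro!: suminf_cong nn_integral_cmult_indicator)
    also have "\<dots> \<le> (\<Sum>k. ennreal ((1/2) ^ k))"
    proof (rule suminf_le)
      fix k
      have "2 ^ k * measure (M n \<Otimes>\<^sub>M M n) (E (B k) n) \<le> 2 ^ k * (1/4) ^ k" using B by (intro mult_left_mono) auto
      also have "\<dots> = (1/2::real) ^ k" by (simp add: power_mult_distrib[symmetric])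
      finally show "ennreal (2 ^ k) * emeasure (M n \<Otimes>\<^sub>M M n) (E (B k) n) \<le> ennreal ((1/2) ^ k)"
        by (simp add: MM.P.emeasure_eq_measure ennreal_mult'[symmetric] ennreal_leI)
    qed auto
    also have "\<dots> = ennreal (\<Sum>k. (1/2) ^ k)" by (rule suminf_ennreal2) (auto intro!: summable_geometric)
    also have "\<dots> = 2" by (simp add: suminf_geometric)
    finally show ?thesis .
  qed
  then have le2: "(\<integral>\<^sup>+x. (\<integral>\<^sup>+y. \<phi> n (x, y) \<partial>M n) \<partial>M n) \<le> 2" for n
    by (subst M.nn_integral_fst[OF \<phi>m])
  have "\<exists>x. x \<in> space (M n) \<and> (\<integral>\<^sup>+y. \<phi> n (x, y) \<partial>M n) < 3" for n
  proof (rule ccontr)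
    assume "\<not> ?thesis"
    then have "\<And>x. x \<in> space (M n) \<Longrightarrow> 3 \<le> (\<integral>\<^sup>+y. \<phi> n (x, y) \<partial>M n)" by (meson not_less)
    then have "(\<integral>\<^sup>+x. 3 \<partial>M n) \<le> (\<integral>\<^sup>+x. (\<integral>\<^sup>+y. \<phi> n (x, y) \<partial>M n) \<partial>M n)" by (intro nn_integral_mono)
    from order_trans[OF this le2[of n]] show False by (simp add: M.emeasure_space_1)
  qed
  then obtain b where b: "\<And>n. b n \<in> space (M n)" "\<And>n. (\<integral>\<^sup>+y. \<phi> n (b n, y) \<partial>M n) < 3" by metis
  have small: "measure (M n) {x \<in> space (M n). B k < d n (b n) x} \<le> 3 * (1/2) ^ k" for n k
  proof -
    let ?S = "{x \<in> space (M n). B k < d n (b n) x}"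
    have S: "?S \<in> sets (M n)"
    proof -
      have "(\<lambda>x. d n (b n) x) \<in> borel_measurable (M n)"
        using measurable_compose[OF measurable_Pair1'[OF b(1)] d, of n] by simp
      then show ?thesis by measurable
    qed
    have "ennreal (2 ^ k) * emeasure (M n) ?S = (\<integral>\<^sup>+y. ennreal (2 ^ k) * indicator ?S y \<partial>M n)"
      using S by (rule nn_integral_cmult_indicator[symmetric])
    also have "\<dots> \<le> (\<integral>\<^sup>+y. \<phi> n (b n, y) \<partial>M n)"
    proof (rule nn_integral_mono)
      fix y assume "y \<in> space (M n)"
      then have "ennreal (2 ^ k) * indicator ?S y = ennreal (2 ^ k) * indicator (E (B k) n) (b n, y)"
        using b(1)[of n] by (auto simp: E_def indicator_def space_pair_measure)
      also have "\<dots> \<le> \<phi> n (b n, y)"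
      proof -
        have "(\<Sum>j\<in>{k}. ennreal (2 ^ j) * indicator (E (B j) n) (b n, y)) \<le> \<phi> n (b n, y)"
          unfolding \<phi>_def by (rule sum_le_suminf) (auto intro: summableI)
        then show ?thesis by (simp only: sum.insert finite.emptyI empty_iff sum.empty simp_thms add_0_right)
      qed
      finally show "ennreal (2 ^ k) * indicator ?S y \<le> \<phi> n (b n, y)" .
    qed
    also have "\<dots> \<le> 3" using b(2)[of n] by simp
    finally have "ennreal (2 ^ k * measure (M n) ?S) \<le> ennreal 3"
      by (simp add: M.emeasure_eq_measure ennreal_mult')
    then have "2 ^ k * measure (M n) ?S \<le> 3" by (subst (asm) ennreal_le_iff) auto
    then show ?thesis by (simp add: field_simps power_one_over)
  qed
  have "\<exists>B. \<forall>n. measure (M n) {x \<in> space (M n). B < d n (b n) x} < \<epsilon>" if \<epsilon>: "0 < \<epsilon>" for \<epsilon>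
  proof -
    obtain k where "(1/2 :: real) ^ k < \<epsilon> / 3" using real_arch_pow_inv[of "\<epsilon> / 3" "1/2"] \<epsilon> by auto
    then have "3 * (1/2) ^ k < \<epsilon>" by simp
    then show ?thesis using small le_less_trans by blast
  qed
  then show ?thesis using that b(1) by blast
qed

text \<open>\<open>f\<close> picks the first point of a dense sequence within
  \<open>\<epsilon>\<close>, provided that its index is below \<open>N\<close>, and the root
  otherwise. The root as default keeps the distance from the root under control even on the event
  where the approximation fails.\<close>

lemma tree_space_discretization:
  assumes ts: "tree_space M \<rho> a" and b: "b \<in> space M" and \<epsilon>: "0 < \<epsilon>"
  shows "\<exists>Q f. finite Q \<and> Q \<subseteq> space M \<and> b \<in> Q \<and> f \<in> measurable M (count_space Q) \<and>
    (\<forall>x\<in>space M. \<rho> b (f x) \<le> \<rho> b x + \<epsilon>) \<and> measure M {x \<in> space M. \<not> \<rho> x (f x) < \<epsilon>} < \<epsilon>"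
proof -
  interpret M: prob_space M using ts by (simp add: tree_space_def)
  have tl: "tree_like (space M) \<rho>" using ts by (simp add: tree_space_def)
  obtain Q where Q: "countable Q" "Q \<subseteq> space M" "\<And>x e. x \<in> space M \<Longrightarrow> 0 < e \<Longrightarrow> \<exists>q\<in>Q. \<rho> x q < e"
    using ts unfolding tree_space_def by blast
  then have "Q \<noteq> {}" using b \<epsilon> by fastforce
  define q where "q = from_nat_into Q"
  have q: "q i \<in> space M" for i using from_nat_into[OF \<open>Q \<noteq> {}\<close>, of i] Q(2) by (auto simp: q_def)
  have qm[measurable]: "(\<lambda>x. \<rho> x (q i)) \<in> borel_measurable M" for i
    using ts q[of i] unfolding tree_space_def by blast
  define idx where "idx x = (LEAST i. \<rho> x (q i) < \<epsilon>)" for x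
  have idx: "\<rho> x (q (idx x)) < \<epsilon>" if x: "x \<in> space M" for x
  proof -
    obtain p where "p \<in> Q" "\<rho> x p < \<epsilon>" using Q(3)[OF x \<epsilon>] by blast
    moreover obtain i where "q i = p" using range_from_nat_into[OF \<open>Q \<noteq> {}\<close> Q(1)] \<open>p \<in> Q\<close> by (metis imageE q_def)
    ultimately show ?thesis unfolding idx_def by (metis (mono_tags) LeastI)
  qed
  have idxm[measurable]: "idx \<in> measurable M (count_space UNIV)"
    unfolding idx_def by (rule measurable_Least) measurable
  have "(\<lambda>N. measure M {x \<in> space M. N \<le> idx x}) \<longlonglongrightarrow> measure M (\<Inter>N. {x \<in> space M. N \<le> idx x})"
  proof (rule M.finite_Lim_measure_decseq)
    show "range (\<lambda>N. {x \<in> space M. N \<le> idx x}) \<subseteq> M.events" by auto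
    show "decseq (\<lambda>N. {x \<in> space M. N \<le> idx x})" by (auto simp: decseq_def)
  qed
  also have "(\<Inter>N. {x \<in> space M. N \<le> idx x}) = {}"
  proof -
    have "x \<notin> {y \<in> space M. Suc (idx x) \<le> idx y}" for x by simp
    then show ?thesis by blast
  qed
  finally have "(\<lambda>N. measure M {x \<in> space M. N \<le> idx x}) \<longlonglongrightarrow> 0" by simp
  then have "\<forall>\<^sub>F N in sequentially. measure M {x \<in> space M. N \<le> idx x} < \<epsilon>"
    using \<epsilon> by (rule order_tendstoD(2))
  then obtain N where N: "measure M {x \<in> space M. N \<le> idx x} < \<epsilon>"
    unfolding eventually_sequentially by blast
  define f where "f x = (if idx x < N then q (idx x) else b)" for x
  define Q' where "Q' = insert b (q ` {..<N})"
  have "f \<in> measurable M (count_space Q')"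
  proof -
    have "(\<lambda>i. if i < N then q i else b) \<in> measurable (count_space UNIV) (count_space Q')"
      by (auto simp: Q'_def)
    from measurable_compose[OF idxm this] show ?thesis by (simp add: f_def[abs_def])
  qed
  moreover have "\<rho> b (f x) \<le> \<rho> b x + \<epsilon>" if x: "x \<in> space M" for x
  proof (cases "idx x < N")
    case True
    have "\<rho> b (q (idx x)) \<le> \<rho> b x + \<rho> x (q (idx x))" using tl b x q unfolding tree_like_def by blast
    then show ?thesis using idx[OF x] True by (simp add: f_def)
  next
    case False
    have "\<rho> b b = 0" using tl b unfolding tree_like_def by blast
    then show ?thesis using False \<epsilon> tree_like_nonneg[OF tl b x] by (simp add: f_def)
  qed
  moreover have "measure M {x \<in> space M. \<not> \<rho> x (f x) < \<epsilon>} < \<epsilon>"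
  proof (rule le_less_trans[OF M.finite_measure_mono N])
    show "{x \<in> space M. \<not> \<rho> x (f x) < \<epsilon>} \<subseteq> {x \<in> space M. N \<le> idx x}"
      using idx by (auto simp: f_def split: if_splits)
  qed measurable
  ultimately show ?thesis
    by (intro exI[of _ Q'] exI[of _ f]) (use b q in \<open>auto simp: Q'_def\<close>)
qed

text \<open>Compactness of the box, by contradiction: along a subsequence \<open>u\<close> and
  \<open>v\<close> converge to the same matrix. The bound concerns \<open>u\<close> alone because in
  the application one of the two matrices is dominated by heights.\<close>

lemma uniformly_continuous_on_matrix_box:
  assumes F: "continuous_map (matrix_topology r) euclideanreal F" and e: "0 < e"
  obtains \<delta> where "0 < \<delta>"
    "\<And>u v. u \<in> topspace (matrix_topology r) \<Longrightarrow> v \<in> topspace (matrix_topology r) \<Longrightarrow>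
      (\<And>ij. ij \<in> {1..r} \<times> {1..r} \<Longrightarrow> \<bar>u ij\<bar> \<le> C) \<Longrightarrow> (\<And>ij. ij \<in> {1..r} \<times> {1..r} \<Longrightarrow> \<bar>u ij - v ij\<bar> \<le> \<delta>) \<Longrightarrow>
      \<bar>F u - F v\<bar> < e"
proof (rule ccontr)
  assume "\<not> thesis"
  then have "\<exists>u v. u \<in> topspace (matrix_topology r) \<and> v \<in> topspace (matrix_topology r) \<and>
      (\<forall>ij\<in>{1..r} \<times> {1..r}. \<bar>u ij\<bar> \<le> C) \<and> (\<forall>ij\<in>{1..r} \<times> {1..r}. \<bar>u ij - v ij\<bar> \<le> inverse (real (Suc n))) \<and> e \<le> \<bar>F u - F v\<bar>" for n
    using that[of "inverse (real (Suc n))"] by (metis (no_types, lifting) inverse_positive_iff_positive not_less of_nat_0_less_iff zero_less_Suc)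
  then obtain u v where u: "\<And>n. u n \<in> topspace (matrix_topology r)" and v: "\<And>n. v n \<in> topspace (matrix_topology r)"
    and C: "\<And>n ij. ij \<in> {1..r} \<times> {1..r} \<Longrightarrow> \<bar>u n ij\<bar> \<le> C"
    and uv: "\<And>n ij. ij \<in> {1..r} \<times> {1..r} \<Longrightarrow> \<bar>u n ij - v n ij\<bar> \<le> inverse (real (Suc n))"
    and far: "\<And>n. e \<le> \<bar>F (u n) - F (v n)\<bar>" by metis
  obtain k where k: "strict_mono (k :: nat \<Rightarrow> nat)" "\<And>ij. ij \<in> {1..r} \<times> {1..r} \<Longrightarrow> convergent (\<lambda>n. u (k n) ij)"
  proof (rule bounded_pointwise_convergent_subsequence[of "{1..r} \<times> {1..r}" u])
    show "countable ({1..r} \<times> {1..r})" by (intro countable_finite) simp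
    show "\<exists>B. \<forall>n. \<bar>u n ij\<bar> \<le> B" if "ij \<in> {1..r} \<times> {1..r}" for ij using C[OF that] by blast
  qed blast
  define w where "w = restrict (\<lambda>ij. lim (\<lambda>n. u (k n) ij)) ({1..r} \<times> {1..r})"
  have uw: "(\<lambda>n. u (k n) ij) \<longlonglongrightarrow> w ij" if "ij \<in> {1..r} \<times> {1..r}" for ij
    using k(2)[OF that] that by (simp add: w_def convergent_LIMSEQ_iff)
  have vw: "(\<lambda>n. v (k n) ij) \<longlonglongrightarrow> w ij" if ij: "ij \<in> {1..r} \<times> {1..r}" for ij
  proof -
    have "(\<lambda>n. u (k n) ij - v (k n) ij) \<longlonglongrightarrow> 0"
    proof (rule Lim_null_comparison)
      show "\<forall>\<^sub>F n in sequentially. norm (u (k n) ij - v (k n) ij) \<le> inverse (real (Suc (k n)))"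
        using uv[OF ij] by simp
      show "(\<lambda>n. inverse (real (Suc (k n)))) \<longlonglongrightarrow> 0"
        using LIMSEQ_subseq_LIMSEQ[OF LIMSEQ_inverse_real_of_nat k(1)] by (simp add: o_def)
    qed
    from tendsto_diff[OF uw[OF ij] this] show ?thesis by simp
  qed
  have w: "w \<in> extensional ({1..r} \<times> {1..r})" by (simp add: w_def)
  have "limitin (matrix_topology r) (\<lambda>n. u (k n)) w sequentially" "limitin (matrix_topology r) (\<lambda>n. v (k n)) w sequentially"
    unfolding matrix_topology_def limitin_componentwise
    using uw vw w u v by (simp_all add: topspace_matrix PiE_def del: atLeastAtMost_iff)
  from this[THEN continuous_map_limit[OF F]] have "(\<lambda>n. F (u (k n))) \<longlonglongrightarrow> F w" "(\<lambda>n. F (v (k n))) \<longlonglongrightarrow> F w"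
    by (simp_all add: o_def)
  from tendsto_rabs[OF tendsto_diff[OF this]] have "(\<lambda>n. \<bar>F (u (k n)) - F (v (k n))\<bar>) \<longlonglongrightarrow> 0" by simp
  from LIMSEQ_le_const[OF this, of e] far e show False by force
qed

lemma prob_PiM_exists_le:
  assumes M: "prob_space M" and S: "S \<in> sets M"
  shows "measure (Pi\<^sub>M {1..r::nat} (\<lambda>_. M)) {\<xi> \<in> space (Pi\<^sub>M {1..r} (\<lambda>_. M)). \<exists>i\<in>{1..r}. \<xi> i \<in> S} \<le> r * measure M S"
proof -
  let ?P = "Pi\<^sub>M {1..r} (\<lambda>_. M)"
  interpret P: prob_space ?P by (rule prob_space_PiM) (rule M)
  have comp: "(\<lambda>\<xi>. \<xi> i) \<in> measurable ?P M" if "i \<in> {1..r}" for i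
    using that by (rule measurable_component_singleton)
  have eq: "measure ?P ((\<lambda>\<xi>. \<xi> i) -` S \<inter> space ?P) = measure M S" if i: "i \<in> {1..r}" for i
  proof -
    have "measure M S = measure (distr ?P M (\<lambda>\<xi>. \<xi> i)) S"
      by (subst distr_PiM_component) (use M i in auto)
    also have "\<dots> = measure ?P ((\<lambda>\<xi>. \<xi> i) -` S \<inter> space ?P)" by (rule measure_distr[OF comp[OF i] S])
    finally show ?thesis by simp
  qed
  have "{\<xi> \<in> space ?P. \<exists>i\<in>{1..r}. \<xi> i \<in> S} = (\<Union>i\<in>{1..r}. (\<lambda>\<xi>. \<xi> i) -` S \<inter> space ?P)" by auto
  also have "measure ?P \<dots> \<le> (\<Sum>i\<in>{1..r}. measure ?P ((\<lambda>\<xi>. \<xi> i) -` S \<inter> space ?P))"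
    by (rule P.finite_measure_subadditive_finite) (use measurable_sets[OF comp S] in auto)
  also have "\<dots> = (\<Sum>i\<in>{1..r}. measure M S)" by (rule sum.cong[OF refl eq])
  finally show ?thesis by simp
qed

text \<open>Unless some sample point is bad or has a large height, the two distance matrices are
  close and the one for \<open>d'\<close> lies in a fixed box, where \<open>F\<close> is uniformly
  continuous. The remaining event has small probability and \<open>F\<close> is bounded.\<close>

lemma converging_together:
  fixes M :: "nat \<Rightarrow> 'a measure"
  assumes prob: "\<And>n. prob_space (M n)"
    and d: "\<And>n. (\<lambda>(x, y). d n x y) \<in> borel_measurable (M n \<Otimes>\<^sub>M M n)"
    and d': "\<And>n. (\<lambda>(x, y). d' n x y) \<in> borel_measurable (M n \<Otimes>\<^sub>M M n)"
    and h: "\<And>n. h n \<in> borel_measurable (M n)"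
    and bad: "\<And>n. Bad n \<in> sets (M n)" "\<And>n. measure (M n) (Bad n) \<le> \<epsilon> n" "\<epsilon> \<longlonglongrightarrow> 0"
    and close: "\<And>n x y. x \<in> space (M n) \<Longrightarrow> y \<in> space (M n) \<Longrightarrow> x \<notin> Bad n \<Longrightarrow> y \<notin> Bad n \<Longrightarrow>
      \<bar>d' n x y - d n x y\<bar> \<le> 2 * \<epsilon> n"
    and dom: "\<And>n x y. x \<in> space (M n) \<Longrightarrow> y \<in> space (M n) \<Longrightarrow> \<bar>d' n x y\<bar> \<le> h n x + h n y"
    and tight: "\<And>e. 0 < e \<Longrightarrow> \<exists>B. \<forall>n. measure (M n) {x \<in> space (M n). B < h n x} < e"
    and F: "continuous_map (matrix_topology r) euclideanreal F" "bounded (F ` topspace (matrix_topology r))"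
  shows "(\<lambda>n. (\<integral>x. F x \<partial>tau r (d n) (M n)) - (\<integral>x. F x \<partial>tau r (d' n) (M n))) \<longlonglongrightarrow> 0"
proof (rule LIMSEQ_I)
  fix e :: real assume e: "0 < e"
  obtain C0 where C0: "\<And>x. x \<in> topspace (matrix_topology r) \<Longrightarrow> \<bar>F x\<bar> \<le> C0"
    using F(2) by (auto simp: bounded_iff)
  define C where "C = max C0 1"
  have C: "\<bar>F x\<bar> \<le> C" "0 < C" if "x \<in> topspace (matrix_topology r)" for x
    using C0[OF that] by (auto simp: C_def)
  have C_pos: "0 < C" by (simp add: C_def)
  \<comment> \<open>Adding 1 keeps the denominator of \<open>c\<close> positive for
    \<open>r = 0\<close>. A single coordinate fails with probability at most \<open>2 * c\<close>,
    some coordinate with probability at most \<open>e / (4 * C)\<close>; as the integrands differ by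
    at most \<open>2 * C\<close>, this costs \<open>e / 2\<close> on top of the \<open>e / 4\<close>
    from uniform continuity.\<close>
  define R where "R = real r + 1"
  have R: "0 < R" "real r \<le> R" by (auto simp: R_def)
  define c where "c = e / (8 * C * R)"
  have c: "0 < c" using e C_pos R by (simp add: c_def)
  obtain B0 where B0: "\<And>n. measure (M n) {x \<in> space (M n). B0 < h n x} < c" using tight[OF c] by blast
  define B where "B = max B0 0"
  have e4: "0 < e / 4" using e by simp
  obtain \<delta> where \<delta>: "0 < \<delta>" and unif_cont: "\<And>u v. u \<in> topspace (matrix_topology r) \<Longrightarrow> v \<in> topspace (matrix_topology r) \<Longrightarrow>
      (\<And>ij. ij \<in> {1..r} \<times> {1..r} \<Longrightarrow> \<bar>u ij\<bar> \<le> 2 * B) \<Longrightarrow> (\<And>ij. ij \<in> {1..r} \<times> {1..r} \<Longrightarrow> \<bar>u ij - v ij\<bar> \<le> \<delta>) \<Longrightarrow>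
      \<bar>F u - F v\<bar> < e / 4"
    by (rule uniformly_continuous_on_matrix_box[OF F(1) e4, of "2 * B"]) blast
  have "\<forall>\<^sub>F n in sequentially. \<epsilon> n < min c (\<delta> / 2)"
    using c \<delta> by (intro order_tendstoD(2)[OF bad(3)]) auto
  then obtain N where N: "\<And>n. N \<le> n \<Longrightarrow> \<epsilon> n < min c (\<delta> / 2)" unfolding eventually_sequentially by blast
  have "norm ((\<integral>x. F x \<partial>tau r (d n) (M n)) - (\<integral>x. F x \<partial>tau r (d' n) (M n)) - 0) < e" if n: "N \<le> n" for n
  proof -
    interpret M: prob_space "M n" by (rule prob)
    let ?P = "Pi\<^sub>M {1..r} (\<lambda>_. M n)"
    interpret P: prob_space ?P by (rule prob_space_PiM) (rule prob)
    define S where "S = Bad n \<union> {x \<in> space (M n). B < h n x}"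
    have big: "{x \<in> space (M n). B < h n x} \<in> sets (M n)" using h[of n] by measurable
    have S: "S \<in> sets (M n)" unfolding S_def using bad(1) big by blast
    have "measure (M n) {x \<in> space (M n). B < h n x} \<le> measure (M n) {x \<in> space (M n). B0 < h n x}"
      using h[of n] by (intro M.finite_measure_mono) (auto simp: B_def)
    then have "measure (M n) S \<le> 2 * c"
      using measure_Un_le[OF bad(1) big] B0[of n] bad(2)[of n] N[OF n] unfolding S_def by simp
    define W where "W = {\<xi> \<in> space ?P. \<exists>i\<in>{1..r}. \<xi> i \<in> S}"
    have "W = (\<Union>i\<in>{1..r}. (\<lambda>\<xi>. \<xi> i) -` S \<inter> space ?P)" by (auto simp: W_def)
    also have "\<dots> \<in> sets ?P"
    proof (rule sets.finite_UN)
      fix i assume "i \<in> {1..r}"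
      then have "(\<lambda>\<xi>. \<xi> i) \<in> measurable ?P (M n)" by (rule measurable_component_singleton)
      then show "(\<lambda>\<xi>. \<xi> i) -` S \<inter> space ?P \<in> sets ?P" using S by (rule measurable_sets)
    qed simp
    finally have W: "W \<in> sets ?P" .
    have "measure ?P W \<le> r * measure (M n) S" unfolding W_def by (rule prob_PiM_exists_le[OF prob S])
    also have "\<dots> \<le> r * (2 * c)" using \<open>measure (M n) S \<le> 2 * c\<close> by (intro mult_left_mono) auto
    also have "\<dots> \<le> R * (2 * c)" using c R by (intro mult_right_mono) auto
    also have "\<dots> = e / (4 * C)" using C_pos R by (simp add: c_def field_simps)
    finally have PW: "measure ?P W \<le> e / (4 * C)" .
    have dmat: "distance_matrix r \<rho> \<xi> \<in> topspace (matrix_topology r)" for \<rho> :: "'a \<Rightarrow> 'a \<Rightarrow> real" and \<xi>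
      by (simp add: topspace_matrix distance_matrix_def)
    note Fm = measurable_continuous_map_borel_of[OF F(1) refl]
    define f where "f \<xi> = F (distance_matrix r (d n) \<xi>)" for \<xi>
    define f' where "f' \<xi> = F (distance_matrix r (d' n) \<xi>)" for \<xi>
    have f: "f \<in> borel_measurable ?P" "f' \<in> borel_measurable ?P"
      unfolding f_def f'_def
      by (rule measurable_compose[OF measurable_distance_matrix[OF d] Fm])
        (rule measurable_compose[OF measurable_distance_matrix[OF d'] Fm])
    have fC: "\<bar>f \<xi>\<bar> \<le> C" "\<bar>f' \<xi>\<bar> \<le> C" for \<xi> unfolding f_def f'_def using C(1)[OF dmat] by auto
    have int: "integrable ?P f" "integrable ?P f'"
      by (rule P.integrable_const_bound[where B = C]; use fC f in auto)+
    have pw: "\<bar>f \<xi> - f' \<xi>\<bar> \<le> e / 4 + 2 * C * indicator W \<xi>" if \<xi>: "\<xi> \<in> space ?P" for \<xi>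
    proof (cases "\<xi> \<in> W")
      case True
      then show ?thesis using fC[of \<xi>] e by (auto simp: indicator_def)
    next
      case False
      have sp: "\<xi> i \<in> space (M n)" if "i \<in> {1..r}" for i using \<xi> that by (auto simp: space_PiM)
      have notS: "\<xi> i \<notin> S" if "i \<in> {1..r}" for i using False \<xi> that by (auto simp: W_def)
      have 1: "\<bar>d' n (\<xi> i) (\<xi> j)\<bar> \<le> 2 * B" if "i \<in> {1..r}" "j \<in> {1..r}" for i j
        using dom[OF sp[OF that(1)] sp[OF that(2)]] notS[OF that(1)] notS[OF that(2)] sp[OF that(1)] sp[OF that(2)]
        by (auto simp: S_def)
      have 2: "\<bar>d' n (\<xi> i) (\<xi> j) - d n (\<xi> i) (\<xi> j)\<bar> \<le> \<delta>" if "i \<in> {1..r}" "j \<in> {1..r}" for i j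
        using close[OF sp[OF that(1)] sp[OF that(2)]] notS[OF that(1)] notS[OF that(2)] N[OF n]
        by (force simp: S_def)
      have "\<bar>F (distance_matrix r (d' n) \<xi>) - F (distance_matrix r (d n) \<xi>)\<bar> < e / 4"
      proof (rule unif_cont[OF dmat dmat])
        fix ij assume "ij \<in> {1..r} \<times> {1..r}"
        then obtain i j where ij: "ij = (i, j)" "i \<in> {1..r}" "j \<in> {1..r}" by blast
        show "\<bar>distance_matrix r (d' n) \<xi> ij\<bar> \<le> 2 * B"
          using 1[OF ij(2,3)] ij by (auto simp: distance_matrix_def B_def)
        show "\<bar>distance_matrix r (d' n) \<xi> ij - distance_matrix r (d n) \<xi> ij\<bar> \<le> \<delta>"
          using 2[OF ij(2,3)] ij \<delta> by (auto simp: distance_matrix_def)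
      qed
      then show ?thesis using False by (simp add: f_def f'_def abs_minus_commute)
    qed
    have intW: "integrable ?P (\<lambda>\<xi>. e / 4 + 2 * C * indicator W \<xi>)"
      by (rule P.integrable_const_bound[where B = "e / 4 + 2 * C"])
        (use e C_pos W in \<open>auto simp: indicator_def\<close>)
    have "\<bar>(\<integral>\<xi>. f \<xi> \<partial>?P) - (\<integral>\<xi>. f' \<xi> \<partial>?P)\<bar> = \<bar>\<integral>\<xi>. f \<xi> - f' \<xi> \<partial>?P\<bar>"
      using int by (simp only: Bochner_Integration.integral_diff)
    also have "\<dots> \<le> (\<integral>\<xi>. \<bar>f \<xi> - f' \<xi>\<bar> \<partial>?P)" by (rule integral_abs_bound)
    also have "\<dots> \<le> (\<integral>\<xi>. e / 4 + 2 * C * indicator W \<xi> \<partial>?P)"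
      by (rule integral_mono[OF _ intW pw]) (use int in auto)
    also have "\<dots> = e / 4 + 2 * C * measure ?P W"
    proof -
      have i2: "integrable ?P (\<lambda>\<xi>. 2 * C * indicator W \<xi>)"
      proof (rule P.integrable_const_bound[where B = "2 * C"])
        show "AE \<xi> in ?P. norm (2 * C * indicator W \<xi>) \<le> 2 * C"
          using C_pos by (intro AE_I2) (auto simp: indicator_def)
      qed (use W in measurable)
      have "(\<integral>\<xi>. e / 4 + 2 * C * indicator W \<xi> \<partial>?P) = (\<integral>\<xi>. e / 4 \<partial>?P) + (\<integral>\<xi>. 2 * C * indicator W \<xi> \<partial>?P)"
        by (rule Bochner_Integration.integral_add[OF P.integrable_const i2])
      also have "(\<integral>\<xi>. e / 4 \<partial>?P) = e / 4" by (simp only: lebesgue_integral_const P.prob_space) simp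
      also have "(\<integral>\<xi>. 2 * C * indicator W \<xi> \<partial>?P) = 2 * C * measure ?P W"
        using sets.sets_into_space[OF W] by (simp add: Int_absorb2)
      finally show ?thesis .
    qed
    also have "\<dots> \<le> e / 4 + 2 * C * (e / (4 * C))" using PW C_pos by (intro add_left_mono mult_left_mono) auto
    also have "\<dots> < e" using e C_pos by simp
    finally show ?thesis
      unfolding integral_tau[OF d F(1)] integral_tau[OF d' F(1)] f_def f'_def by simp
  qed
  then show "\<exists>N. \<forall>n\<ge>N. norm ((\<integral>x. F x \<partial>tau r (d n) (M n)) - (\<integral>x. F x \<partial>tau r (d' n) (M n)) - 0) < e" by blast
qed

text \<open>Each point \<open>x\<close> is replaced by \<open>f n x\<close> from a finite set while
  its extra length \<open>a n x\<close> is kept, which gives \<open>d'\<close>.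
  \<open>coding_limit\<close> and \<open>limit_dendron\<close> produce the limit for
  \<open>d'\<close>, and \<open>converging_together\<close> shows that \<open>d\<close> has the same
  limit.\<close>

theorem tight_tree_spaces_subseq_converge:
  fixes M :: "nat \<Rightarrow> 'a measure"
  assumes ts: "\<And>n. tree_space (M n) (\<rho> n) (a n)"
    and tight: "tight (\<lambda>n. distance_law (\<lambda>x y. \<rho> n x y + a n x + a n y) (M n))"
  shows "subseq_converges_to_some_dendron (\<lambda>n x y. \<rho> n x y + a n x + a n y) M"
proof -
  define d where "d n x y = \<rho> n x y + a n x + a n y" for n x y
  define \<epsilon> where "\<epsilon> n = 1 / (real n + 2)" for n
  have \<epsilon>: "0 < \<epsilon> n" "\<epsilon> n \<le> 1" for n by (auto simp: \<epsilon>_def)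
  have \<epsilon>0: "\<epsilon> \<longlonglongrightarrow> 0"
    unfolding \<epsilon>_def using LIMSEQ_ignore_initial_segment[OF lim_1_over_n, of 2] by (simp add: add.commute)
  have prob: "prob_space (M n)" and tl: "tree_like (space (M n)) (\<rho> n)" and am: "a n \<in> borel_measurable (M n)"
    and a0: "\<And>x. x \<in> space (M n) \<Longrightarrow> 0 \<le> a n x" for n
    using ts[of n] by (auto simp: tree_space_def)
  interpret M: prob_space "M n" for n by (rule prob)
  have refl: "\<rho> n x x = 0" if "x \<in> space (M n)" for n x using tl[of n] that unfolding tree_like_def by blast
  have sym: "\<rho> n x y = \<rho> n y x" if "x \<in> space (M n)" "y \<in> space (M n)" for n x y
    using tl[of n] that unfolding tree_like_def by blast
  have tri: "\<rho> n x z \<le> \<rho> n x y + \<rho> n y z" if "x \<in> space (M n)" "y \<in> space (M n)" "z \<in> space (M n)" for n x y z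
    using tl[of n] that unfolding tree_like_def by blast
  have nn: "0 \<le> \<rho> n x y" if "x \<in> space (M n)" "y \<in> space (M n)" for n x y using tree_like_nonneg[OF tl that] .
  have dm: "(\<lambda>(x, y). d n x y) \<in> borel_measurable (M n \<Otimes>\<^sub>M M n)" for n
    unfolding d_def by (rule tree_space_measurable(2)[OF ts])
  have tight_d: "tight (\<lambda>n. distance_law (d n) (M n))" using tight by (simp add: d_def[abs_def])
  obtain b where b: "\<And>n. b n \<in> space (M n)"
    and tight_b: "\<And>e. 0 < e \<Longrightarrow> \<exists>B. \<forall>n. measure (M n) {x \<in> space (M n). B < d n (b n) x} < e"
    by (rule exists_tight_root[OF prob dm tight_d]) blast
  define good_pair where "good_pair n Q f \<longleftrightarrow> finite Q \<and> Q \<subseteq> space (M n) \<and> b n \<in> Q \<and> f \<in> measurable (M n) (count_space Q) \<and>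
    (\<forall>x\<in>space (M n). \<rho> n (b n) (f x) \<le> \<rho> n (b n) x + \<epsilon> n) \<and>
    measure (M n) {x \<in> space (M n). \<not> \<rho> n x (f x) < \<epsilon> n} < \<epsilon> n" for n Q f
  have "\<exists>Q f. good_pair n Q f" for n
    unfolding good_pair_def by (rule tree_space_discretization[OF ts b \<epsilon>(1)])
  then obtain Q f where "\<And>n. good_pair n (Q n) (f n)" by metis
  then have Q: "finite (Q n)" "Q n \<subseteq> space (M n)" and f: "f n \<in> measurable (M n) (count_space (Q n))"
    and fb: "\<And>x. x \<in> space (M n) \<Longrightarrow> \<rho> n (b n) (f n x) \<le> \<rho> n (b n) x + \<epsilon> n"
    and fbad: "measure (M n) {x \<in> space (M n). \<not> \<rho> n x (f n x) < \<epsilon> n} < \<epsilon> n" for n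
    unfolding good_pair_def by blast+
  have fQ: "f n x \<in> Q n" if "x \<in> space (M n)" for n x using measurable_space[OF f that] by simp
  then have fs: "f n x \<in> space (M n)" if "x \<in> space (M n)" for n x using Q(2) that by blast
  have Qs: "q \<in> space (M n)" if "q \<in> Q n" for n q using Q(2) that by blast
  define K where "K n = gromov_product (\<rho> n) (b n)" for n
  define h where "h n x = \<rho> n (b n) (f n x) + a n x" for n x
  have fin_meas: "(\<lambda>x. \<psi> (f n x)) \<in> borel_measurable (M n)" for n and \<psi> :: "'a \<Rightarrow> real"
    using measurable_compose[OF f[of n], of \<psi> borel] by simp
  have hm: "h n \<in> borel_measurable (M n)" for n
    unfolding h_def[abs_def] using fin_meas[of "\<rho> n (b n)" n] am[of n] by measurable
  have h_tight: "\<exists>B. \<forall>n. measure (M n) {x \<in> space (M n). B < h n x} < e" if e: "0 < e" for e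
  proof -
    obtain B where B: "\<And>n. measure (M n) {x \<in> space (M n). B < d n (b n) x} < e" using tight_b[OF e] by blast
    \<comment> \<open>Discretization raises the distance from the root by at most
      \<open>\<epsilon> n\<close>, which is at most 1, and \<open>d n (b n) x\<close> also contains
      the nonnegative \<open>a n (b n)\<close>.\<close>
    have "measure (M n) {x \<in> space (M n). B + 1 < h n x} < e" for n
    proof (rule le_less_trans[OF M.finite_measure_mono B])
      show "{x \<in> space (M n). B + 1 < h n x} \<subseteq> {x \<in> space (M n). B < d n (b n) x}"
      proof safe
        fix x assume x: "x \<in> space (M n)" "B + 1 < h n x"
        then show "B < d n (b n) x" using fb[OF x(1)] a0[OF b, of n] \<epsilon>(2)[of n] by (simp add: h_def d_def)
      qed
      have "(\<lambda>x. d n (b n) x) \<in> borel_measurable (M n)"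
        using measurable_compose[OF measurable_Pair1'[OF b] dm, of n] by simp
      then show "{x \<in> space (M n). B < d n (b n) x} \<in> M.events n" by measurable
    qed
    then show ?thesis by blast
  qed
  define d' where "d' n x y = h n x + h n y - 2 * K n (f n x) (f n y)" for n x y
  have d'_eq: "d' n x y = \<rho> n (f n x) (f n y) + a n x + a n y" for n x y
    by (simp add: d'_def h_def K_def gromov_product_def field_simps)
  obtain k \<Omega> S H g where k: "strict_mono (k :: nat \<Rightarrow> nat)" and \<Omega>: "prob_space (\<Omega> :: real measure)"
    and SH: "S \<in> borel_measurable \<Omega>" "H \<in> borel_measurable \<Omega>" "distr \<Omega> borel S = unif"
    and g: "\<And>s t u. 0 < s \<Longrightarrow> s < t \<Longrightarrow> t < u \<Longrightarrow> u < 1 \<Longrightarrow> g s u = min (g s t) (g t u)"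
      "\<And>s t. 0 < s \<Longrightarrow> s < t \<Longrightarrow> t < 1 \<Longrightarrow> 0 \<le> g s t"
      "AE w in \<Omega>. \<forall>t. 0 < t \<longrightarrow> t < 1 \<longrightarrow> (S w < t \<longrightarrow> g (S w) t \<le> H w) \<and> (t < S w \<longrightarrow> g t (S w) \<le> H w)"
    and conv: "\<And>r F D. continuous_map (matrix_topology r) euclideanreal F \<Longrightarrow> bounded (F ` topspace (matrix_topology r)) \<Longrightarrow>
      (\<lambda>(x, y). D x y) \<in> borel_measurable (\<Omega> \<Otimes>\<^sub>M \<Omega>) \<Longrightarrow>
      (AE z in \<Omega> \<Otimes>\<^sub>M \<Omega>. D (fst z) (snd z) = H (fst z) + H (snd z) -
        2 * g (min (S (fst z)) (S (snd z))) (max (S (fst z)) (S (snd z)))) \<Longrightarrow>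
      (\<lambda>n. \<integral>x. F x \<partial>tau r (\<lambda>x y. h (k n) x + h (k n) y - 2 * K (k n) (f (k n) x) (f (k n) y)) (M (k n)))
        \<longlonglongrightarrow> (\<integral>x. F x \<partial>tau r D \<Omega>)"
  proof (rule coding_limit[OF prob Q(1) f, where K = K and h = h])
    fix n x y assume xy: "x \<in> Q n" "y \<in> Q n"
    show "K n x y = K n y x" using sym[OF Qs[OF xy(1)] Qs[OF xy(2)]] by (simp add: K_def gromov_product_def)
    show "0 \<le> K n x y"
      using tri[OF Qs[OF xy(1)] b Qs[OF xy(2)]] sym[OF b Qs[OF xy(1)]] by (simp add: K_def gromov_product_def)
    fix z assume z: "z \<in> Q n"
    show "min (K n x y) (K n y z) \<le> K n x z"
      unfolding K_def using tl[of n] b[of n] Qs[OF xy(1)] Qs[OF xy(2)] Qs[OF z] unfolding tree_like_def by blast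
  next
    fix n w assume w: "w \<in> space (M n)"
    show "K n (f n w) (f n w) \<le> h n w"
      using refl[OF fs[OF w]] a0[OF w] by (simp add: K_def h_def gromov_product_def)
  next
    show "h n \<in> borel_measurable (M n)" for n by (rule hm)
    show "\<exists>B. \<forall>n. measure (M n) {w \<in> space (M n). B < h n w} < e" if "0 < e" for e by (rule h_tight[OF that])
  qed blast
  obtain T :: "(nat \<Rightarrow> real) metric" and \<nu> D where T: "long_dendron T \<nu>"
    and D: "(\<lambda>(x, y). D x y) \<in> borel_measurable (\<Omega> \<Otimes>\<^sub>M \<Omega>)"
      "AE z in \<Omega> \<Otimes>\<^sub>M \<Omega>. D (fst z) (snd z) = H (fst z) + H (snd z) -
        2 * g (min (S (fst z)) (S (snd z))) (max (S (fst z)) (S (snd z)))"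
    and tauD: "\<And>r. tau r (dendron_dist T) \<nu> = tau r D \<Omega>"
    by (rule limit_dendron[OF \<Omega> SH g]) blast+
  have K2: "(\<lambda>z. K n (f n (fst z)) (f n (snd z))) \<in> borel_measurable (M n \<Otimes>\<^sub>M M n)" for n
  proof -
    have "(\<lambda>z. (f n (fst z), f n (snd z))) \<in> measurable (M n \<Otimes>\<^sub>M M n) (count_space (Q n) \<Otimes>\<^sub>M count_space (Q n))"
      using f by (intro measurable_Pair measurable_compose[OF measurable_fst] measurable_compose[OF measurable_snd])
    then have "(\<lambda>z. (f n (fst z), f n (snd z))) \<in> measurable (M n \<Otimes>\<^sub>M M n) (count_space (Q n \<times> Q n))"
      by (simp add: pair_measure_countable[OF countable_finite countable_finite] Q)
    from measurable_compose[OF this, of "\<lambda>q. K n (fst q) (snd q)" borel] show ?thesis by simp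
  qed
  have d'm: "(\<lambda>(x, y). d' n x y) \<in> borel_measurable (M n \<Otimes>\<^sub>M M n)" for n
    unfolding d'_def case_prod_beta using K2[of n] hm[of n] by measurable
  define Bad where "Bad n = {x \<in> space (M n). \<not> \<rho> n x (f n x) < \<epsilon> n}" for n
  have Bad: "Bad n \<in> sets (M n)" for n
  proof -
    have "(\<lambda>x. (x, f n x)) \<in> measurable (M n) (M n \<Otimes>\<^sub>M M n)"
      using measurable_compose[OF f[of n], of "\<lambda>x. x" "M n"] Q(2) by (intro measurable_Pair) auto
    from measurable_compose[OF this tree_space_measurable(1)[OF ts]]
    have "(\<lambda>x. \<rho> n x (f n x)) \<in> borel_measurable (M n)" by simp
    then show ?thesis unfolding Bad_def by measurable
  qed
  have diff: "(\<lambda>n. (\<integral>x. F x \<partial>tau r (d n) (M n)) - (\<integral>x. F x \<partial>tau r (d' n) (M n))) \<longlonglongrightarrow> 0"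
    if F: "continuous_map (matrix_topology r) euclideanreal F" "bounded (F ` topspace (matrix_topology r))" for r F
  proof (rule converging_together[OF prob dm d'm hm Bad _ \<epsilon>0 _ _ h_tight F])
    show "measure (M n) (Bad n) \<le> \<epsilon> n" for n using fbad[of n] by (simp add: Bad_def)
    fix n x y assume xy: "x \<in> space (M n)" "y \<in> space (M n)"
    have "\<bar>\<rho> n (f n x) (f n y) - \<rho> n x y\<bar> \<le> \<rho> n x (f n x) + \<rho> n y (f n y)"
      using tri[OF fs[OF xy(1)] xy(1) fs[OF xy(2)]] tri[OF xy(1) xy(2) fs[OF xy(2)]]
        tri[OF xy(1) fs[OF xy(1)] xy(2)] tri[OF fs[OF xy(1)] fs[OF xy(2)] xy(2)]
        sym[OF xy(1) fs[OF xy(1)]] sym[OF xy(2) fs[OF xy(2)]] by linarith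
    then show "\<bar>d' n x y - d n x y\<bar> \<le> 2 * \<epsilon> n" if "x \<notin> Bad n" "y \<notin> Bad n"
      using that xy by (simp add: d'_eq d_def Bad_def)
    have "\<rho> n (f n x) (f n y) \<le> \<rho> n (b n) (f n x) + \<rho> n (b n) (f n y)"
      using tri[OF fs[OF xy(1)] b fs[OF xy(2)]] sym[OF b fs[OF xy(1)]] by simp
    then show "\<bar>d' n x y\<bar> \<le> h n x + h n y"
      using nn[OF fs[OF xy(1)] fs[OF xy(2)]] a0[OF xy(1)] a0[OF xy(2)] by (simp add: d'_eq h_def)
  qed
  have "converges_to_dendron (d \<circ> k) (M \<circ> k) T \<nu>"
    unfolding converges_to_dendron_def weakly_converges_def
  proof (intro allI impI conjI)
    fix r :: nat
    show "tau r ((d \<circ> k) n) ((M \<circ> k) n) \<in> borel_prob_measures (matrix_topology r)" for n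
      using tau_borel_prob[OF prob dm] by simp
    show "tau r (dendron_dist T) \<nu> \<in> borel_prob_measures (matrix_topology r)"
      unfolding tauD by (rule tau_borel_prob[OF \<Omega> D(1)])
    fix F assume "continuous_map (matrix_topology r) euclideanreal F \<and> bounded (F ` topspace (matrix_topology r))"
    then have F: "continuous_map (matrix_topology r) euclideanreal F" "bounded (F ` topspace (matrix_topology r))" by auto
    have "(\<lambda>n. ((\<integral>x. F x \<partial>tau r (d (k n)) (M (k n))) - (\<integral>x. F x \<partial>tau r (d' (k n)) (M (k n)))) +
        (\<integral>x. F x \<partial>tau r (d' (k n)) (M (k n)))) \<longlonglongrightarrow> 0 + (\<integral>x. F x \<partial>tau r D \<Omega>)"
    proof (rule tendsto_add)
      show "(\<lambda>n. (\<integral>x. F x \<partial>tau r (d (k n)) (M (k n))) - (\<integral>x. F x \<partial>tau r (d' (k n)) (M (k n)))) \<longlonglongrightarrow> 0"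
        using LIMSEQ_subseq_LIMSEQ[OF diff[OF F] k] by (simp add: o_def)
      show "(\<lambda>n. \<integral>x. F x \<partial>tau r (d' (k n)) (M (k n))) \<longlonglongrightarrow> (\<integral>x. F x \<partial>tau r D \<Omega>)"
        using conv[OF F D] by (simp add: d'_def[abs_def])
    qed
    then show "(\<lambda>n. \<integral>x. F x \<partial>tau r ((d \<circ> k) n) ((M \<circ> k) n)) \<longlonglongrightarrow> (\<integral>x. F x \<partial>tau r (dendron_dist T) \<nu>)"
      unfolding tauD by simp
  qed
  then show ?thesis
    unfolding subseq_converges_to_some_dendron_def using k T by (auto simp: d_def[abs_def])
qed

theorem corollary6p3:
  shows "(\<forall>(c :: nat \<Rightarrow> real) (V :: nat \<Rightarrow> 'v set) E.
            (\<forall>n. 0 < c n \<and> finite_tree (V n) (E n)) \<and>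
            tight (\<lambda>n. distance_law (rescaled_dist (c n) (V n) (E n)) (uniform_count_measure (V n))) \<longrightarrow>
            subseq_converges_to_some_dendron
              (\<lambda>n. rescaled_dist (c n) (V n) (E n)) (\<lambda>n. uniform_count_measure (V n)))
       \<and> (\<forall>(T :: nat \<Rightarrow> 'a metric) \<mu>.
            (\<forall>n. measured_real_tree (T n) (\<mu> n)) \<and>
            tight (\<lambda>n. distance_law (mdist (T n)) (\<mu> n)) \<longrightarrow>
            subseq_converges_to_some_dendron (\<lambda>n. mdist (T n)) \<mu>)
       \<and> (\<forall>(T :: nat \<Rightarrow> 'b metric) \<nu>.
            (\<forall>n. long_dendron (T n) (\<nu> n)) \<and>
            tight (\<lambda>n. distance_law (dendron_dist (T n)) (\<nu> n)) \<longrightarrow>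
            subseq_converges_to_some_dendron (\<lambda>n. dendron_dist (T n)) \<nu>)"
proof (intro conjI allI impI; elim conjE)
  fix c :: "nat \<Rightarrow> real" and V :: "nat \<Rightarrow> 'v set" and E
  assume cVE: "\<forall>n. 0 < c n \<and> finite_tree (V n) (E n)"
    and tight: "tight (\<lambda>n. distance_law (rescaled_dist (c n) (V n) (E n)) (uniform_count_measure (V n)))"
  have "tree_space (uniform_count_measure (V n)) (rescaled_dist (c n) (V n) (E n)) (\<lambda>_. 0)" for n
    using cVE by (intro tree_space_finite_tree) auto
  from tight_tree_spaces_subseq_converge[OF this] tight
  show "subseq_converges_to_some_dendron
      (\<lambda>n. rescaled_dist (c n) (V n) (E n)) (\<lambda>n. uniform_count_measure (V n))" by simp
next
  fix T :: "nat \<Rightarrow> 'a metric" and \<mu>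
  assume T: "\<forall>n. measured_real_tree (T n) (\<mu> n)" and tight: "tight (\<lambda>n. distance_law (mdist (T n)) (\<mu> n))"
  have "tree_space (\<mu> n) (mdist (T n)) (\<lambda>_. 0)" for n
    using T by (intro tree_space_measured_real_tree) auto
  from tight_tree_spaces_subseq_converge[OF this] tight
  show "subseq_converges_to_some_dendron (\<lambda>n. mdist (T n)) \<mu>" by simp
next
  fix T :: "nat \<Rightarrow> 'b metric" and \<nu>
  assume T: "\<forall>n. long_dendron (T n) (\<nu> n)" and tight: "tight (\<lambda>n. distance_law (dendron_dist (T n)) (\<nu> n))"
  have "tree_space (\<nu> n) (\<lambda>p q. mdist (T n) (fst p) (fst q)) snd" for n
    using T by (intro tree_space_long_dendron) auto
  moreover have "(\<lambda>p q. mdist (T n) (fst p) (fst q) + snd p + snd q) = dendron_dist (T n)" for n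
    by (auto simp: dendron_dist_def fun_eq_iff)
  ultimately show "subseq_converges_to_some_dendron (\<lambda>n. dendron_dist (T n)) \<nu>"
    using tight_tree_spaces_subseq_converge[of \<nu> "\<lambda>n p q. mdist (T n) (fst p) (fst q)" "\<lambda>_. snd"] tight by simp
qed

end
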